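(* All zeros and poles of the meromorphic function $f$ are simple and lie in $]-\infty,0]$. The zeros of $f$ are exactly $\xi_0=0$ together with, for each $p=1,2,\dots$, exactly $2^{p-1}$ zeros $\xi_{p,1}<\xi_{p,2}<\cdots<\xi_{p,2^{p-1}}$ lying in the open interval $]-p-1,-p[$. The poles of $f$ are exactly the points $-l$ and $\xi_{p,k}-l$ for $l=1,2,\dots$, $p\ge1$, $1\le k\le 2^{p-1}$. The numbers $$\rho_0=\frac{1}{f'(0)},\qquad \rho_{p,k}=\frac{1}{f'(\xi_{p,k})}$$ are strictly positive, and for $z\in\mathbb C$ (away from poles) $$F(z)=\frac{\rho_0}{z+1}+\sum_{p=1}^\infty\sum_{k=1}^{2^{p-1}}\frac{\rho_{p,k}}{z+1-\xi_{p,k}},$$ $$f(z)=z\sum_{l=1}^\infty\left[\frac{\rho_0}{l(z+l)}+\sum_{p=1}^\infty\sum_{k=1}^{2^{p-1}}\frac{\rho_{p,k}}{(l-\xi_{p,k})(z+l-\xi_{p,k})}\right].$$ Moreover $\mu$ is absolutely continuous with respect to Lebesgue measure on $]0,1[$ with an increasing and convex density $$\mathcal D(t)=\rho_0+\sum_{p=1}^\infty\sum_{k=1}^{2^{p-1}}\rho_{p,k}\,t^{-\xi_{p,k}},\qquad 0<t<1.$$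
   Context: Let $(m_n)_{n\ge0}$ be the unique sequence of positive reals with $m_0=1$ and $(1+m_1+\cdots+m_n)\,m_n=1$ for $n\ge1$. It is a Hausdorff moment sequence: let $\mu$ be the unique probability measure on $[0,1]$ with $\int_0^1 t^n\,d\mu(t)=m_n$ for all $n\ge0$; it satisfies $\mu(\{0\})=\mu(\{1\})=0$. For $\Re z>0$ define $f(z)=\int_0^1\frac{1-t^z}{1-t}\,d\mu(t)$ and $F(z)=\int_0^1 t^z\,d\mu(t)$ (with $t^z:=0$ at $t=0$, $\frac{1-t^z}{1-t}:=z$ at $t=1$). These functions extend to meromorphic functions on $\mathbb C$, still denoted $f$ and $F$, satisfying $f(z+1)F(z)=1$ and $f(z)=f(z+1)-1/f(z+1)$ for $z\in\mathbb C$. *)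

theory Defs
  imports "HOL-Complex_Analysis.Complex_Analysis"
begin

definition mseq :: "nat \<Rightarrow> real" where
  "mseq = (THE m. m 0 = 1 \<and> (\<forall>n. 0 < m n) \<and>
                  (\<forall>n\<ge>1. (1 + (\<Sum>i=1..n. m i)) * m n = 1))"

definition mu :: "real measure" where
  "mu = (THE M. sets M = sets borel \<and> emeasure M UNIV = 1 \<and> emeasure M {0..1} = 1 \<and>
               (\<forall>n. (\<integral>t. t ^ n \<partial>M) = mseq n))"

text \<open>The defining integrals, for Re z > 0 (t powr z = 0 at t = 0;
  the integrand is z at t = 1).\<close>
definition f_int :: "complex \<Rightarrow> complex" where
  "f_int z = (\<integral>t. (if t = 1 then z else (1 - complex_of_real t powr z) / (1 - complex_of_real t)) \<partial>mu)"

definition F_int :: "complex \<Rightarrow> complex" where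
  "F_int z = (\<integral>t. complex_of_real t powr z \<partial>mu)"

text \<open>The meromorphic continuations to the whole plane, normalised so that they
  have no removable singularities (library convention: value 0 at poles).\<close>
definition f_mero :: "complex \<Rightarrow> complex" where
  "f_mero = (THE g. g nicely_meromorphic_on UNIV \<and> (\<forall>z. 0 < Re z \<longrightarrow> g z = f_int z))"

definition F_mero :: "complex \<Rightarrow> complex" where
  "F_mero = (THE g. g nicely_meromorphic_on UNIV \<and> (\<forall>z. 0 < Re z \<longrightarrow> g z = F_int z))"

end

theory Submission
  imports Defs "HOL-Probability.Probability"
begin

text \<open>
  With \<open>psi y = y - 1 / y\<close> and \<open>lam 0 = 0\<close>, \<open>lam n = 1 + m\<^sub>1 + \<dots> + m\<^sub>n\<^sub>-\<^sub>1\<close>, the recursion for the moments reads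
  \<open>psi (lam (n + 1)) = lam n\<close>. The rational functions \<open>f\<^sub>n z = psi\<^sup>n (lam n + z / lam (n + 1))\<close>
  interpolate \<open>lam\<close> at \<open>0\<close> and \<open>1\<close>, converge monotonically on the positive axis, and
  \<open>1 / f\<^sub>n\<close> has partial fractions with positive weights at points of \<open>]-\<infinity>, 0]\<close>. Hence
  \<open>1 / f\<^sub>n\<close> is a Stieltjes transform, tightness and Helly's theorem give a probability measure
  \<open>Q\<close> on \<open>[0, \<infinity>[\<close> with \<open>1 / f z = \<integral> (1 + s) / (z + s) dQ(s)\<close>, and \<open>f z = psi (f (z + 1))\<close>
  holds in the limit and extends \<open>f\<close> to the plane. Walking left by unit steps, each branch of
  \<open>f\<close> between consecutive poles is an increasing bijection onto the line, and \<open>psi\<close> splits it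
  into two such branches; this counts the zeros. Stieltjes inversion shows that \<open>Q\<close> is carried
  by the negatives of the zeros of \<open>f\<close>, with masses given by the residues of \<open>1 / f\<close>, which is
  the partial fraction expansion. The density \<open>\<integral> (1 + s) t\<^sup>s dQ(s)\<close> then has the moments
  \<open>m\<^sub>n\<close>, and the series of \<open>f\<close> is the telescoped functional equation.
\<close>

section \<open>The recursion\<close>


text \<open>Neither the existence of the measure with the moments m_n nor that of the continuations
  is assumed. Both are built from the recursion alone, and the definite descriptions are resolved
  only once explicit objects are available. The delicate point is the passage to the limit:
  compactness yields a subsequence, whereas the functional equation links the approximants n and n +
  1. Monotonicity in n, in opposite directions on the two sides of 1, makes the whole sequence
  converge and closes this gap. Tightness comes from a bound uniform in n, a consequence of the
  concavity of \<open>lam\<close>; the numerator 1 + s of the kernel turns the normalisation at 1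
  into total mass 1. Division by zero is used on purpose. Since 1 / 0 = 0 gives
  \<open>psi 0 = 0\<close>, the iterates of \<open>psi\<close> take the value 0 at poles, which is
  the library convention for meromorphic functions, and the functional equation holds at every
  point. The price is that a zero of f is recognised only together with the value one step to the
  right: if f z = 0, then z is a pole precisely when f (z + 1) = 0.\<close>

definition psi :: "'a::field \<Rightarrow> 'a" where
  "psi y = y - 1 / y"

text \<open>The positive solution y of \<open>psi y = c\<close>, that is, of y^2 - c y - 1 = 0. The
  two roots have product -1, so the negative one is \<open>c - psi_root c\<close>, which equals -1 /
  \<open>psi_root c\<close>.\<close>

definition psi_root :: "real \<Rightarrow> real" where
  "psi_root c = (c + sqrt (c\<^sup>2 + 4)) / 2"

fun lam :: "nat \<Rightarrow> real" where
  "lam 0 = 0"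
| "lam (Suc n) = psi_root (lam n)"

declare lam.simps(2) [simp del]

lemma psi_zero [simp]: "psi 0 = 0"
  by (simp add: psi_def)

lemma psi_of_real: "psi (of_real y) = (of_real (psi y) :: complex)"
  by (simp add: psi_def)

lemma psi_funpow_of_real: "(psi ^^ n) (of_real y) = (of_real ((psi ^^ n) y) :: complex)"
  by (induction n) (simp_all add: psi_of_real)

lemma psi_root_pos: "0 < psi_root c"
proof -
  have "\<bar>c\<bar> < sqrt (c\<^sup>2 + 4)" by (rule real_less_rsqrt) simp
  then show ?thesis by (simp add: psi_root_def)
qed

lemma psi_root_mult: "psi_root c * (psi_root c - c) = 1"
proof -
  have "psi_root c * (psi_root c - c) = ((sqrt (c\<^sup>2 + 4))\<^sup>2 - c\<^sup>2) / 4"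
    by (simp add: psi_root_def field_simps power2_eq_square)
  also have "\<dots> = 1" by simp
  finally show ?thesis .
qed

lemma inverse_psi_root: "1 / psi_root c = psi_root c - c"
  using psi_root_mult[of c] psi_root_pos[of c] by (simp add: field_simps)

lemma psi_psi_root [simp]: "psi (psi_root c) = c"
  by (simp add: psi_def inverse_psi_root)

lemma psi_root_gt: "c < psi_root c"
  using inverse_psi_root[of c] psi_root_pos[of c] by (smt (verit) zero_less_divide_1_iff)

lemma psi_mono: "0 < (x::real) \<Longrightarrow> x \<le> y \<Longrightarrow> psi x \<le> psi y"
  by (simp add: psi_def frac_le diff_mono)

lemma psi_strict_mono: "0 < (x::real) \<Longrightarrow> x < y \<Longrightarrow> psi x < psi y"
  by (smt (verit) psi_def frac_le)

lemma psi_root_mono: "c \<le> d \<Longrightarrow> psi_root c \<le> psi_root d"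
  using psi_strict_mono[of "psi_root d" "psi_root c"] psi_root_pos[of d] by fastforce

lemma psi_root_0 [simp]: "psi_root 0 = 1"
  by (simp add: psi_root_def)

lemma lam_1 [simp]: "lam (Suc 0) = 1"
  by (simp add: lam.simps)

lemma lam_Suc_pos: "0 < lam (Suc n)"
  by (simp add: lam.simps psi_root_pos)

lemma psi_lam: "psi (lam (Suc n)) = lam n"
  by (simp add: lam.simps)

lemma inverse_lam_Suc: "1 / lam (Suc n) = lam (Suc n) - lam n"
  by (simp add: lam.simps inverse_psi_root)

lemma lam_mono: "m \<le> n \<Longrightarrow> lam m \<le> lam n"
  by (rule lift_Suc_mono_le[of lam]) (use psi_root_gt in \<open>auto intro: less_imp_le simp: lam.simps\<close>)

lemma lam_nonneg: "0 \<le> lam n"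
  using lam_mono[of 0 n] by simp

text \<open>Each step of \<open>lam\<close> is the reciprocal of the new value, so the square grows
  by 1 + \<open>lam n\<close> / \<open>lam (Suc n)\<close>, which lies between 1 and 2. The lower
  bound makes \<open>lam\<close> diverge, as tightness requires; the upper bound controls the
  remainder of the telescoped series of f.\<close>

lemma lam_sq_bounds: "real n \<le> (lam n)\<^sup>2 \<and> (lam n)\<^sup>2 \<le> 2 * real n"
proof (induction n)
  case (Suc n)
  have e: "lam (Suc n) * (lam (Suc n) - lam n) = 1" by (simp add: lam.simps psi_root_mult)
  have "(lam (Suc n))\<^sup>2 - (lam n)\<^sup>2 = lam (Suc n) * (lam (Suc n) - lam n) + lam n * (lam (Suc n) - lam n)"
    by (simp add: power2_eq_square algebra_simps)
  moreover have "0 \<le> lam n * (lam (Suc n) - lam n)"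
    using lam_nonneg[of n] lam_mono[of n "Suc n"] by simp
  moreover have "lam n * (lam (Suc n) - lam n) \<le> lam (Suc n) * (lam (Suc n) - lam n)"
    using lam_mono[of n "Suc n"] by (intro mult_right_mono) auto
  ultimately show ?case using Suc e by simp
qed simp

lemma lam_ge_sqrt: "sqrt (real n) \<le> lam n"
  using lam_sq_bounds[of n] lam_nonneg[of n] by (simp add: real_le_lsqrt)

lemma lam_le_sqrt: "lam n \<le> sqrt (2 * real n)"
  using lam_sq_bounds[of n] by (simp add: real_le_rsqrt)

lemma lam_at_top: "filterlim lam at_top sequentially"
proof (rule filterlim_at_top_mono)
  show "filterlim (\<lambda>n. sqrt (real n)) at_top sequentially"
    by (rule filterlim_compose[OF sqrt_at_top filterlim_real_sequentially])
qed (simp add: lam_ge_sqrt)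

lemma psi_funpow_lam: "(psi ^^ n) (lam (n + k)) = lam k"
  by (induction n arbitrary: k) (simp_all add: funpow_Suc_right del: funpow.simps(2) add: psi_lam)

text \<open>\<open>psi\<close> is increasing on the positive axis and carries the half line from
  \<open>lam (Suc n)\<close> to the one from \<open>lam n\<close>. A point at or beyond
  \<open>lam n\<close> is therefore still positive before each of the n applications, and
  monotonicity survives all of them.\<close>

lemma psi_funpow_mono: "lam n \<le> x \<Longrightarrow> x \<le> y \<Longrightarrow> (psi ^^ n) x \<le> (psi ^^ n) y"
proof (induction n arbitrary: x y)
  case (Suc n)
  have "0 < x" using Suc.prems lam_Suc_pos[of n] by simp
  then have "lam n \<le> psi x" "psi x \<le> psi y"
    using psi_mono[of "lam (Suc n)" x] psi_mono[of x y] Suc.prems lam_Suc_pos[of n] psi_lam[of n] by auto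
  then show ?case using Suc.IH by (simp add: funpow_Suc_right del: funpow.simps(2))
qed simp

lemma psi_funpow_pos: "lam n < x \<Longrightarrow> 0 < (psi ^^ n) x"
proof (induction n arbitrary: x)
  case (Suc n)
  have "lam n < psi x"
    using psi_strict_mono[of "lam (Suc n)" x] Suc.prems lam_Suc_pos[of n] psi_lam[of n] by auto
  then show ?case using Suc.IH by (simp add: funpow_Suc_right del: funpow.simps(2))
qed simp

text \<open>The poles are the two preimages r and c - r of c, and the residues are 1 / psi'(r) and 1
  / psi'(c - r); both are positive as psi' = 1 + 1 / y^2. The relation r (r - c) = 1 brings them
  into the stated form.\<close>

lemma inverse_psi_minus:
  assumes "psi_root c < y"
  defines "r \<equiv> psi_root c"
  shows "1 / (psi y - c) = (r / (2 * r - c)) / (y - r) + ((r - c) / (2 * r - c)) / (y - (c - r))"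
proof -
  have r: "r * (r - c) = 1" "0 < r" "c < r" "r < y"
    using psi_root_mult psi_root_pos psi_root_gt assms by (auto simp: r_def)
  have "y * (psi y - c) = y\<^sup>2 - c * y - 1"
    using r by (simp add: psi_def field_simps power2_eq_square)
  also have "\<dots> = (y - r) * (y - (c - r))"
    using r(1) by (simp add: algebra_simps power2_eq_square)
  finally have "1 / (psi y - c) = y / ((y - r) * (y - (c - r)))"
    using r by (metis divide_divide_eq_left div_self mult.commute order_less_asym order_less_trans)
  also have "\<dots> = (r / (2 * r - c)) / (y - r) + ((r - c) / (2 * r - c)) / (y - (c - r))"
  proof -
    have nz: "2 * r - c \<noteq> 0" "y - r \<noteq> 0" "y - (c - r) \<noteq> 0"
      using r by auto
    have "(r / (2 * r - c)) / (y - r) + ((r - c) / (2 * r - c)) / (y - (c - r))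
       = (r * (y - (c - r)) + (r - c) * (y - r)) / ((2 * r - c) * ((y - r) * (y - (c - r))))"
      using nz by (simp add: divide_simps)
    also have "r * (y - (c - r)) + (r - c) * (y - r) = (2 * r - c) * y"
      by (simp add: algebra_simps)
    finally show ?thesis using nz by simp
  qed
  finally show ?thesis .
qed

text \<open>The induction substitutes \<open>psi y\<close> for y, and each simple fraction splits
  into two with positive weights. A list avoids merging fractions with equal poles; the bound on the
  poles keeps y to the right of all of them.\<close>

lemma inverse_psi_funpow:
  "\<exists>L :: (real \<times> real) list. (\<forall>(w, a)\<in>set L. 0 < w \<and> a \<le> lam n) \<and>
     (\<forall>y>lam n. 1 / (psi ^^ n) y = (\<Sum>(w, a)\<leftarrow>L. w / (y - a)))"
proof (induction n)
  case 0
  show ?case by (rule exI[of _ "[(1, 0)]"]) simp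
next
  case (Suc n)
  then obtain L where "\<forall>(w, a)\<in>set L. 0 < w \<and> a \<le> lam n"
    "\<forall>y>lam n. 1 / (psi ^^ n) y = (\<Sum>(w, a)\<leftarrow>L. w / (y - a))"
    by blast
  then have L: "\<And>w a. (w, a) \<in> set L \<Longrightarrow> 0 < w \<and> a \<le> lam n"
    "\<And>y. y > lam n \<Longrightarrow> 1 / (psi ^^ n) y = (\<Sum>(w, a)\<leftarrow>L. w / (y - a))"
    by auto
  \<comment> \<open>\<open>f\<close> takes a fraction to its part at the positive preimage of the
    pole, \<open>g\<close> to its part at the negative one.\<close>
  define f where "f = (\<lambda>(w, a). (w * (psi_root a / (2 * psi_root a - a)), psi_root a))"
  define g where "g = (\<lambda>(w, a). (w * ((psi_root a - a) / (2 * psi_root a - a)), a - psi_root a))"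
  have nz: "2 * psi_root a - a > 0" for a
    using psi_root_gt[of a] psi_root_pos[of a] by simp
  show ?case
  proof (intro exI[of _ "map f L @ map g L"] conjI allI impI)
    show "\<forall>(w, a)\<in>set (map f L @ map g L). 0 < w \<and> a \<le> lam (Suc n)"
    proof safe
      fix w a assume wa: "(w, a) \<in> set (map f L @ map g L)"
      then obtain w' a' where h: "(w', a') \<in> set L" "(w, a) = f (w', a') \<or> (w, a) = g (w', a')"
        by auto
      have "0 < w'" "a' \<le> lam n" using L h by auto
      with h show "0 < w"
        using nz[of a'] psi_root_pos[of a'] psi_root_gt[of a'] by (auto simp: f_def g_def)
      have "psi_root a' \<le> lam (Suc n)" using \<open>a' \<le> lam n\<close> psi_root_mono by (simp add: lam.simps)
      moreover have "a' - psi_root a' \<le> lam (Suc n)" using psi_root_gt[of a'] lam_Suc_pos[of n] by simp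
      ultimately show "a \<le> lam (Suc n)" using h by (auto simp: f_def g_def)
    qed
    fix y :: real assume y: "y > lam (Suc n)"
    then have "psi y > lam n"
      using psi_strict_mono[of "lam (Suc n)" y] lam_Suc_pos[of n] psi_lam[of n] by simp
    then have "1 / (psi ^^ Suc n) y = (\<Sum>(w, a)\<leftarrow>L. w / (psi y - a))"
      using L(2)[of "psi y"] by (simp add: funpow_Suc_right del: funpow.simps(2))
    also have "\<dots> = (\<Sum>p\<leftarrow>L. (case f p of (w, a) \<Rightarrow> w / (y - a)) + (case g p of (w, a) \<Rightarrow> w / (y - a)))"
    proof (intro arg_cong[where f = sum_list] map_cong refl, clarify)
      fix w a assume "(w, a) \<in> set L"
      then have "psi_root a < y" using L y psi_root_mono[of a "lam n"] by (fastforce simp: lam.simps)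
      then have "w * (1 / (psi y - a)) = 
         w * ((psi_root a / (2 * psi_root a - a)) / (y - psi_root a) + ((psi_root a - a) / (2 * psi_root a - a)) / (y - (a - psi_root a)))"
        using inverse_psi_minus by metis
      then show "w / (psi y - a) = (case f (w, a) of (w, a) \<Rightarrow> w / (y - a)) + (case g (w, a) of (w, a) \<Rightarrow> w / (y - a))"
        by (simp add: f_def g_def distrib_left)
    qed
    also have "\<dots> = (\<Sum>(w, a)\<leftarrow>map f L @ map g L. w / (y - a))"
      by (simp add: sum_list_addf comp_def)
    finally show "1 / (psi ^^ Suc n) y = (\<Sum>(w, a)\<leftarrow>map f L @ map g L. w / (y - a))" .
  qed
qed

section \<open>Rational approximants\<close>

text \<open>The argument is the affine function through \<open>lam n\<close> at 0 and
  \<open>lam (Suc n)\<close> at 1, because the step of \<open>lam\<close> is 1 /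
  \<open>lam (Suc n)\<close>; applying \<open>psi\<close> n times undoes the shift by n.\<close>

definition fapp :: "nat \<Rightarrow> real \<Rightarrow> real" where
  "fapp n x = (psi ^^ n) (lam n + x / lam (Suc n))"

lemma fapp_one: "fapp n 1 = 1"
  using psi_funpow_lam[of n 1] inverse_lam_Suc[of n] by (simp add: fapp_def)

lemma fapp_pos: "0 < x \<Longrightarrow> 0 < fapp n x"
  unfolding fapp_def by (rule psi_funpow_pos) (use lam_Suc_pos[of n] in simp)

lemma fapp_mono: "0 \<le> x \<Longrightarrow> x \<le> y \<Longrightarrow> fapp n x \<le> fapp n y"
  unfolding fapp_def using lam_Suc_pos[of n]
  by (intro psi_funpow_mono) (simp_all add: divide_right_mono)

text \<open>At x = 1 both sides equal \<open>lam (Suc n)\<close>. The difference u - v is a positive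
  multiple of 1 / (l (l + x d)) - 1 / (l (l + d)), so its sign changes exactly there; hence the
  approximants increase with n on ]0, 1] and decrease beyond 1.\<close>

lemma psi_lam_step:
  fixes n :: nat
  assumes "0 < x"
  defines "u \<equiv> psi (lam (Suc n) + x / lam (Suc (Suc n)))" and "v \<equiv> lam n + x / lam (Suc n)"
  shows "x \<le> 1 \<Longrightarrow> v \<le> u" "1 \<le> x \<Longrightarrow> u \<le> v"
proof -
  define l l' where "l = lam (Suc n)" and "l' = lam (Suc (Suc n))"
  have l: "0 < l" "0 < l'" "l' * (l' - l) = 1" "lam n = l - 1 / l"
    using lam_Suc_pos[of n] lam_Suc_pos[of "Suc n"] psi_root_mult psi_lam[of n]
    by (simp_all add: l_def l'_def psi_def lam.simps(2)[of "Suc n"] del: psi_psi_root)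
  define d where "d = 1 / l'"
  have d: "0 < d" "l' = l + d" "d * (l + d) = 1" using l by (auto simp: d_def field_simps)
  \<comment> \<open>Since l + d = 1 / d, this writes 1 / l as the value at x = 1 of the expression d
    (1 + 1 / (l (l + x d))) that occurs in u - v.\<close>
  have dd: "1 / l = d * (1 + 1 / (l * (l + d)))"
  proof -
    have "1 / (l + d) = d" using d(3) by (metis mult_zero_right nonzero_eq_divide_eq zero_neq_one)
    moreover have "1 / (l * (l + d)) = 1 / (l + d) / l" by (simp add: mult.commute)
    ultimately have "1 / (l * (l + d)) = d / l" by simp
    then have "d * (1 + 1 / (l * (l + d))) = (d * (l + d)) / l" using l(1) by (simp add: distrib_left add_divide_distrib)
    then show ?thesis using d(3) by simp
  qed
  have u: "u = l + x * d - 1 / (l + x * d)" by (simp add: u_def psi_def l_def l'_def d_def)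
  have v: "v = l - 1 / l + x / l" by (simp only: v_def l(4) l_def[symmetric])
  have p: "0 < l + x * d" using l d assms by (simp add: add_pos_pos)
  then have "1 / l - 1 / (l + x * d) = x * d / (l * (l + x * d))" using l by (simp add: field_simps)
  then have "u - v = x * d + x * d / (l * (l + x * d)) - x / l"
    unfolding u v by linarith
  also have "\<dots> = x * (d * (1 + 1 / (l * (l + x * d))) - 1 / l)"
    by (simp only: right_diff_distrib distrib_left mult_1_right mult.assoc times_divide_eq_right)
  also have "\<dots> = x * d * (1 / (l * (l + x * d)) - 1 / (l * (l + d)))"
    unfolding dd by (simp add: algebra_simps)
  finally have uv: "u - v = x * d * (1 / (l * (l + x * d)) - 1 / (l * (l + d)))" .
  { assume "x \<le> 1"
    then have "1 / (l * (l + d)) \<le> 1 / (l * (l + x * d))"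
      using l d p by (intro divide_left_mono mult_left_mono mult_pos_pos) auto
    then show "v \<le> u" using uv assms d by (metis diff_ge_0_iff_ge mult_nonneg_nonneg less_imp_le) }
  { assume "1 \<le> x"
    then have "1 / (l * (l + d)) \<ge> 1 / (l * (l + x * d))"
      using l d p by (intro divide_left_mono mult_left_mono mult_pos_pos) auto
    then have "u - v \<le> 0" unfolding uv using assms d by (intro mult_nonneg_nonpos) auto
    then show "u \<le> v" by simp }
qed

lemma fapp_Suc: "fapp (Suc n) x = (psi ^^ n) (psi (lam (Suc n) + x / lam (Suc (Suc n))))"
  by (simp add: fapp_def funpow_Suc_right del: funpow.simps(2))

lemma fapp_incseq: "0 < x \<Longrightarrow> x \<le> 1 \<Longrightarrow> fapp n x \<le> fapp (Suc n) x"
  unfolding fapp_Suc unfolding fapp_def using psi_lam_step[of x n] lam_Suc_pos[of n]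
  by (intro psi_funpow_mono) auto

lemma fapp_decseq: "1 \<le> x \<Longrightarrow> fapp (Suc n) x \<le> fapp n x"
proof -
  assume x: "1 \<le> x"
  have "lam (Suc n) \<le> lam (Suc n) + x / lam (Suc (Suc n))"
    using x lam_Suc_pos[of "Suc n"] by simp
  then have "lam n \<le> psi (lam (Suc n) + x / lam (Suc (Suc n)))"
    using psi_mono[OF lam_Suc_pos, of n] psi_lam[of n] by metis
  then show ?thesis
    unfolding fapp_Suc unfolding fapp_def using psi_lam_step[of x n] x
    by (intro psi_funpow_mono) auto
qed

text \<open>\<open>lam\<close> is concave, its steps being reciprocals of increasing numbers, so the
  affine interpolant at k lies above \<open>lam (n + k)\<close>. The bound does not depend on n,
  which is what tightness needs.\<close>

lemma fapp_ge_lam: "lam k \<le> fapp n (real k)"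
proof -
  have "lam (n + k) \<le> lam n + real k / lam (Suc n)"
  proof (induction k)
    case (Suc k)
    have "1 / lam (Suc (n + k)) \<le> 1 / lam (Suc n)"
      using lam_mono[of "Suc n" "Suc (n + k)"] lam_Suc_pos[of n] by (intro divide_left_mono) (auto simp: lam_Suc_pos)
    then show ?case using Suc inverse_lam_Suc[of "n + k"] by (simp add: add_divide_distrib)
  qed simp
  then have "(psi ^^ n) (lam (n + k)) \<le> fapp n (real k)"
    unfolding fapp_def using lam_mono[of n "n + k"] by (intro psi_funpow_mono) auto
  then show ?thesis by (simp add: psi_funpow_lam)
qed

lemma fapp_tendsto:
  assumes "0 < x"
  shows "\<exists>L>0. (\<lambda>n. fapp n x) \<longlonglongrightarrow> L"
proof (cases "x \<le> 1")
  case True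
  have "incseq (\<lambda>n. fapp n x)" using fapp_incseq assms True by (intro incseq_SucI) auto
  moreover have "fapp n x \<le> 1" for n using fapp_mono[of x 1 n] assms True by (simp add: fapp_one)
  ultimately obtain L where L: "(\<lambda>n. fapp n x) \<longlonglongrightarrow> L" "\<forall>i. fapp i x \<le> L"
    using incseq_convergent by blast
  then have "0 < L" using fapp_pos[OF assms, of 0] by (meson less_le_trans)
  with L show ?thesis by blast
next
  case False
  have "decseq (\<lambda>n. fapp n x)" using fapp_decseq False by (intro decseq_SucI) auto
  moreover have ge: "1 \<le> fapp n x" for n using fapp_mono[of 1 x n] False by (simp add: fapp_one)
  ultimately obtain L where L: "(\<lambda>n. fapp n x) \<longlonglongrightarrow> L"
    using decseq_convergent by blast
  moreover have "1 \<le> L" by (rule LIMSEQ_le_const[OF L]) (use ge in auto)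
  ultimately show ?thesis by (meson less_le_trans zero_less_one)
qed

text \<open>The substitution y = \<open>lam n\<close> + x / l turns w / (y - a) into l w / (x + s)
  with s = l (\<open>lam n\<close> - a), and the weights l w / (1 + s) have sum 1 because
  \<open>fapp n 1 = 1\<close>. The truncation \<open>max 0 s\<close> makes the kernel continuous and
  bounded on the whole line, as weak convergence demands; the null set \<open>{..-1}\<close> enters
  the tightness estimate.\<close>

lemma inverse_fapp_measure:
  "\<exists>M. real_distribution M \<and> measure M {..-1} = 0 \<and>
     (\<forall>x>0. 1 / fapp n x = (\<integral>s. (1 + max 0 s) / (x + max 0 s) \<partial>M))"
proof -
  define l where "l = lam (Suc n)"
  have l: "0 < l" using lam_Suc_pos by (simp add: l_def)
  obtain L where "\<forall>(w, a)\<in>set L. 0 < w \<and> a \<le> lam n"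
    and L: "\<forall>y>lam n. 1 / (psi ^^ n) y = (\<Sum>(w, a)\<leftarrow>L. w / (y - a))"
    using inverse_psi_funpow by blast
  then have L': "0 < fst (L ! i)" "snd (L ! i) \<le> lam n" if "i < length L" for i
    using that by (metis (mono_tags, lifting) case_prod_beta nth_mem)+
  define s where "s = (\<lambda>i. l * (lam n - snd (L ! i)))"
  define w where "w = (\<lambda>i. l * fst (L ! i) / (1 + s i))"
  have s: "0 \<le> s i" if "i < length L" for i using L'(2)[OF that] l by (simp add: s_def)
  have w: "0 < w i" if "i < length L" for i using L'(1)[OF that] l s[OF that] by (simp add: w_def add_pos_nonneg)
  define P where "P = point_measure {..<length L} (\<lambda>i. ennreal (w i))"
  have int_P: "(\<integral>i. h i \<partial>P) = (\<Sum>i<length L. w i * h i)" for h :: "nat \<Rightarrow> real"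
    unfolding P_def by (subst lebesgue_integral_point_measure_finite) (auto intro: less_imp_le w)
  have rep: "1 / fapp n x = (\<Sum>i<length L. w i * ((1 + s i) / (x + s i)))" if "0 < x" for x
  proof -
    have "1 / fapp n x = (\<Sum>(w, a)\<leftarrow>L. w / (lam n + x / l - a))"
      unfolding fapp_def l_def using L that lam_Suc_pos[of n] by simp
    also have "\<dots> = (\<Sum>i<length L. fst (L ! i) / (lam n + x / l - snd (L ! i)))"
      by (simp add: sum_list_sum_nth case_prod_beta atLeast0LessThan)
    also have "\<dots> = (\<Sum>i<length L. w i * ((1 + s i) / (x + s i)))"
    proof (rule sum.cong)
      fix i assume "i \<in> {..<length L}"
      then have i: "i < length L" by simp
      have "l * (lam n + x / l - snd (L ! i)) = x + s i" using l by (simp add: s_def field_simps)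
      then have "fst (L ! i) / (lam n + x / l - snd (L ! i)) = l * fst (L ! i) / (x + s i)"
        using l by (metis mult_divide_mult_cancel_left_if less_irrefl)
      also have "\<dots> = w i * ((1 + s i) / (x + s i))" using s[OF i] by (simp add: w_def)
      finally show "fst (L ! i) / (lam n + x / l - snd (L ! i)) = w i * ((1 + s i) / (x + s i))" .
    qed simp
    finally show ?thesis .
  qed
  have sum1: "(\<Sum>i<length L. w i) = 1"
  proof -
    have "(\<Sum>i<length L. w i) = (\<Sum>i<length L. w i * ((1 + s i) / (1 + s i)))"
      using s by (intro sum.cong) (auto simp: add_pos_nonneg less_imp_neq[symmetric])
    also have "\<dots> = 1" using rep[of 1] by (simp add: fapp_one)
    finally show ?thesis .
  qed
  have sP: "sets P = sets (count_space {..<length L})" "space P = {..<length L}"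
    by (simp_all add: P_def sets_point_measure space_point_measure)
  have smeas [measurable]: "s \<in> borel_measurable P"
    using sP by (simp add: measurable_def)
  interpret P: prob_space P
  proof
    have "emeasure P (space P) = (\<Sum>i<length L. ennreal (w i))"
      unfolding P_def by (simp add: emeasure_point_measure_finite space_point_measure)
    also have "\<dots> = ennreal (\<Sum>i<length L. w i)" by (rule sum_ennreal) (auto intro: less_imp_le w)
    finally show "emeasure P (space P) = 1" using sum1 by simp
  qed
  define M where "M = distr P borel s"
  interpret M: real_distribution M
    unfolding M_def by (rule P.real_distribution_distr) simp
  have "measure M {..-1} = measure P (s -` {..-1} \<inter> space P)"
    unfolding M_def by (rule measure_distr) auto
  also have "s -` {..-1} \<inter> space P = {}" using s sP by fastforce
  finally have "measure M {..-1} = 0" by simp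
  moreover have "1 / fapp n x = (\<integral>s. (1 + max 0 s) / (x + max 0 s) \<partial>M)" if "0 < x" for x
  proof -
    have "(\<integral>s. (1 + max 0 s) / (x + max 0 s) \<partial>M) = (\<integral>i. (1 + max 0 (s i)) / (x + max 0 (s i)) \<partial>P)"
      unfolding M_def by (rule integral_distr) auto
    also have "\<dots> = 1 / fapp n x"
      unfolding int_P rep[OF that] using s by (intro sum.cong) auto
    finally show ?thesis by simp
  qed
  ultimately show ?thesis using M.real_distribution_axioms by blast
qed

section \<open>Weak limit of the approximating measures\<close>

lemma stieltjes_kernel_bound:
  fixes s x :: real
  assumes "0 \<le> s" "0 < x"
  shows "(1 + s) / (x + s) \<le> max 1 (1 / x)"
proof (cases "x \<le> 1")
  case True
  have "x * (1 + s) \<le> x + s" using assms True mult_right_mono[of x 1 s] by (simp add: distrib_left)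
  then have "(1 + s) / (x + s) \<le> 1 / x" using assms by (simp add: field_simps)
  then show ?thesis by simp
next
  case False
  then have "(1 + s) / (x + s) \<le> 1" using assms by simp
  then show ?thesis by simp
qed

lemma psi_tendsto: "(g \<longlongrightarrow> L) F \<Longrightarrow> L \<noteq> 0 \<Longrightarrow> ((\<lambda>x. psi (g x)) \<longlongrightarrow> psi L) F"
  for L :: "'a::real_normed_field"
  unfolding psi_def by (intro tendsto_intros)

text \<open>This is the factor by which the argument is rescaled when the shift by 1 turns
  \<open>fapp n\<close> into \<open>fapp (Suc n)\<close>; the right-hand side shows that it tends to
  1.\<close>

lemma lam_ratio: "lam (Suc (Suc n)) / lam (Suc n) = 1 + 1 / (lam (Suc n) * lam (Suc (Suc n)))"
proof -
  define l l' where "l = lam (Suc n)" and "l' = lam (Suc (Suc n))"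
  have l: "0 < l" "1 / l' = l' - l"
    unfolding l_def l'_def by (rule lam_Suc_pos, rule inverse_lam_Suc)
  have "1 / (l * l') = (1 / l') / l" by simp
  also have "\<dots> = l' / l - 1" unfolding l(2) using l(1) by (simp only: diff_divide_distrib) simp
  finally show ?thesis by (simp add: l_def l'_def)
qed

lemma fixed_point_measure_exists:
  "\<exists>Q. real_distribution Q \<and> (AE s in Q. 0 \<le> s) \<and>
     (\<forall>x>0. 1 / (\<integral>s. (1 + s) / (x + s) \<partial>Q) = psi (1 / (\<integral>s. (1 + s) / (x + 1 + s) \<partial>Q)))"
proof -
  define K where "K = (\<lambda>x s :: real. (1 + max 0 s) / (x + max 0 s))"
  have K_cont: "isCont (K x) s" if "0 < x" for x s
    unfolding K_def using that by (intro continuous_intros) auto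
  have K_meas [measurable]: "K x \<in> borel_measurable borel" for x
    unfolding K_def by measurable
  have K_bound: "norm (K x s) \<le> max 1 (1 / x)" if "0 < x" for x s
    unfolding K_def using stieltjes_kernel_bound[of "max 0 s" x] that by simp
  have K_nonneg: "0 \<le> K x s" if "0 < x" for x s
    unfolding K_def using that by simp
  \<comment> \<open>This yields that \<open>fapp n (c * x)\<close> is at most c times
    \<open>fapp n x\<close>, the upper half of the later squeeze.\<close>
  have K_scale: "K x s \<le> c * K (c * x) s" if "0 < x" "1 \<le> c" for x c s
  proof -
    have "c * x + max 0 s \<le> c * (x + max 0 s)"
      using that mult_right_mono[of 1 c "max 0 s"] by (simp add: algebra_simps)
    moreover have "0 < c * x + max 0 s" using that by (intro add_pos_nonneg) auto
    ultimately have "c * (1 + max 0 s) / (c * (x + max 0 s)) \<le> c * (1 + max 0 s) / (c * x + max 0 s)"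
      using that by (intro divide_left_mono mult_pos_pos) auto
    then show ?thesis using that by (simp add: K_def)
  qed
  obtain M where M: "\<And>n. real_distribution (M n)" "\<And>n. measure (M n) {..-1} = 0"
    "\<And>n x. 0 < x \<Longrightarrow> 1 / fapp n x = (\<integral>s. K x s \<partial>M n)"
    using inverse_fapp_measure unfolding K_def by metis
  have K_int: "integrable N (K x)" if "real_distribution N" "0 < x" for N x
  proof -
    interpret N: real_distribution N by fact
    show ?thesis using K_bound[OF that(2)]
      by (intro N.integrable_const_bound[where B = "max 1 (1 / x)"] AE_I2) auto
  qed

  \<comment> \<open>On s > k the kernel at x = k is at least 1 / 2, so the mass beyond k is at most
    2 / \<open>fapp n (real k)\<close>, hence at most 2 / \<open>lam k\<close>, uniformly in
    n.\<close>
  have "tight M"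
    unfolding tight_def
  proof (intro conjI allI impI M(1))
    fix \<epsilon> :: real assume "0 < \<epsilon>"
    have "filterlim lam at_top sequentially" by (rule lam_at_top)
    then have "eventually (\<lambda>k. lam k > 2 / \<epsilon>) sequentially" by (simp add: filterlim_at_top_dense)
    then obtain k where k: "lam k > 2 / \<epsilon>" "k \<ge> 1"
      by (metis (mono_tags, lifting) eventually_sequentially le_cases order_trans)
    show "\<exists>a b::real. a < b \<and> (\<forall>n. measure (M n) {a<..b} > 1 - \<epsilon>)"
    proof (rule exI[of _ "-1"], rule exI[of _ "real k"], intro conjI allI)
      fix n
      interpret N: real_distribution "M n" by (rule M)
      have k0: "0 < real k" using k by simp
      have "0 < 2 / \<epsilon>" using \<open>0 < \<epsilon>\<close> by simp
      then have lk: "0 < lam k" using k by linarith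
      have "measure (M n) {real k<..} / 2 = (\<integral>s. indicator {real k<..} s / 2 \<partial>M n)"
        by simp
      also have "\<dots> \<le> (\<integral>s. K (real k) s \<partial>M n)"
      proof (rule integral_mono)
        fix s show "indicator {real k<..} s / 2 \<le> K (real k) s"
          using k K_nonneg[OF k0, of s] by (auto simp: indicator_def K_def field_simps)
      next
        show "integrable (M n) (\<lambda>s. indicator {real k<..} s / 2 :: real)"
          by (intro integrable_divide integrable_real_indicator) (auto simp: less_top[symmetric])
      qed (rule K_int[OF M(1) k0])
      also have "\<dots> = 1 / fapp n (real k)" using M(3) k0 by simp
      also have "\<dots> \<le> 1 / lam k"
        using fapp_ge_lam[of k n] lk by (intro divide_left_mono mult_pos_pos) auto
      also have "\<dots> < \<epsilon> / 2"
        using k(1) \<open>0 < \<epsilon>\<close> lk by (simp add: field_simps)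
      finally have t: "measure (M n) {real k<..} < \<epsilon>" by simp
      have "measure (M n) ({..-1} \<union> {-1<..real k} \<union> {real k<..})
          \<le> measure (M n) ({..-1} \<union> {-1<..real k}) + measure (M n) {real k<..}"
        by (rule measure_Un_le) auto
      moreover have "measure (M n) ({..-1} \<union> {-1<..real k}) \<le> measure (M n) {..-1} + measure (M n) {-1<..real k}"
        by (rule measure_Un_le) auto
      moreover have "{..-1} \<union> {-1<..real k} \<union> {real k<..} = UNIV" by auto
      moreover have "measure (M n) UNIV = 1" using N.prob_space by simp
      ultimately show "1 - \<epsilon> < measure (M n) {-1<..real k}" using t M(2)[of n] by simp
    qed (use k in simp)
  qed
  from tight_imp_convergent_subsubsequence[OF this strict_mono_id]
  obtain r Q where r: "strict_mono (r :: nat \<Rightarrow> nat)" and Q: "real_distribution Q" and conv: "weak_conv_m (M \<circ> r) Q"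
    by (auto simp: comp_def id_def)
  interpret Q: real_distribution Q by (rule Q)
  define g where "g = (\<lambda>x. \<integral>s. K x s \<partial>Q)"
  \<comment> \<open>The limit over all n exists by \<open>fapp_tendsto\<close>; the subsequence only
    identifies it as 1 / \<open>g x\<close>.\<close>
  have conv_g: "(\<lambda>n. fapp n x) \<longlonglongrightarrow> 1 / g x" and g_nz: "g x \<noteq> 0" if x: "0 < x" for x
  proof -
    obtain L where L: "L > 0" "(\<lambda>n. fapp n x) \<longlonglongrightarrow> L" using fapp_tendsto[OF x] by blast
    then have "(\<lambda>k. 1 / fapp (r k) x) \<longlonglongrightarrow> 1 / L"
      using LIMSEQ_subseq_LIMSEQ[OF L(2) r] by (intro tendsto_divide) (auto simp: comp_def)
    moreover have "(\<lambda>k. integral\<^sup>L ((M \<circ> r) k) (K x)) \<longlonglongrightarrow> integral\<^sup>L Q (K x)"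
      by (rule weak_conv_imp_integral_bdd_continuous_conv[OF _ Q conv])
         (use M(1) K_cont[OF x] K_bound[OF x] in auto)
    then have "(\<lambda>k. 1 / fapp (r k) x) \<longlonglongrightarrow> g x"
      using M(3)[OF x] by (simp add: g_def comp_def)
    ultimately have "g x = 1 / L" using LIMSEQ_unique by blast
    then show "(\<lambda>n. fapp n x) \<longlonglongrightarrow> 1 / g x" "g x \<noteq> 0" using L by auto
  qed
  have fun_eq: "1 / g x = psi (1 / g (x + 1))" if x: "0 < x" for x
  proof -
    define c where "c = (\<lambda>n. lam (Suc (Suc n)) / lam (Suc n))"
    have c1: "1 \<le> c n" for n
      using lam_mono[of "Suc n" "Suc (Suc n)"] lam_Suc_pos[of n] by (simp add: c_def)
    have "c = (\<lambda>n. 1 + 1 / (lam (Suc n) * lam (Suc (Suc n))))"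
      unfolding c_def by (rule ext) (rule lam_ratio)
    moreover have "(\<lambda>n. 1 + 1 / (lam (Suc n) * lam (Suc (Suc n)))) \<longlonglongrightarrow> 1 + 0"
    proof (intro tendsto_add tendsto_const)
      have "filterlim (\<lambda>n. lam (Suc n)) at_top sequentially" "filterlim (\<lambda>n. lam (Suc (Suc n))) at_top sequentially"
        using lam_at_top filterlim_sequentially_Suc[of lam at_top] filterlim_sequentially_Suc[of "\<lambda>n. lam (Suc n)" at_top]
        by (simp_all only:)
      from filterlim_at_top_mult_at_top[OF this]
      show "(\<lambda>n. 1 / (lam (Suc n) * lam (Suc (Suc n)))) \<longlonglongrightarrow> 0"
        using tendsto_inverse_0_at_top by (simp add: inverse_eq_divide)
    qed
    ultimately have c: "c \<longlonglongrightarrow> 1" by simp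
    have scale: "fapp n (a * x) \<le> a * fapp n x" if a: "1 \<le> a" for n a
    proof -
      have ax: "0 < a * x" using a x by simp
      have "1 / fapp n x \<le> (\<integral>s. a * K (a * x) s \<partial>M n)"
        unfolding M(3)[OF x] using K_scale[OF x a] K_int[OF M(1)] x ax by (intro integral_mono) auto
      also have "\<dots> = a * (1 / fapp n (a * x))" using M(3)[OF ax] by simp
      finally show ?thesis using fapp_pos[OF x, of n] fapp_pos[OF ax, of n] by (simp add: field_simps)
    qed
    \<comment> \<open>Adding 1 to x moves the base point from \<open>lam n\<close> to
      \<open>lam (Suc n)\<close>; what remains is the change of slope, the dilation by
      \<open>c n\<close>.\<close>
    have shift: "psi (fapp n (x + 1)) = fapp (Suc n) (c n * x)" for n
    proof -
      have "lam n + (x + 1) / lam (Suc n) = lam (Suc n) + c n * x / lam (Suc (Suc n))"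
        using inverse_lam_Suc[of n] lam_Suc_pos[of "Suc n"] by (simp add: c_def add_divide_distrib)
      then show ?thesis by (simp add: fapp_def)
    qed
    have "(\<lambda>n. psi (fapp n (x + 1))) \<longlonglongrightarrow> psi (1 / g (x + 1))"
      using conv_g[of "x + 1"] g_nz[of "x + 1"] x by (intro psi_tendsto) auto
    moreover have "(\<lambda>n. fapp (Suc n) (c n * x)) \<longlonglongrightarrow> 1 / g x"
    proof (rule tendsto_sandwich)
      have lim: "(\<lambda>n. fapp (Suc n) x) \<longlonglongrightarrow> 1 / g x" using conv_g[OF x] LIMSEQ_Suc by blast
      then show "(\<lambda>n. fapp (Suc n) x) \<longlonglongrightarrow> 1 / g x" .
      from tendsto_mult[OF c lim] show "(\<lambda>n. c n * fapp (Suc n) x) \<longlonglongrightarrow> 1 / g x" by simp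
      show "\<forall>\<^sub>F n in sequentially. fapp (Suc n) x \<le> fapp (Suc n) (c n * x)"
        using c1 x by (intro always_eventually allI fapp_mono) auto
      show "\<forall>\<^sub>F n in sequentially. fapp (Suc n) (c n * x) \<le> c n * fapp (Suc n) x"
        using c1 scale by (intro always_eventually allI) auto
    qed
    ultimately show ?thesis unfolding shift using LIMSEQ_unique by blast
  qed

  \<comment> \<open>The push-forward under \<open>max 0\<close> keeps the integrals of the truncated
    kernel and lets the truncation disappear from the statement.\<close>
  define R where "R = distr Q borel (max 0)"
  interpret R: real_distribution R unfolding R_def by (rule Q.real_distribution_distr) simp
  have "AE s in R. 0 \<le> s" unfolding R_def by (subst AE_distr_iff) auto
  moreover have "(\<integral>s. (1 + s) / (x + s) \<partial>R) = g x" for x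
    unfolding R_def g_def K_def by (subst integral_distr) auto
  moreover note R.real_distribution_axioms
  ultimately show ?thesis
    using fun_eq by metis
qed

section \<open>Preimages of zero\<close>

lemma psi_funpow_0 [simp]: "(psi ^^ n) 0 = 0"
  by (induction n) simp_all

lemma psi_neg_inverse: "psi (- (1 / b)) = psi b"
  by (simp add: psi_def)

lemma psi_diff_root: "psi (c - psi_root c) = c"
proof -
  have "c - psi_root c = - (1 / psi_root c)" by (simp add: inverse_psi_root)
  then show ?thesis by (simp only: psi_neg_inverse psi_psi_root)
qed

lemma psi_inj_pos: "0 < (x::real) \<Longrightarrow> 0 < y \<Longrightarrow> psi x = psi y \<Longrightarrow> x = y"
  using psi_strict_mono[of x y] psi_strict_mono[of y x] by linarith

lemma psi_neg_unique: "a < 0 \<Longrightarrow> a = psi a - psi_root (psi a)"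
proof -
  assume a: "a < 0"
  have "psi (- (1 / a)) = psi (psi_root (psi a))" by (simp add: psi_neg_inverse)
  moreover have "0 < - (1 / a)" using a by (simp add: zero_less_divide_iff)
  ultimately have "- (1 / a) = psi_root (psi a)"
    using psi_inj_pos psi_root_pos by blast
  then show ?thesis by (simp add: psi_def)
qed

text \<open>Negative numbers that \<open>psi\<close> carries to \<open>0\<close> in exactly \<open>p + 1\<close> steps. The condition
  on \<open>psi ^^ p\<close> is needed because division by zero gives \<open>psi 0 = 0\<close>.\<close>

definition neg_roots :: "nat \<Rightarrow> real set" where
  "neg_roots p = {a. a < 0 \<and> (psi ^^ Suc p) a = 0 \<and> (psi ^^ p) a \<noteq> 0}"

text \<open>A negative a is the negative preimage of c = \<open>psi a\<close>, so it suffices to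
  describe c. If c is positive, it is -1 / b with b negative, and \<open>psi\<close> does not
  distinguish b from -1 / b. Each element of \<open>neg_roots p\<close> thus contributes two values
  of c, which is why the number of points doubles.\<close>

lemma neg_roots_Suc:
  "neg_roots (Suc p) = (\<lambda>c. c - psi_root c) ` (neg_roots p \<union> (\<lambda>a. - (1 / a)) ` neg_roots p)"
proof (intro equalityI subsetI)
  fix a assume a: "a \<in> neg_roots (Suc p)"
  define c where "c = psi a"
  have c: "(psi ^^ Suc p) c = 0" "(psi ^^ p) c \<noteq> 0" "a = c - psi_root c"
    using a psi_neg_unique unfolding neg_roots_def c_def
    by (auto simp: funpow_Suc_right simp del: funpow.simps(2))
  then have "c \<noteq> 0" by auto
  have "c \<in> neg_roots p \<union> (\<lambda>a. - (1 / a)) ` neg_roots p"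
  proof (cases "c < 0")
    case True
    then show ?thesis using c by (simp add: neg_roots_def)
  next
    case False
    have "(psi ^^ Suc p) (- (1 / c)) = 0"
      using c(1) by (simp only: funpow_Suc_right comp_def psi_neg_inverse)
    \<comment> \<open>For p = 0 no \<open>psi\<close> is applied and the claim is that -1 / c is
      nonzero; for larger p the first application replaces -1 / c by c.\<close>
    moreover have "(psi ^^ p) (- (1 / c)) \<noteq> 0"
      using c(2) \<open>c \<noteq> 0\<close> by (cases p) (auto simp: funpow_Suc_right psi_neg_inverse simp del: funpow.simps(2))
    moreover have "- (1 / c) < 0" using False \<open>c \<noteq> 0\<close> by (simp add: divide_less_0_iff)
    ultimately have "- (1 / c) \<in> neg_roots p" by (simp add: neg_roots_def)
    moreover have "c = - (1 / (- (1 / c)))" using \<open>c \<noteq> 0\<close> by simp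
    ultimately show ?thesis by blast
  qed
  with c(3) show "a \<in> (\<lambda>c. c - psi_root c) ` (neg_roots p \<union> (\<lambda>a. - (1 / a)) ` neg_roots p)" by blast
next
  fix a assume "a \<in> (\<lambda>c. c - psi_root c) ` (neg_roots p \<union> (\<lambda>a. - (1 / a)) ` neg_roots p)"
  then obtain c b where b: "b \<in> neg_roots p" and cb: "c = b \<or> c = - (1 / b)" and a: "a = c - psi_root c"
    by blast
  have "(psi ^^ Suc p) c = 0"
    using b cb by (auto simp: neg_roots_def funpow_Suc_right psi_neg_inverse simp del: funpow.simps(2))
  moreover have "(psi ^^ p) c \<noteq> 0"
    using b cb by (cases p) (auto simp: neg_roots_def funpow_Suc_right psi_neg_inverse simp del: funpow.simps(2))
  moreover have "psi a = c" using a psi_diff_root by simp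
  moreover have "a < 0" using a psi_root_gt[of c] by simp
  ultimately show "a \<in> neg_roots (Suc p)"
    by (simp add: neg_roots_def funpow_Suc_right del: funpow.simps(2))
qed

lemma neg_roots_card: "finite (neg_roots p) \<and> card (neg_roots p) = 2 ^ p"
proof (induction p)
  case 0
  have "neg_roots 0 = {-1}"
  proof (intro equalityI subsetI)
    fix a assume "a \<in> neg_roots 0"
    then have a: "a < 0" "psi a = 0" by (auto simp: neg_roots_def)
    show "a \<in> {-1}" using psi_neg_unique[OF a(1)] a(2) by simp
  qed (simp add: neg_roots_def psi_def)
  then show ?case by simp
next
  case (Suc p)
  have neg: "a < 0" if "a \<in> neg_roots p" for a using that by (simp add: neg_roots_def)
  have inj1: "inj_on (\<lambda>a. - (1 / a) :: real) (neg_roots p)" by (auto simp: inj_on_def)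
  have inj2: "inj_on (\<lambda>c. c - psi_root c) S" for S
    by (rule inj_on_inverseI[where g = psi]) (rule psi_diff_root)
  have disj: "neg_roots p \<inter> (\<lambda>a. - (1 / a)) ` neg_roots p = {}"
  proof -
    have "x \<notin> (\<lambda>a. - (1 / a)) ` neg_roots p" if "x \<in> neg_roots p" for x
    proof
      assume "x \<in> (\<lambda>a. - (1 / a)) ` neg_roots p"
      then obtain b where "b \<in> neg_roots p" "x = - (1 / b)" by blast
      with neg[OF this(1)] neg[OF that] show False by simp
    qed
    then show ?thesis by blast
  qed
  have "card (neg_roots p \<union> (\<lambda>a. - (1 / a)) ` neg_roots p) = 2 ^ p + 2 ^ p"
    using Suc disj by (subst card_Un_disjoint) (auto simp: card_image[OF inj1])
  then show ?case
    unfolding neg_roots_Suc using Suc by (simp add: card_image[OF inj2])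
qed

text \<open>Stated over a general field because it serves twice: over the complex numbers for
  differentiation under the integral, and over the reals with D = 0 for a distribution
  function.\<close>

lemma has_field_derivative_quadratic:
  fixes f :: "'a::real_normed_field \<Rightarrow> 'a"
  assumes "0 < e" "\<And>w. dist w z < e \<Longrightarrow> norm (f w - f z - D * (w - z)) \<le> K * (norm (w - z))\<^sup>2"
  shows "(f has_field_derivative D) (at z)"
  unfolding has_field_derivative_iff
proof (rule LIM_zero_cancel, rule Lim_null_comparison)
  show "\<forall>\<^sub>F w in at z. norm ((f w - f z) / (w - z) - D) \<le> K * norm (w - z)"
    unfolding eventually_at
  proof (intro exI[of _ e] conjI assms(1) ballI impI)
    fix w assume w: "w \<noteq> z \<and> dist w z < e"
    then have nz: "w - z \<noteq> 0" "0 < norm (w - z)" by auto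
    have "(f w - f z) / (w - z) - D = (f w - f z - D * (w - z)) / (w - z)"
      using nz(1) by (simp add: diff_divide_distrib)
    then have "norm ((f w - f z) / (w - z) - D) = norm (f w - f z - D * (w - z)) / norm (w - z)"
      by (simp only: norm_divide)
    also have "\<dots> \<le> K * (norm (w - z))\<^sup>2 / norm (w - z)"
      using assms(2) w by (intro divide_right_mono) auto
    also have "\<dots> = K * norm (w - z)" using nz by (simp add: power2_eq_square)
    finally show "norm ((f w - f z) / (w - z) - D) \<le> K * norm (w - z)" .
  qed
  have "((\<lambda>w. K * norm (w - z)) \<longlongrightarrow> K * norm (z - z)) (at z)"
    by (intro tendsto_intros)
  then show "((\<lambda>w. K * norm (w - z)) \<longlongrightarrow> 0) (at z)" by simp
qed

section \<open>The Stieltjes transform on the slit plane\<close>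

definition slit :: "complex set" where
  "slit = - complex_of_real ` {..0}"

lemma nonpos_reals_eq: "complex_of_real ` {..0} = {z. Im z = 0 \<and> Re z \<le> 0}"
proof (intro equalityI subsetI)
  fix z assume "z \<in> {z. Im z = 0 \<and> Re z \<le> 0}"
  then have "z = complex_of_real (Re z)" "Re z \<in> {..0}" by (auto simp: complex_eq_iff)
  then show "z \<in> complex_of_real ` {..0}" by (rule image_eqI)
qed auto

lemma in_slit_iff: "z \<in> slit \<longleftrightarrow> Im z \<noteq> 0 \<or> 0 < Re z"
  unfolding slit_def nonpos_reals_eq by auto

lemma open_slit: "open slit"
proof -
  have "complex_of_real ` {..0} = {z. Im z = 0} \<inter> {z. Re z \<le> 0}"
    unfolding nonpos_reals_eq by auto
  then show ?thesis
    by (auto simp: slit_def open_Compl intro!: closed_Int closed_halfspace_Im_eq closed_halfspace_Re_le)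
qed

lemma connected_slit: "connected slit"
  unfolding slit_def by (rule starlike_imp_connected[OF starlike_slotted_complex_plane_left])

text \<open>Writing 1 + s = (1 + R) + (s - R), the first part is controlled by the distance to the
  cut and the second by the triangle inequality. The constant is uniform in s and in w near z, so it
  dominates every kernel near z.\<close>

lemma slit_resolvent_bound:
  assumes "z \<in> slit"
  obtains e B where "0 < e" "0 < B" "\<And>w s. dist w z < e \<Longrightarrow> 0 \<le> s \<Longrightarrow> 1 + s \<le> B * norm (w + of_real s)"
proof -
  obtain d where d: "0 < d" "ball z d \<subseteq> slit"
    using open_slit assms openE by blast
  define R where "R = norm z + d"
  define B where "B = (1 + R) * (2 / d) + 1"
  have R: "0 < R" using d by (simp add: R_def add_nonneg_pos)
  show ?thesis
  proof (rule that[of "d / 2" B])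
    show "0 < B" using d R by (simp add: B_def add_pos_pos)
    fix w s assume w: "dist w z < d / 2" and s: "0 \<le> (s::real)"
    have n1: "d / 2 \<le> norm (w + of_real s)"
    proof (rule ccontr)
      assume "\<not> d / 2 \<le> norm (w + of_real s)"
      then have "dist z (- of_real s) < d"
        using w norm_triangle_ineq[of "z - w" "w + of_real s"] by (simp add: dist_norm norm_minus_commute)
      then have "of_real (- s) \<in> slit" using d by auto
      then show False using s by (simp add: in_slit_iff)
    qed
    have "norm w \<le> R" using w d norm_triangle_ineq2[of w z] by (simp add: dist_norm R_def)
    moreover have "s \<le> norm (w + of_real s) + norm w"
      using norm_triangle_ineq[of "w + of_real s" "- w"] s by simp
    ultimately have n2: "s - R \<le> norm (w + of_real s)" by simp
    have "1 + R \<le> (1 + R) * (2 / d) * norm (w + of_real s)"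
      using n1 d R mult_left_mono[of 1 "2 / d * norm (w + of_real s)" "1 + R"] by (simp add: field_simps)
    with n2 show "1 + s \<le> B * norm (w + of_real s)" by (simp add: B_def algebra_simps)
  qed (use d in simp)
qed

section \<open>Simple zeros and simple poles\<close>

lemma simple_zero:
  assumes "g analytic_on {z}" "g z = 0" "(g has_field_derivative d) (at z)" "d \<noteq> 0"
  shows "zorder g z = 1" "isolated_zero g z"
proof -
  have d: "deriv g z = d" using assms by (simp add: DERIV_imp_deriv)
  show "zorder g z = 1"
    by (rule zorder_zero_eqI'[OF assms(1)]) (use assms d in auto)
  have "\<forall>\<^sub>F w in at z. g w \<noteq> 0"
  proof -
    have "((\<lambda>w. (g w - g z) / (w - z)) \<longlongrightarrow> d) (at z)"
      using assms(3) by (simp add: has_field_derivative_iff)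
    then have "\<forall>\<^sub>F w in at z. (g w - g z) / (w - z) \<noteq> 0"
      using assms(4) tendsto_imp_eventually_ne by blast
    then show ?thesis by eventually_elim (use assms(2) in auto)
  qed
  moreover have "g \<midarrow>z\<rightarrow> 0" using analytic_at_imp_isCont[OF assms(1)] assms(2) by (simp add: isCont_def)
  ultimately show "isolated_zero g z" by (simp add: isolated_zero_def)
qed

text \<open>Everything passes through 1 / f, which is analytic at a simple pole. The hypothesis
  \<open>f z = 0\<close> is the value convention at poles, and 1 / 0 = 0 turns it into a zero of 1 /
  f.\<close>

lemma simple_pole:
  assumes "(\<lambda>w. 1 / f w) analytic_on {z}" "f z = 0" "((\<lambda>w. 1 / f w) has_field_derivative d) (at z)" "d \<noteq> 0"
  shows "zorder f z = -1" "is_pole f z" "f meromorphic_on {z}"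
proof -
  define g where "g = (\<lambda>w. 1 / f w)"
  have f: "f = (\<lambda>w. inverse (g w))" by (simp add: g_def fun_eq_iff)
  have g: "zorder g z = 1" "isolated_zero g z"
    unfolding g_def by (rule simple_zero[OF assms(1) _ assms(3,4)]; simp add: assms(2))+
  show "is_pole f z" unfolding f is_pole_inverse_iff by (rule g)
  have "zorder (\<lambda>w. inverse (g w)) z = - zorder g z"
  proof (rule zorder_inverse)
    show "\<exists>\<^sub>F w in at z. g w \<noteq> 0"
      using g(2) by (auto simp: isolated_zero_def intro: eventually_frequently)
  qed (use assms(1) in \<open>auto simp: g_def isolated_singularity_at_analytic not_essential_analytic\<close>)
  with g show "zorder f z = -1" unfolding f by simp
  have "g meromorphic_on {z}" unfolding g_def using assms(1) analytic_on_imp_meromorphic_on by blast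
  then show "f meromorphic_on {z}" unfolding f by (intro meromorphic_intros)
qed

lemma inverse_psi: "1 / psi y = y / (y\<^sup>2 - 1)"
proof (cases "y = 0")
  case False
  then have "psi y = (y\<^sup>2 - 1) / y" by (simp add: psi_def diff_divide_distrib power2_eq_square)
  then show ?thesis by simp
qed simp

text \<open>Written in 1 / y, this form stays analytic where y has a pole, while
  \<open>inverse_psi\<close> is the one that is analytic at y = 0. Total division makes both valid
  for every y.\<close>

lemma inverse_psi': "1 / psi y = (1 / y) / (1 - (1 / y)\<^sup>2)"
proof (cases "y = 0")
  case False
  then have "1 - (1 / y)\<^sup>2 = (y\<^sup>2 - 1) / y\<^sup>2" by (simp add: diff_divide_distrib power_divide)
  then show ?thesis unfolding inverse_psi using False by (simp add: power2_eq_square)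
qed simp

lemma norm_one_add_of_real: "0 \<le> s \<Longrightarrow> norm (1 + complex_of_real s) = 1 + s"
  by (metis abs_of_nonneg add_nonneg_nonneg norm_of_real of_real_1 of_real_add zero_le_one)

text \<open>The approximants do not occur again: what follows rests on these properties of the limit
  measure.\<close>

locale stieltjes_fixed_point = real_distribution Q for Q :: "real measure" +
  assumes nonneg: "AE s in Q. 0 \<le> s"
    and fun_eq: "\<And>x. 0 < x \<Longrightarrow>
      1 / (\<integral>s. (1 + s) / (x + s) \<partial>Q) = psi (1 / (\<integral>s. (1 + s) / (x + 1 + s) \<partial>Q))"
begin

section \<open>The transform \<open>G\<close> and its reciprocal on the slit plane\<close>

definition G :: "complex \<Rightarrow> complex" where
  "G z = (\<integral>s. (1 + of_real s) / (z + of_real s) \<partial>Q)"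

lemma prob_UNIV [simp]: "prob UNIV = 1"
  using prob_space by simp

lemma norm_integral_le:
  fixes h :: "real \<Rightarrow> 'b::{banach, second_countable_topology}"
  assumes "integrable Q h" "AE s in Q. norm (h s) \<le> C"
  shows "norm (\<integral>s. h s \<partial>Q) \<le> C"
proof -
  have "norm (\<integral>s. h s \<partial>Q) \<le> (\<integral>s. norm (h s) \<partial>Q)" by (rule integral_norm_bound)
  also have "\<dots> \<le> (\<integral>s. C \<partial>Q)" using assms by (intro integral_mono_AE) auto
  finally show ?thesis by simp
qed

lemma integral_pos:
  fixes h :: "real \<Rightarrow> real"
  assumes "integrable Q h" "AE s in Q. 0 < h s"
  shows "0 < (\<integral>s. h s \<partial>Q)"
proof -
  have nn: "AE s in Q. 0 \<le> h s" using assms(2) by eventually_elim simp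
  have "(\<integral>s. h s \<partial>Q) \<noteq> 0"
  proof
    assume "(\<integral>s. h s \<partial>Q) = 0"
    then have "AE s in Q. h s = 0" using integral_nonneg_eq_0_iff_AE[OF assms(1) nn] by simp
    with assms(2) have "AE s in Q. False" by eventually_elim simp
    then show False by simp
  qed
  with integral_nonneg_AE[OF nn] show ?thesis by simp
qed

lemma resolvent_bounds:
  fixes z :: complex
  assumes "0 < B" "0 \<le> s" "1 + s \<le> B * norm (z + of_real s)"
  shows "z + of_real s \<noteq> 0" "norm ((1 + of_real s) / (z + of_real s)) \<le> B"
    "norm (1 / (z + of_real s)) \<le> B"
proof -
  have p: "0 < norm (z + of_real s)" using assms by (smt (verit) mult_eq_0_iff norm_ge_zero zero_le_mult_iff)
  then show "z + of_real s \<noteq> 0" by auto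
  have "norm (1 + of_real s :: complex) = 1 + s" using assms(2) by (rule norm_one_add_of_real)
  then show "norm ((1 + of_real s) / (z + of_real s)) \<le> B"
    using p assms by (simp add: norm_divide divide_le_eq)
  show "norm (1 / (z + of_real s)) \<le> B"
    using p assms by (simp add: norm_divide divide_le_eq)
qed

lemma kernel_integrable: "z \<in> slit \<Longrightarrow> integrable Q (\<lambda>s. (1 + of_real s) / (z + of_real s))"
proof -
  assume "z \<in> slit"
  then obtain e B where B: "0 < e" "0 < B" "\<And>w s. dist w z < e \<Longrightarrow> 0 \<le> s \<Longrightarrow> 1 + s \<le> B * norm (w + of_real s)"
    using slit_resolvent_bound by metis
  show ?thesis
  proof (rule integrable_const_bound[where B = B])
    show "AE s in Q. norm ((1 + of_real s) / (z + of_real s)) \<le> B"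
      using nonneg by eventually_elim (rule resolvent_bounds(2)[OF B(2)], use B in auto)
  qed measurable
qed

text \<open>The second order remainder of the reciprocal is (a - b)^2 / (a b^2). Together with the
  numerator 1 + s it contains three factors of modulus at most B, whence the constant
  \<open>B ^ 3\<close>.\<close>

lemma G_deriv:
  assumes "z \<in> slit"
  shows "(G has_field_derivative - (\<integral>s. (1 + of_real s) / (z + of_real s)\<^sup>2 \<partial>Q)) (at z)"
proof -
  obtain e B where e: "0 < e" and B: "0 < B" "\<And>w s. dist w z < e \<Longrightarrow> 0 \<le> s \<Longrightarrow> 1 + s \<le> B * norm (w + of_real s)"
    using assms slit_resolvent_bound by metis
  obtain d where d: "0 < d" "ball z d \<subseteq> slit" using open_slit assms openE by blast
  show ?thesis
  proof (rule has_field_derivative_quadratic[where e = "min d e" and K = "B ^ 3"])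
    show "0 < min d e" using d e by simp
    fix w assume w: "dist w z < min d e"
    then have ws: "w \<in> slit" using d by (auto simp: dist_commute)
    let ?k = "\<lambda>w s. (1 + complex_of_real s) / (w + of_real s)"
    have bz: "AE s in Q. 1 + s \<le> B * norm (z + of_real s)" and bw: "AE s in Q. 1 + s \<le> B * norm (w + of_real s)"
      using nonneg by (eventually_elim, use B w e in auto)+
    have int2: "integrable Q (\<lambda>s. (1 + complex_of_real s) / (z + of_real s)\<^sup>2)"
    proof (rule integrable_const_bound[where B = "B * B"])
      show "AE s in Q. norm ((1 + complex_of_real s) / (z + of_real s)\<^sup>2) \<le> B * B"
        using nonneg bz
      proof eventually_elim
        case (elim s)
        have "norm (?k z s) * norm (1 / (z + of_real s)) \<le> B * B"
          using resolvent_bounds[OF B(1) elim] B(1) by (intro mult_mono) auto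
        then show ?case by (simp add: norm_mult[symmetric] power2_eq_square)
      qed
    qed measurable
    have "G w - G z - - (\<integral>s. (1 + of_real s) / (z + of_real s)\<^sup>2 \<partial>Q) * (w - z)
        = (\<integral>s. ?k w s - ?k z s + (1 + complex_of_real s) / (z + of_real s)\<^sup>2 * (w - z) \<partial>Q)"
      unfolding G_def using kernel_integrable[OF ws] kernel_integrable[OF assms] int2 by (simp del: times_divide_eq_left)
    also have "norm \<dots> \<le> B ^ 3 * (norm (w - z))\<^sup>2"
    proof (rule norm_integral_le)
      show "AE s in Q. norm (?k w s - ?k z s + (1 + complex_of_real s) / (z + of_real s)\<^sup>2 * (w - z)) \<le> B ^ 3 * (norm (w - z))\<^sup>2"
        using nonneg bz bw
      proof eventually_elim
        case (elim s)
        note rz = resolvent_bounds[OF B(1) elim(1,2)] and rw = resolvent_bounds[OF B(1) elim(1,3)]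
        have alg: "1 / a - 1 / b + (a - b) / b\<^sup>2 = (1 / a) * (1 / b) * (1 / b) * (a - b)\<^sup>2"
          if "a \<noteq> 0" "b \<noteq> 0" for a b :: complex
          using that by (simp add: divide_simps power2_eq_square) (simp add: algebra_simps)
        have "?k w s - ?k z s + (1 + complex_of_real s) / (z + of_real s)\<^sup>2 * (w - z)
            = (1 + of_real s) * (1 / (w + of_real s) - 1 / (z + of_real s) + ((w + of_real s) - (z + of_real s)) / (z + of_real s)\<^sup>2)"
          by (simp add: algebra_simps add_divide_distrib diff_divide_distrib)
        also have "\<dots> = ?k w s * (1 / (z + of_real s)) * (1 / (z + of_real s)) * (w - z)\<^sup>2"
          unfolding alg[OF rw(1) rz(1)] by simp
        finally have "norm (?k w s - ?k z s + (1 + complex_of_real s) / (z + of_real s)\<^sup>2 * (w - z))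
            = norm (?k w s) * norm (1 / (z + of_real s)) * norm (1 / (z + of_real s)) * (norm (w - z))\<^sup>2"
          by (simp only: norm_mult norm_power)
        also have "\<dots> \<le> B * B * B * (norm (w - z))\<^sup>2"
          using rz rw B(1) by (intro mult_mono mult_nonneg_nonneg) auto
        finally show ?case by (simp add: power3_eq_cube)
      qed
    qed (use kernel_integrable[OF ws] kernel_integrable[OF assms] int2 in \<open>auto simp del: times_divide_eq_left\<close>)
    finally show "norm (G w - G z - - (\<integral>s. (1 + of_real s) / (z + of_real s)\<^sup>2 \<partial>Q) * (w - z)) \<le> B ^ 3 * (norm (w - z))\<^sup>2" .
  qed
qed

lemma G_holomorphic: "G holomorphic_on slit"
  using G_deriv by (meson field_differentiable_at_within field_differentiable_def holomorphic_onI)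

text \<open>The imaginary part of the kernel is of Poisson type and has a fixed sign. It shows that
  \<open>G\<close> has no zeros off the axis and, close to the axis, bounds the mass of Q on small
  intervals.\<close>

lemma G_Im:
  assumes "Im z \<noteq> 0"
  shows "integrable Q (\<lambda>s. (1 + s) / (norm (z + of_real s))\<^sup>2)"
    and "Im (G z) = - Im z * (\<integral>s. (1 + s) / (norm (z + of_real s))\<^sup>2 \<partial>Q)"
proof -
  have z: "z \<in> slit" using assms by (simp add: in_slit_iff)
  have im: "Im ((1 + of_real s) / (z + of_real s)) = - Im z * ((1 + s) / (norm (z + of_real s))\<^sup>2)" for s
    by (simp add: Im_divide cmod_power2 algebra_simps diff_divide_distrib)
  have i: "integrable Q (\<lambda>s. Im ((1 + of_real s) / (z + of_real s)))"
    by (rule integrable_Im[OF kernel_integrable[OF z]])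
  have "integrable Q (\<lambda>s. (- 1 / Im z) * (- Im z * ((1 + s) / (norm (z + of_real s))\<^sup>2)))"
    using i unfolding im by (rule integrable_mult_right)
  moreover have "(- 1 / Im z) * (- Im z * c) = c" for c using assms by simp
  ultimately show "integrable Q (\<lambda>s. (1 + s) / (norm (z + of_real s))\<^sup>2)" by (simp only:)
  have "Im (G z) = (\<integral>s. Im ((1 + of_real s) / (z + of_real s)) \<partial>Q)"
    unfolding G_def using kernel_integrable[OF z] by simp
  then show "Im (G z) = - Im z * (\<integral>s. (1 + s) / (norm (z + of_real s))\<^sup>2 \<partial>Q)"
    unfolding im by (simp del: times_divide_eq_right)
qed

lemma G_of_real: "G (of_real x) = of_real (\<integral>s. (1 + s) / (x + s) \<partial>Q)"
proof -
  have "G (of_real x) = (\<integral>s. complex_of_real ((1 + s) / (x + s)) \<partial>Q)"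
    unfolding G_def by simp
  then show ?thesis by (simp only: integral_complex_of_real)
qed

lemma stieltjes_real_pos:
  assumes "0 < x"
  shows "0 < (\<integral>s. (1 + s) / (x + s) \<partial>Q)"
proof (rule integral_pos)
  have "integrable Q (\<lambda>s. Re ((1 + of_real s) / (of_real x + of_real s)))"
    by (rule integrable_Re[OF kernel_integrable]) (use assms in \<open>simp add: in_slit_iff\<close>)
  moreover have "Re ((1 + of_real s) / (of_real x + of_real s)) = (1 + s) / (x + s)" for s
    by (metis Re_complex_of_real of_real_1 of_real_add of_real_divide)
  ultimately show "integrable Q (\<lambda>s. (1 + s) / (x + s))" by simp
  show "AE s in Q. 0 < (1 + s) / (x + s)" using nonneg by eventually_elim (use assms in simp)
qed

lemma G_nonzero:
  assumes "z \<in> slit"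
  shows "G z \<noteq> 0"
proof (cases "Im z = 0")
  case False
  have "AE s in Q. 0 < (1 + s) / (norm (z + of_real s))\<^sup>2"
    using nonneg
  proof eventually_elim
    case (elim s)
    have "z + of_real s \<noteq> 0" using False by (auto simp: complex_eq_iff)
    then show ?case using elim by simp
  qed
  then have "0 < (\<integral>s. (1 + s) / (norm (z + of_real s))\<^sup>2 \<partial>Q)"
    using G_Im(1)[OF False] by (intro integral_pos) auto
  then show ?thesis using G_Im(2)[OF False] False by auto
next
  case True
  define x where "x = Re z"
  have z: "z = of_real x" "0 < x" using True assms by (auto simp: x_def in_slit_iff complex_eq_iff)
  show ?thesis unfolding z(1) G_of_real using stieltjes_real_pos[OF z(2)] by simp
qed

definition f0 :: "complex \<Rightarrow> complex" where
  "f0 z = 1 / G z"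

lemma f0_holomorphic: "f0 holomorphic_on slit"
  unfolding f0_def using G_nonzero by (intro holomorphic_intros G_holomorphic) auto

lemma f0_nonzero: "z \<in> slit \<Longrightarrow> f0 z \<noteq> 0"
  by (simp add: f0_def G_nonzero)

lemma f0_one: "f0 1 = 1"
proof -
  have "AE s in Q. (1 + s) / (1 + s) = 1" using nonneg by eventually_elim simp
  then have "(\<integral>s. (1 + s) / (1 + s) \<partial>Q) = (\<integral>s. 1 \<partial>Q)"
    by (intro integral_cong_AE) simp_all
  also have "\<dots> = 1" by simp
  finally show ?thesis using G_of_real[of 1] by (simp only: f0_def of_real_1) simp
qed

lemma slit_add: "z \<in> slit \<Longrightarrow> z + of_nat n \<in> slit"
  by (auto simp: in_slit_iff)

lemma slit_add1: "z \<in> slit \<Longrightarrow> z + 1 \<in> slit"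
  using slit_add[of z 1] by simp

lemma f0_fun_eq:
  assumes "z \<in> slit"
  shows "f0 z = psi (f0 (z + 1))"
proof -
  have sub: "(\<lambda>z. z + 1) ` slit \<subseteq> slit" using slit_add1 by blast
  have holo1: "(\<lambda>z. f0 (z + 1)) holomorphic_on slit"
    using holomorphic_on_compose_gen[OF _ f0_holomorphic sub] by (simp add: comp_def holomorphic_intros)
  have "f0 z - psi (f0 (z + 1)) = 0"
  proof (rule analytic_continuation[where f = "\<lambda>z. f0 z - psi (f0 (z + 1))" and w = z and S = slit and U = "complex_of_real ` {0<..}" and \<xi> = 1])
    show "(\<lambda>z. f0 z - psi (f0 (z + 1))) holomorphic_on slit"
      unfolding psi_def using f0_nonzero slit_add1 by (intro holomorphic_intros f0_holomorphic holo1) auto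
    show "1 islimpt complex_of_real ` {0<..}"
    proof -
      have "(1::real) islimpt {0<..}" by (rule interior_limit_point) (simp add: interior_open)
      then show ?thesis
        unfolding islimpt_approachable
        by (metis (no_types, lifting) dist_of_real image_eqI of_real_1 of_real_eq_iff)
    qed
    fix w assume "w \<in> complex_of_real ` {0<..}"
    then obtain x where x: "w = of_real x" "0 < x" by auto
    have "G (w + 1) = of_real (\<integral>s. (1 + s) / (x + 1 + s) \<partial>Q)"
      using G_of_real[of "x + 1"] x by simp
    moreover have "G w = of_real (\<integral>s. (1 + s) / (x + s) \<partial>Q)" using G_of_real[of x] x by simp
    ultimately have "f0 w = of_real (1 / (\<integral>s. (1 + s) / (x + s) \<partial>Q))"
      "f0 (w + 1) = of_real (1 / (\<integral>s. (1 + s) / (x + 1 + s) \<partial>Q))" by (simp_all add: f0_def)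
    then show "f0 w - psi (f0 (w + 1)) = 0" using fun_eq[OF x(2)] by (simp only: psi_of_real) simp
  qed (use open_slit connected_slit assms in \<open>auto simp: in_slit_iff\<close>)
  then show ?thesis by simp
qed

section \<open>Extension to the plane by the functional equation\<close>

lemma f0_iterate: "z \<in> slit \<Longrightarrow> f0 z = (psi ^^ n) (f0 (z + of_nat n))"
proof (induction n)
  case (Suc n)
  have "f0 (z + of_nat n) = psi (f0 (z + of_nat (Suc n)))"
    using f0_fun_eq[OF slit_add[OF Suc.prems]] by (simp add: add_ac)
  then show ?case using Suc by (simp add: funpow_Suc_right del: funpow.simps(2))
qed simp

text \<open>Any number n of steps with z + n in the slit plane gives the same value; the choice made
  here puts z + n into the right half plane. Since \<open>psi 0 = 0\<close>, poles receive the value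
  0.\<close>

definition f :: "complex \<Rightarrow> complex" where
  "f z = (let n = nat \<lceil>- Re z\<rceil> + 1 in (psi ^^ n) (f0 (z + of_nat n)))"

text \<open>Both numbers of steps are compared with their sum, which \<open>f0_iterate\<close>
  reaches from either side.\<close>

lemma f_eq:
  assumes "z + of_nat n \<in> slit"
  shows "f z = (psi ^^ n) (f0 (z + of_nat n))"
proof -
  define m where "m = nat \<lceil>- Re z\<rceil> + 1"
  have "- Re z < real m" unfolding m_def by linarith
  then have m: "z + of_nat m \<in> slit" by (simp add: in_slit_iff)
  have "f z = (psi ^^ m) (f0 (z + of_nat m))" by (simp add: f_def m_def Let_def)
  also have "\<dots> = (psi ^^ (m + n)) (f0 (z + of_nat (m + n)))"
    using f0_iterate[OF m, of n] by (simp add: funpow_add add_ac)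
  also have "\<dots> = (psi ^^ (n + m)) (f0 (z + of_nat n + of_nat m))"
    by (simp add: add_ac)
  also have "\<dots> = (psi ^^ n) (f0 (z + of_nat n))"
    using f0_iterate[OF assms, of m] by (simp add: funpow_add)
  finally show ?thesis .
qed

lemma f_slit: "z \<in> slit \<Longrightarrow> f z = f0 z"
  using f_eq[of z 0] by simp

lemma f_fun_eq: "f z = psi (f (z + 1))"
proof -
  define n where "n = nat \<lceil>- Re z\<rceil> + 1"
  have "- Re z < real n" unfolding n_def by linarith
  then have "z + 1 + of_nat n \<in> slit" "z + of_nat (Suc n) \<in> slit" by (auto simp: in_slit_iff)
  then show ?thesis using f_eq[of "z + 1" n] f_eq[of z "Suc n"] by (simp add: add_ac)
qed

lemma f_one: "f 1 = 1"
  using f_slit[of 1] f0_one by (simp add: in_slit_iff)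

lemma f_slit_nonzero: "z \<in> slit \<Longrightarrow> f z \<noteq> 0"
  by (simp add: f_slit f0_nonzero)

lemma f_slit_analytic: "z \<in> slit \<Longrightarrow> f analytic_on {z}"
proof -
  assume z: "z \<in> slit"
  have "f holomorphic_on slit" using f0_holomorphic by (rule holomorphic_transform) (simp add: f_slit)
  then show ?thesis using open_slit z analytic_on_holomorphic by blast
qed

section \<open>Zeros and poles of the meromorphic extension\<close>

lemma f_real: "\<exists>y. f (of_real x) = of_real y"
proof -
  define n where "n = nat \<lceil>- x\<rceil> + 1"
  have "- x < real n" unfolding n_def by linarith
  then have "of_real (x + real n) \<in> slit" by (simp add: in_slit_iff)
  then have "of_real x + of_nat n \<in> slit" by simp
  from f_eq[OF this] have "f (of_real x) = (psi ^^ n) (f0 (of_real (x + real n)))" by simp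
  then show ?thesis
    by (metis G_of_real f0_def of_real_1 of_real_divide psi_funpow_of_real)
qed

definition fr :: "real \<Rightarrow> real" where
  "fr x = Re (f (of_real x))"

lemma f_of_real: "f (of_real x) = of_real (fr x)"
  using f_real[of x] by (auto simp: fr_def)

lemma fr_fun_eq: "fr x = psi (fr (x + 1))"
proof -
  have "of_real (fr x) = (of_real (psi (fr (x + 1))) :: complex)"
    using f_fun_eq[of "of_real x"] f_of_real[of "x + 1"] by (simp add: f_of_real psi_of_real)
  then show ?thesis by (simp only: of_real_eq_iff)
qed

lemma fr_zero_iff: "f (of_real x) = 0 \<longleftrightarrow> fr x = 0"
  by (simp add: f_of_real)

lemma fr_one: "fr 1 = 1"
  using f_one f_of_real[of 1] by simp

lemma fr_0: "fr 0 = 0"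
  using fr_fun_eq[of 0] by (simp add: fr_one psi_def)

lemma f_deriv_pos:
  assumes "0 < x"
  shows "\<exists>d>0. (f has_field_derivative of_real d) (at (of_real x))"
proof -
  define D where "D = (\<integral>s. (1 + s) / (x + s)\<^sup>2 \<partial>Q)"
  define g where "g = (\<integral>s. (1 + s) / (x + s) \<partial>Q)"
  have z: "complex_of_real x \<in> slit" using assms by (simp add: in_slit_iff)
  have "(\<integral>s. (1 + of_real s) / (of_real x + of_real s)\<^sup>2 \<partial>Q) = (\<integral>s. complex_of_real ((1 + s) / (x + s)\<^sup>2) \<partial>Q)"
    by simp
  also have "\<dots> = of_real D" unfolding D_def by (rule integral_complex_of_real)
  finally have G': "(G has_field_derivative - of_real D) (at (of_real x))"
    using G_deriv[OF z] by simp
  have gx: "G (of_real x) = of_real g" unfolding g_def by (rule G_of_real)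
  have gnz: "g \<noteq> 0" using G_nonzero[OF z] gx by auto
  have "0 < D"
    unfolding D_def
  proof (rule integral_pos)
    show "AE s in Q. 0 < (1 + s) / (x + s)\<^sup>2"
      using nonneg by eventually_elim (use assms in \<open>simp add: add_pos_nonneg\<close>)
    show "integrable Q (\<lambda>s. (1 + s) / (x + s)\<^sup>2)"
    proof (rule integrable_const_bound[where B = "max 1 (1 / x) * (1 / x)"])
      show "AE s in Q. norm ((1 + s) / (x + s)\<^sup>2) \<le> max 1 (1 / x) * (1 / x)"
        using nonneg
      proof eventually_elim
        case (elim s)
        have "norm ((1 + s) / (x + s)\<^sup>2) = (1 + s) / (x + s) * (1 / (x + s))"
          using elim assms by (simp add: power2_eq_square)
        also have "\<dots> \<le> max 1 (1 / x) * (1 / x)"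
          using stieltjes_kernel_bound[OF elim assms] elim assms by (intro mult_mono) (auto intro: divide_left_mono)
        finally show ?case .
      qed
    qed measurable
  qed
  have "(f0 has_field_derivative of_real (D / g\<^sup>2)) (at (of_real x))"
    unfolding f0_def using gnz gx
    by (auto intro!: derivative_eq_intros G' simp: power2_eq_square)
  moreover have "eventually (\<lambda>w. f0 w = f w) (nhds (of_real x))"
    using eventually_nhds_in_open[OF open_slit z] by eventually_elim (simp add: f_slit)
  ultimately have "(f has_field_derivative of_real (D / g\<^sup>2)) (at (of_real x))"
    using DERIV_cong_ev[OF refl _ refl] by blast
  then show ?thesis using \<open>0 < D\<close> gnz by (intro exI[of _ "D / g\<^sup>2"]) simp
qed

text \<open>On the real axis \<open>f\<close> is a local diffeomorphism into the projective line: either \<open>f\<close>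
  is analytic with positive derivative or \<open>1 / f\<close> is analytic with negative derivative. Since
  poles have value \<open>0\<close>, the second case is detected by \<open>f (x + 1) = 0\<close> alone.\<close>

definition regular_at :: "real \<Rightarrow> bool" where
  "regular_at x \<longleftrightarrow> fr (x + 1) \<noteq> 0 \<and> f analytic_on {of_real x} \<and>
     (\<exists>d>0. (f has_field_derivative of_real d) (at (of_real x)))"

definition polar_at :: "real \<Rightarrow> bool" where
  "polar_at x \<longleftrightarrow> fr (x + 1) = 0 \<and> fr x = 0 \<and> (\<lambda>w. 1 / f w) analytic_on {of_real x} \<and>
     (\<exists>d<0. ((\<lambda>w. 1 / f w) has_field_derivative of_real d) (at (of_real x)))"

lemma inverse_f: "1 / f w = f (w + 1) / ((f (w + 1))\<^sup>2 - 1)"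
  using inverse_psi[of "f (w + 1)"] unfolding f_fun_eq[of w, symmetric] .

lemma inverse_f': "1 / f w = (1 / f (w + 1)) / (1 - (1 / f (w + 1))\<^sup>2)"
  using inverse_psi'[of "f (w + 1)"] unfolding f_fun_eq[of w, symmetric] .

lemma analytic_shift: "g analytic_on {z + 1} \<Longrightarrow> (\<lambda>w. g (w + 1)) analytic_on {z}"
  for g :: "complex \<Rightarrow> complex"
  using analytic_on_compose[of "\<lambda>w. w + 1" "{z}" g] by (simp add: comp_def analytic_intros)

text \<open>Induction to the left in unit steps from the positive axis. If y = f (x + 1) is nonzero,
  the derivative d there becomes d + d / y^2 > 0. If x + 1 is a zero, 1 / f gets the derivative -d
  at x; if x + 1 is a pole, the derivative of 1 / f is passed on unchanged, because
  \<open>psi\<close> is tangent to the identity at infinity.\<close>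

lemma regular_or_polar: "regular_at x \<or> polar_at x"
proof -
  have "- real n < x \<Longrightarrow> regular_at x \<or> polar_at x" for n
  proof (induction n arbitrary: x)
    case 0
    then have x: "0 < x" by simp
    have "complex_of_real x \<in> slit" "complex_of_real (x + 1) \<in> slit" using x by (auto simp: in_slit_iff)
    then have "f analytic_on {of_real x}" "fr (x + 1) \<noteq> 0"
      using f_slit_analytic f_slit_nonzero fr_zero_iff by blast+
    then show ?case using f_deriv_pos[OF x] by (simp add: regular_at_def)
  next
    case (Suc n)
    let ?z = "complex_of_real x"
    have IH: "regular_at (x + 1) \<or> polar_at (x + 1)" using Suc by (intro Suc.IH) simp
    have fz: "f = (\<lambda>z. psi (f (z + 1)))" using f_fun_eq by blast
    have fz': "f = (\<lambda>z. f (z + 1) - 1 / f (z + 1))" using fz unfolding psi_def .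
    show ?case
    proof (cases "fr (x + 1) = 0")
      case False
      then have "regular_at (x + 1)" using IH by (auto simp: polar_at_def)
      then obtain d where d: "f analytic_on {?z + 1}" "0 < d" "(f has_field_derivative of_real d) (at (?z + 1))"
        by (auto simp: regular_at_def)
      define y where "y = fr (x + 1)"
      have fy: "f (?z + 1) = of_real y" using f_of_real[of "x + 1"] by (simp add: y_def)
      have y: "y \<noteq> 0" using False by (simp add: y_def)
      have an: "(\<lambda>w. f (w + 1)) analytic_on {?z}" using analytic_shift[OF d(1)] .
      have dv: "((\<lambda>w. f (w + 1)) has_field_derivative of_real d) (at ?z)" using d(3) by (simp add: DERIV_shift)
      have "(\<lambda>w. f (w + 1) - 1 / f (w + 1)) analytic_on {?z}"
        using y fy by (intro analytic_intros an) auto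
      then have "f analytic_on {?z}" by (simp only: fz'[symmetric])
      moreover have "((\<lambda>w. f (w + 1) - 1 / f (w + 1)) has_field_derivative of_real (d + d / y\<^sup>2)) (at ?z)"
        using y fy by (auto intro!: derivative_eq_intros dv simp: power2_eq_square)
      then have "(f has_field_derivative of_real (d + d / y\<^sup>2)) (at ?z)" by (simp only: fz'[symmetric])
      moreover have "0 < d + d / y\<^sup>2" using d(2) y by (intro add_pos_pos divide_pos_pos) auto
      ultimately have "regular_at x" unfolding regular_at_def using False by blast
      then show ?thesis ..
    next
      case True
      then have fx: "fr x = 0" using fr_fun_eq[of x] by simp
      have f1: "f (?z + 1) = 0" using f_of_real[of "x + 1"] True by simp
      have "(\<lambda>w. 1 / f w) analytic_on {?z} \<and> (\<exists>d<0. ((\<lambda>w. 1 / f w) has_field_derivative of_real d) (at ?z))"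
        using IH
      proof
        assume "regular_at (x + 1)"
        then obtain d where d: "f analytic_on {?z + 1}" "0 < d" "(f has_field_derivative of_real d) (at (?z + 1))"
          by (auto simp: regular_at_def)
        have an: "(\<lambda>w. f (w + 1)) analytic_on {?z}" using analytic_shift[OF d(1)] .
        have dv: "((\<lambda>w. f (w + 1)) has_field_derivative of_real d) (at ?z)" using d(3) by (simp add: DERIV_shift)
        have eq: "(\<lambda>w. 1 / f w) = (\<lambda>w. f (w + 1) / ((f (w + 1))\<^sup>2 - 1))"
          by (rule ext) (rule inverse_f)
        have "(\<lambda>w. f (w + 1) / ((f (w + 1))\<^sup>2 - 1)) analytic_on {?z}"
          using f1 by (intro analytic_intros an) auto
        moreover have "((\<lambda>w. f (w + 1) / ((f (w + 1))\<^sup>2 - 1)) has_field_derivative of_real (- d)) (at ?z)"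
          using f1 by (auto intro!: derivative_eq_intros dv)
        ultimately show ?thesis unfolding eq using d(2) by (intro conjI exI[of _ "- d"]) auto
      next
        assume "polar_at (x + 1)"
        then obtain d where d: "(\<lambda>w. 1 / f w) analytic_on {?z + 1}" "d < 0" "((\<lambda>w. 1 / f w) has_field_derivative of_real d) (at (?z + 1))"
          by (auto simp: polar_at_def)
        have an: "(\<lambda>w. 1 / f (w + 1)) analytic_on {?z}" using analytic_shift[OF d(1)] .
        have dv: "((\<lambda>w. 1 / f (w + 1)) has_field_derivative of_real d) (at ?z)"
          using d(3) DERIV_shift[of "\<lambda>w. 1 / f w"] by simp
        have eq: "(\<lambda>w. 1 / f w) = (\<lambda>w. (1 / f (w + 1)) / (1 - (1 / f (w + 1))\<^sup>2))"
          by (rule ext) (rule inverse_f')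
        have "(\<lambda>w. (1 / f (w + 1)) / (1 - (1 / f (w + 1))\<^sup>2)) analytic_on {?z}"
          using f1 by (intro analytic_on_divide analytic_on_diff analytic_on_const analytic_on_power an) auto
        moreover have "((\<lambda>w. (1 / f (w + 1)) / (1 - (1 / f (w + 1))\<^sup>2)) has_field_derivative
            (of_real d * (1 - (1 / f (?z + 1))\<^sup>2) - (1 / f (?z + 1)) * (0 - of_nat 2 * (of_real d * (1 / f (?z + 1)) ^ (2 - Suc 0))))
              / ((1 - (1 / f (?z + 1))\<^sup>2) * (1 - (1 / f (?z + 1))\<^sup>2))) (at ?z)"
          using f1 by (intro DERIV_divide DERIV_diff DERIV_const DERIV_power dv) auto
        then have "((\<lambda>w. (1 / f (w + 1)) / (1 - (1 / f (w + 1))\<^sup>2)) has_field_derivative of_real d) (at ?z)"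
          by (simp only: f1) simp
        ultimately show ?thesis unfolding eq using d(2) by (intro conjI exI[of _ d]) auto
      qed
      then have "polar_at x" unfolding polar_at_def using True fx by blast
      then show ?thesis ..
    qed
  qed
  from this[of "nat \<lceil>- x\<rceil> + 1"] show ?thesis by linarith
qed

lemma regular_iff: "regular_at x \<longleftrightarrow> fr (x + 1) \<noteq> 0"
  using regular_or_polar[of x] by (auto simp: regular_at_def polar_at_def)

lemma polar_iff: "polar_at x \<longleftrightarrow> fr (x + 1) = 0"
  using regular_or_polar[of x] by (auto simp: regular_at_def polar_at_def)

section \<open>Zeros, poles and meromorphy in the plane\<close>

lemma slit_or_real: "z \<in> slit \<or> (\<exists>x\<le>0. z = of_real x)"
proof (cases "z \<in> slit")
  case False
  then have "z = of_real (Re z)" "Re z \<le> 0" by (auto simp: in_slit_iff complex_eq_iff)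
  then show ?thesis by blast
qed simp

lemma polar_pole:
  assumes "polar_at x"
  shows "is_pole f (of_real x)" "zorder f (of_real x) = -1" "f meromorphic_on {of_real x}"
proof -
  obtain d where d: "((\<lambda>w. 1 / f w) has_field_derivative of_real d) (at (of_real x))" "d < 0"
    and a: "(\<lambda>w. 1 / f w) analytic_on {of_real x}" and z: "f (of_real x) = 0"
    using assms by (auto simp: polar_at_def fr_zero_iff)
  have "complex_of_real d \<noteq> 0" using d by simp
  from simple_pole[OF a z d(1) this]
  show "is_pole f (of_real x)" "zorder f (of_real x) = -1" "f meromorphic_on {of_real x}" by blast+
qed

lemma f_analytic: "f (z + 1) \<noteq> 0 \<Longrightarrow> f analytic_on {z}"
proof -
  assume nz: "f (z + 1) \<noteq> 0"
  consider "z \<in> slit" | x where "z = of_real x" using slit_or_real by blast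
  then show ?thesis
  proof cases
    case 2
    then have "fr (x + 1) \<noteq> 0" using nz fr_zero_iff[of "x + 1"] by simp
    then have "regular_at x" by (simp add: regular_iff)
    then show ?thesis using 2 by (simp add: regular_at_def)
  qed (rule f_slit_analytic)
qed

lemma not_slit_real:
  assumes "f z = 0"
  obtains x where "x \<le> 0" "z = of_real x"
  using assms f_slit_nonzero slit_or_real by blast

text \<open>With the value 0 at poles, f (z + 1) = 0 says that z + 1 is a zero or a pole, and the
  rational map y - 1 / y sends both 0 and infinity to infinity.\<close>

lemma f_pole_iff: "is_pole f z \<longleftrightarrow> f (z + 1) = 0"
proof
  assume "is_pole f z"
  then show "f (z + 1) = 0"
    using f_analytic analytic_at_imp_no_pole by blast
next
  assume 0: "f (z + 1) = 0"
  then obtain x where "z + 1 = of_real x" by (rule not_slit_real)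
  then have z: "z = of_real (x - 1)" by (simp add: algebra_simps)
  then have "fr (x - 1 + 1) = 0" using 0 fr_zero_iff[of "x"] by simp
  then show "is_pole f z" using polar_pole(1) polar_iff z by blast
qed

lemma f_zorder_pole: "is_pole f z \<Longrightarrow> zorder f z = -1"
proof -
  assume "is_pole f z"
  then have 0: "f (z + 1) = 0" by (simp add: f_pole_iff)
  then obtain x where "z + 1 = of_real x" by (rule not_slit_real)
  then have z: "z = of_real (x - 1)" by (simp add: algebra_simps)
  then have "fr (x - 1 + 1) = 0" using 0 fr_zero_iff[of "x"] by simp
  then show ?thesis using polar_pole(2) polar_iff z by blast
qed

lemma f_pole_value: "is_pole f z \<Longrightarrow> f z = 0"
  using f_fun_eq[of z] by (simp add: f_pole_iff)

lemma f_zero_deriv: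
  assumes "\<not> is_pole f z" "f z = 0"
  obtains x d where "x \<le> 0" "z = of_real x" "fr x = 0" "fr (x + 1) \<noteq> 0" "0 < d"
    "(f has_field_derivative of_real d) (at z)" "zorder f z = 1"
proof -
  obtain x where x: "x \<le> 0" "z = of_real x" using assms(2) by (rule not_slit_real)
  have r: "regular_at x" using assms(1) f_pole_iff[of z] fr_zero_iff[of "x + 1"] x by (simp add: regular_iff)
  then obtain d where d: "0 < d" "(f has_field_derivative of_real d) (at z)" "f analytic_on {z}"
    unfolding regular_at_def x by blast
  moreover have "zorder f z = 1" using d assms(2) by (intro simple_zero(1)[of f z "of_real d"]) auto
  ultimately show ?thesis using that x r assms(2) fr_zero_iff by (simp add: regular_iff)
qed

lemma nicely_meromorphic_f: "f nicely_meromorphic_on UNIV"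
  unfolding nicely_meromorphic_on_def
proof
  have "f meromorphic_on {z}" for z
  proof (cases "f (z + 1) = 0")
    case True
    then obtain x where "z + 1 = of_real x" by (rule not_slit_real)
    then have z: "z = of_real (x - 1)" by (simp add: algebra_simps)
    then have "fr (x - 1 + 1) = 0" using True fr_zero_iff[of "x"] by simp
    then show ?thesis using polar_pole(3) polar_iff z by blast
  next
    case False
    then show ?thesis using f_analytic analytic_on_imp_meromorphic_on by blast
  qed
  then show "f meromorphic_on UNIV" by (auto simp: meromorphic_on_def)
  show "\<forall>z\<in>UNIV. is_pole f z \<and> f z = 0 \<or> f \<midarrow>z\<rightarrow> f z"
  proof
    fix z
    show "is_pole f z \<and> f z = 0 \<or> f \<midarrow>z\<rightarrow> f z"
    proof (cases "is_pole f z")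
      case False
      then have "f analytic_on {z}" using f_analytic f_pole_iff by blast
      then show ?thesis using analytic_at_imp_isCont isCont_def by blast
    qed (simp add: f_pole_value)
  qed
qed

section \<open>Counting the zeros between consecutive integers\<close>

lemma fr_pos: "0 < x \<Longrightarrow> 0 < fr x"
proof -
  assume x: "0 < x"
  have "0 < (\<integral>s. (1 + s) / (x + s) \<partial>Q)" by (rule stieltjes_real_pos[OF x])
  moreover have "f (of_real x) = of_real (1 / (\<integral>s. (1 + s) / (x + s) \<partial>Q))"
    using x by (simp add: f_slit in_slit_iff f0_def G_of_real)
  ultimately show ?thesis by (simp add: fr_def)
qed

lemma fr_has_deriv:
  assumes "(f has_field_derivative of_real d) (at (of_real x))"
  shows "(fr has_real_derivative d) (at x)"
proof -
  have "((\<lambda>x. f (of_real x)) has_vector_derivative of_real d) (at x)"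
    using assms by (rule has_vector_derivative_real_field)
  from bounded_linear.has_vector_derivative[OF bounded_linear_Re this]
  show ?thesis by (simp add: has_real_derivative_iff_has_vector_derivative fr_def[abs_def])
qed

lemma fr_deriv_pos: "- 1 < x \<Longrightarrow> \<exists>d>0. (fr has_real_derivative d) (at x)"
proof -
  assume "- 1 < x"
  then have "regular_at x" using fr_pos[of "x + 1"] by (simp add: regular_iff)
  then show ?thesis using fr_has_deriv unfolding regular_at_def by blast
qed

lemma fr_strict_mono: "- 1 < x \<Longrightarrow> x < y \<Longrightarrow> fr x < fr y"
  by (rule DERIV_pos_imp_increasing[of x y fr]) (auto, meson fr_deriv_pos less_le_trans)

lemma fr_neg: "- 1 < x \<Longrightarrow> x < 0 \<Longrightarrow> fr x < 0"
  using fr_strict_mono[of x 0] by (simp add: fr_0)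

text \<open>The behaviour at the pole -1 is bypassed: the preimage \<open>psi_root c\<close> of c
  lies in ]0, 1[, is attained by \<open>fr\<close> on [0, 1] by the intermediate value theorem, and
  becomes c one step to the left.\<close>

lemma fr_surj_neg:
  assumes "c < 0"
  obtains x where "- 1 < x" "x < 0" "fr x = c"
proof -
  have r: "0 < psi_root c" "psi_root c < 1"
    using psi_root_pos psi_root_mono[of c 0] assms psi_psi_root[of c]
    by (auto simp: less_le) (metis less_irrefl psi_psi_root psi_root_0)
  have "\<exists>y\<ge>0. y \<le> 1 \<and> fr y = psi_root c"
  proof (rule IVT)
    show "\<forall>x. 0 \<le> x \<and> x \<le> 1 \<longrightarrow> isCont fr x"
      using fr_deriv_pos DERIV_isCont by (metis less_le_trans neg_less_0_iff_less zero_less_one)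
  qed (use r in \<open>auto simp: fr_0 fr_one\<close>)
  then obtain y where y: "0 \<le> y" "y \<le> 1" "fr y = psi_root c" by blast
  then have "y \<noteq> 0" "y \<noteq> 1" using r by (auto simp: fr_0 fr_one)
  moreover have "fr (y - 1) = c" using fr_fun_eq[of "y - 1"] y by simp
  ultimately show ?thesis using y that[of "y - 1"] by simp
qed

lemma fr_iterate: "fr x = (psi ^^ n) (fr (x + real n))"
proof (induction n)
  case (Suc n)
  have "fr (x + real n) = psi (fr (x + real (Suc n)))"
    using fr_fun_eq[of "x + real n"] by (simp add: add_ac)
  then show ?case using Suc by (simp add: funpow_Suc_right del: funpow.simps(2))
qed simp

lemma fr_minus_nat: "fr (- real n) = 0"
  using fr_iterate[of "- real n" n] by (simp add: fr_0)

text \<open>Since poles have value \<open>0\<close>, the condition on \<open>fr (x + 1)\<close> separates zeros from poles.\<close>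

definition zeros :: "nat \<Rightarrow> real set" where
  "zeros p = {x. - real p - 1 < x \<and> x < - real p \<and> fr x = 0 \<and> fr (x + 1) \<noteq> 0}"

text \<open>Adding \<open>Suc p\<close> moves ]-p-2, -p-1[ onto ]-1, 0[, where \<open>fr\<close> is
  a bijection onto the negative numbers. In terms of the shifted value, \<open>fr x\<close> and
  \<open>fr (x + 1)\<close> are its images under \<open>Suc p\<close> and p applications of
  \<open>psi\<close>, so the conditions defining \<open>zeros\<close> and \<open>neg_roots\<close>
  correspond.\<close>

lemma zeros_bij: "bij_betw (\<lambda>x. fr (x + real (Suc p))) (zeros (Suc p)) (neg_roots p)"
proof (rule bij_betw_imageI)
  show "inj_on (\<lambda>x. fr (x + real (Suc p))) (zeros (Suc p))"
  proof (rule inj_onI)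
    fix x y assume "x \<in> zeros (Suc p)" "y \<in> zeros (Suc p)" "fr (x + real (Suc p)) = fr (y + real (Suc p))"
    then show "x = y"
      using fr_strict_mono[of "x + real (Suc p)" "y + real (Suc p)"] fr_strict_mono[of "y + real (Suc p)" "x + real (Suc p)"]
      by (fastforce simp: zeros_def)
  qed
  have key: "x \<in> zeros (Suc p) \<longleftrightarrow> fr (x + real (Suc p)) \<in> neg_roots p"
    if "- 1 < x + real (Suc p)" "x + real (Suc p) < 0" for x
  proof -
    have "fr (x + 1) = (psi ^^ p) (fr (x + real (Suc p)))"
      using fr_iterate[of "x + 1" p] by (simp add: add_ac)
    then show ?thesis
      using fr_iterate[of x "Suc p"] fr_neg[OF that] that by (auto simp: zeros_def neg_roots_def)
  qed
  show "(\<lambda>x. fr (x + real (Suc p))) ` zeros (Suc p) = neg_roots p"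
  proof (intro equalityI subsetI)
    fix a assume "a \<in> (\<lambda>x. fr (x + real (Suc p))) ` zeros (Suc p)"
    then obtain x where x: "x \<in> zeros (Suc p)" "a = fr (x + real (Suc p))" by blast
    moreover have "- 1 < x + real (Suc p)" "x + real (Suc p) < 0" using x(1) by (auto simp: zeros_def)
    ultimately show "a \<in> neg_roots p" using key by blast
  next
    fix a assume a: "a \<in> neg_roots p"
    then have "a < 0" by (simp add: neg_roots_def)
    then obtain y where y: "- 1 < y" "y < 0" "fr y = a" by (rule fr_surj_neg)
    have "y - real (Suc p) \<in> zeros (Suc p)" using key[of "y - real (Suc p)"] y a by simp
    then show "a \<in> (\<lambda>x. fr (x + real (Suc p))) ` zeros (Suc p)" using y by (intro image_eqI[of _ _ "y - real (Suc p)"]) auto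
  qed
qed

lemma zeros_card: "card (zeros (Suc p)) = 2 ^ p"
  using bij_betw_same_card[OF zeros_bij] neg_roots_card by simp

lemma zeros_finite: "finite (zeros (Suc p))"
  using bij_betw_finite[OF zeros_bij] neg_roots_card by simp

lemma zeros_index_unique: "x \<in> zeros p \<Longrightarrow> x \<in> zeros q \<Longrightarrow> p = q"
proof -
  assume "x \<in> zeros p" "x \<in> zeros q"
  then have "real p < real q + 1" "real q < real p + 1" by (auto simp: zeros_def)
  then show "p = q" by linarith
qed

definition zero_at :: "real \<Rightarrow> bool" where
  "zero_at x \<longleftrightarrow> fr x = 0 \<and> fr (x + 1) \<noteq> 0"

lemma zero_at_iff: "zero_at x \<longleftrightarrow> x = 0 \<or> (\<exists>p. x \<in> zeros (Suc p))"
proof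
  assume z: "zero_at x"
  then have fx: "fr x = 0" "fr (x + 1) \<noteq> 0" by (auto simp: zero_at_def)
  show "x = 0 \<or> (\<exists>p. x \<in> zeros (Suc p))"
  proof (cases "x = 0")
    case False
    have "\<not> 0 < x" using fr_pos[of x] fx by auto
    with False have "x < 0" by simp
    have "\<not> (- 1 < x)" using fr_neg[of x] \<open>x < 0\<close> fx by auto
    define n where "n = nat \<lceil>- x\<rceil>"
    have n: "real n - 1 < - x" "- x \<le> real n" unfolding n_def using \<open>x < 0\<close> by linarith+
    \<comment> \<open>At a negative integer \<open>fr\<close> also vanishes one step to the right,
      so the point is a pole.\<close>
    have "x \<noteq> - real n"
    proof
      assume xn: "x = - real n"
      then have "n > 0" using \<open>x < 0\<close> by simp
      then have "x + 1 = - real (n - 1)" using xn by (simp add: of_nat_diff)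
      then show False using fx fr_minus_nat by metis
    qed
    then have n': "- x < real n" using n by simp
    have "2 \<le> n" using \<open>\<not> (- 1 < x)\<close> n' by linarith
    then obtain p where p: "n = Suc (Suc p)" using le_Suc_ex[of 2 n] by auto
    have "x \<in> zeros (Suc p)" using n n' fx p by (simp add: zeros_def)
    then show ?thesis by blast
  qed simp
next
  assume "x = 0 \<or> (\<exists>p. x \<in> zeros (Suc p))"
  then show "zero_at x" by (auto simp: zero_at_def zeros_def fr_0 fr_one)
qed

section \<open>Stieltjes inversion\<close>

text \<open>Where \<open>1 / f\<close> continues analytically across the negative axis, \<open>Im (1 / f)\<close> is
  \<open>O(y)\<close> at height \<open>y\<close>; Stieltjes inversion turns this into \<open>Q I = O(|I|^2)\<close> for small
  intervals \<open>I\<close>, so that \<open>Q\<close> vanishes nearby.\<close>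

lemma inverse_f_analytic: "\<not> zero_at x \<Longrightarrow> (\<lambda>w. 1 / f w) analytic_on {of_real x}"
proof -
  assume nz: "\<not> zero_at x"
  show ?thesis
  proof (cases "polar_at x")
    case False
    then have r: "fr (x + 1) \<noteq> 0" "f analytic_on {of_real x}"
      using regular_or_polar[of x] by (auto simp: regular_at_def)
    then have "f (of_real x) \<noteq> 0" using nz by (auto simp: zero_at_def fr_zero_iff)
    then show ?thesis using r by (intro analytic_intros) auto
  qed (simp add: polar_at_def)
qed

lemma local_null:
  assumes "\<not> zero_at x"
  obtains \<delta> where "0 < \<delta>" "prob {- x - \<delta><..<- x + \<delta>} = 0"
proof -
  define g where "g = (\<lambda>w. 1 / f w)"
  obtain e where e: "0 < e" "g holomorphic_on ball (of_real x) e"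
    using inverse_f_analytic[OF assms] by (auto simp: g_def analytic_on_def)
  define r where "r = e / 4"
  have r: "0 < r" "cball (complex_of_real x) (3 * r) \<subseteq> ball (of_real x) e"
    using e by (auto simp: r_def)
  have "continuous_on (cball (complex_of_real x) (3 * r)) (deriv g)"
    using holomorphic_deriv[OF e(2)] r(2) holomorphic_on_imp_continuous_on holomorphic_on_subset by blast
  then have "bounded (deriv g ` cball (complex_of_real x) (3 * r))"
    by (intro compact_imp_bounded compact_continuous_image) auto
  then obtain C where C: "0 < C" "\<And>w. w \<in> cball (complex_of_real x) (3 * r) \<Longrightarrow> norm (deriv g w) \<le> C"
    by (auto simp: bounded_pos)
  have lip: "norm (g v - g w) \<le> C * norm (v - w)"
    if "v \<in> cball (of_real x) (3 * r)" "w \<in> cball (of_real x) (3 * r)" for v w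
  proof (rule field_differentiable_bound[OF convex_cball])
    fix z assume z: "z \<in> cball (complex_of_real x) (3 * r)"
    then have "z \<in> ball (of_real x) e" using r by blast
    then show "(g has_field_derivative deriv g z) (at z within cball (of_real x) (3 * r))"
      by (rule has_field_derivative_at_within[OF holomorphic_derivI[OF e(2) open_ball]])
    show "norm (deriv g z) \<le> C" using C(2) z .
  qed (use that in auto)
  have bound: "prob {a<..b} \<le> 2 * C * (b - a)\<^sup>2" if "a < b" "- x - r < a" "b < - x + r" for a b
  proof -
    \<comment> \<open>The height equals the length of the interval: on \<open>{a<..b}\<close> the
      kernel (1 + s) / |z + s|^2 is then at least 1 / (2 y^2), while an imaginary part of size C y
      bounds the integral of this kernel by C.\<close>
    define y where "y = b - a"
    define z where "z = Complex (- a) y"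
    have y: "0 < y" "y < 2 * r" using that by (auto simp: y_def)
    have "norm (z - of_real (- a)) = y" using y by (simp add: z_def cmod_def)
    moreover have "norm (of_real (- a) - complex_of_real x) < r"
    proof -
      have "norm (of_real (- a) - complex_of_real x) = \<bar>- a - x\<bar>"
        by (metis norm_of_real of_real_diff real_norm_def)
      then show ?thesis using that by linarith
    qed
    ultimately have "norm (z - of_real x) \<le> 3 * r"
      using y norm_triangle_ineq[of "z - of_real (- a)" "of_real (- a) - of_real x"] by simp
    then have zb: "z \<in> cball (of_real x) (3 * r)" by (simp add: dist_norm norm_minus_commute)
    have ab: "of_real (- a) \<in> cball (complex_of_real x) (3 * r)"
      using \<open>norm (of_real (- a) - complex_of_real x) < r\<close> r by (simp add: dist_norm norm_minus_commute)
    have Imz: "Im z \<noteq> 0" "Im z = y" using y by (auto simp: z_def)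
    have zs: "z \<in> slit" using Imz by (simp add: in_slit_iff)
    \<comment> \<open>1 / f is real on the axis, so its imaginary part at z is bounded by the
      Lipschitz estimate over the distance y.\<close>
    have "Im (g (of_real (- a))) = 0"
      unfolding g_def f_of_real by (simp add: Im_divide)
    then have "\<bar>Im (g z)\<bar> \<le> norm (g z - g (of_real (- a)))"
      using abs_Im_le_cmod[of "g z - g (of_real (- a))"] by simp
    also have "\<dots> \<le> C * y"
      using lip[OF zb ab] \<open>norm (z - of_real (- a)) = y\<close> by simp
    finally have "\<bar>Im (G z)\<bar> \<le> C * y" using zs by (simp add: g_def f_slit f0_def)
    then have "\<bar>Im z\<bar> * \<bar>\<integral>s. (1 + s) / (norm (z + of_real s))\<^sup>2 \<partial>Q\<bar> \<le> C * y"
      unfolding G_Im(2)[OF Imz(1)] by (simp add: abs_mult)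
    then have I: "(\<integral>s. (1 + s) / (norm (z + of_real s))\<^sup>2 \<partial>Q) \<le> C"
      using y Imz by (simp add: mult.commute)
    have "prob {a<..b} / (2 * y\<^sup>2) = (\<integral>s. indicator {a<..b} s / (2 * y\<^sup>2) \<partial>Q)" by simp
    also have "\<dots> \<le> (\<integral>s. (1 + s) / (norm (z + of_real s))\<^sup>2 \<partial>Q)"
    proof (rule integral_mono_AE)
      show "integrable Q (\<lambda>s. indicator {a<..b} s / (2 * y\<^sup>2) :: real)"
        by (intro integrable_divide integrable_real_indicator) (auto simp: less_top[symmetric])
      show "AE s in Q. indicator {a<..b} s / (2 * y\<^sup>2) \<le> (1 + s) / (norm (z + of_real s))\<^sup>2"
        using nonneg
      proof eventually_elim
        case (elim s)
        show ?case
        proof (cases "s \<in> {a<..b}")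
          case True
          have n: "(norm (z + of_real s))\<^sup>2 = (s - a)\<^sup>2 + y\<^sup>2" by (simp add: cmod_power2 z_def)
          have "(s - a)\<^sup>2 \<le> y\<^sup>2" using True by (intro power_mono) (auto simp: y_def)
          then have "1 / (2 * y\<^sup>2) \<le> 1 / ((s - a)\<^sup>2 + y\<^sup>2)"
            using y by (intro divide_left_mono) (auto simp: add_nonneg_pos)
          also have "\<dots> \<le> (1 + s) / ((s - a)\<^sup>2 + y\<^sup>2)" using elim by (intro divide_right_mono) auto
          finally show ?thesis using True n by simp
        qed (use elim in simp)
      qed
    qed (rule G_Im(1)[OF Imz(1)])
    also note I
    finally have "prob {a<..b} \<le> C * (2 * y\<^sup>2)" using y by (simp add: divide_le_eq)
    then show ?thesis by (simp add: y_def)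
  qed
  have cdf_bound: "\<bar>cdf Q b - cdf Q a\<bar> \<le> 2 * C * (norm (b - a))\<^sup>2"
    if "- x - r < a" "a < - x + r" "- x - r < b" "b < - x + r" for a b
  proof (cases a b rule: linorder_cases)
    case less
    then show ?thesis using bound[of a b] cdf_diff_eq[of a b] that by simp
  next
    case greater
    then have "cdf Q a - cdf Q b \<le> 2 * C * (a - b)\<^sup>2" "0 \<le> cdf Q a - cdf Q b"
      using bound[of b a] cdf_diff_eq[of b a] that by simp_all
    then show ?thesis by (simp add: power2_commute)
  qed simp
  \<comment> \<open>Increments of quadratic size force the distribution function to be locally
    constant.\<close>
  have deriv: "(cdf Q has_real_derivative 0) (at a)" if "a \<in> {- x - r<..<- x + r}" for a
  proof (rule has_field_derivative_quadratic)
    show "0 < min (a - (- x - r)) (- x + r - a)" using that by simp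
    fix w assume "dist w a < min (a - (- x - r)) (- x + r - a)"
    then show "norm (cdf Q w - cdf Q a - 0 * (w - a)) \<le> 2 * C * (norm (w - a))\<^sup>2"
      using cdf_bound[of a w] that by (simp add: dist_real_def abs_less_iff)
  qed
  have "cdf Q (- x - r / 2) = cdf Q (- x + r / 2)"
    by (rule DERIV_isconst3[of "- x - r" "- x + r"]) (use r deriv in auto)
  then have "prob {- x - r / 2<..- x + r / 2} = 0"
    using cdf_diff_eq[of "- x - r / 2" "- x + r / 2"] r by simp
  moreover have "prob {- x - r / 2<..<- x + r / 2} \<le> prob {- x - r / 2<..- x + r / 2}"
    by (rule finite_measure_mono) auto
  ultimately have "prob {- x - r / 2<..<- x + r / 2} = 0" by (simp add: measure_le_0_iff)
  then show ?thesis using r that[of "r / 2"] by simp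
qed

text \<open>The null intervals of \<open>local_null\<close> depend on the point; shrinking them to
  rational endpoints leaves countably many, whose union is null.\<close>

lemma AE_zero_at: "AE s in Q. zero_at (- s)"
proof -
  define J where "J = {(a :: real, b :: real). a \<in> \<rat> \<and> b \<in> \<rat> \<and> prob {a<..<b} = 0}"
  have "J \<subseteq> \<rat> \<times> \<rat>" by (auto simp: J_def)
  then have ctbl: "countable J" using countable_rat by (meson countable_SIGMA countable_subset)
  have "AE s in Q. \<forall>(a, b)\<in>J. s \<notin> {a<..<b}"
    unfolding AE_ball_countable[OF ctbl]
  proof safe
    fix a b assume "(a, b) \<in> J"
    then have "{a<..<b} \<in> null_sets Q" by (auto simp: J_def emeasure_eq_measure intro: null_setsI)
    then show "AE s in Q. s \<notin> {a<..<b}" by (rule AE_not_in)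
  qed
  then show ?thesis
  proof eventually_elim
    case (elim s)
    show "zero_at (- s)"
    proof (rule ccontr)
      assume "\<not> zero_at (- s)"
      then obtain \<delta> where d: "0 < \<delta>" "prob {s - \<delta><..<s + \<delta>} = 0"
        using local_null[of "- s"] by auto
      obtain a where a: "a \<in> \<rat>" "s - \<delta> < a" "a < s" using Rats_dense_in_real[of "s - \<delta>" s] d by auto
      obtain b where b: "b \<in> \<rat>" "s < b" "b < s + \<delta>" using Rats_dense_in_real[of s "s + \<delta>"] d by auto
      have "prob {a<..<b} \<le> prob {s - \<delta><..<s + \<delta>}"
        using a b by (intro finite_measure_mono) auto
      then have "(a, b) \<in> J" using a b d by (simp add: J_def measure_le_0_iff)
      then show False using elim a b by auto
    qed
  qed
qed

text \<open>The mass of Q at s = -x times the numerator 1 + s of the kernel there, that is, the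
  residue of the transform at x.\<close>

definition weight :: "real \<Rightarrow> real" where
  "weight x = (1 - x) * prob {- x}"

text \<open>Provides the dominating function for y \<rightarrow> 0 on the vertical line through x;
  both y and |x + s| are at most the modulus of the denominator.\<close>

lemma kernel_height_bound:
  fixes s x y :: real
  assumes "0 \<le> s" "0 < y" "y \<le> 1"
  shows "norm (\<i> * of_real y * ((1 + of_real s) / (of_real x + \<i> * of_real y + of_real s))) \<le> 2 + \<bar>x\<bar>"
proof -
  define n where "n = norm (of_real x + \<i> * of_real y + complex_of_real s)"
  have "\<bar>Re (of_real x + \<i> * of_real y + complex_of_real s)\<bar> \<le> n" "\<bar>Im (of_real x + \<i> * of_real y + complex_of_real s)\<bar> \<le> n"
    unfolding n_def by (rule abs_Re_le_cmod, rule abs_Im_le_cmod)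
  then have n: "\<bar>x + s\<bar> \<le> n" "y \<le> n" using assms by simp_all
  have "1 + s \<le> (1 + \<bar>x\<bar>) + \<bar>x + s\<bar>" by linarith
  then have "y * (1 + s) \<le> y * (1 + \<bar>x\<bar>) + y * \<bar>x + s\<bar>"
    using assms by (metis distrib_left less_imp_le mult_left_mono)
  also have "\<dots> \<le> n * (1 + \<bar>x\<bar>) + 1 * n"
    using n assms by (intro add_mono mult_mono) auto
  finally have "y * (1 + s) \<le> (2 + \<bar>x\<bar>) * n" by (simp add: algebra_simps)
  moreover have "0 < n" using n assms by linarith
  moreover have "norm (1 + complex_of_real s) = 1 + s"
    using assms by (simp add: norm_one_add_of_real)
  ultimately show ?thesis using assms by (simp add: norm_mult norm_divide n_def[symmetric] divide_le_eq)
qed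

text \<open>Both sides are the limit of \<open>\<i> y G (x + \<i> y)\<close> for \<open>y \<rightarrow> 0\<close>.\<close>

lemma zero_weight:
  assumes "zero_at x" "(f has_field_derivative of_real d) (at (of_real x))" "d \<noteq> 0"
  shows "weight x = 1 / d"
proof -
  define y where "y = (\<lambda>n. 1 / real (Suc n))"
  have y: "0 < y n" "y n \<le> 1" for n by (simp_all add: y_def)
  have ylim: "y \<longlonglongrightarrow> 0" unfolding y_def using LIMSEQ_Suc[OF lim_1_over_n] by simp
  define h where "h = (\<lambda>n s. \<i> * of_real (y n) * ((1 + of_real s) / (of_real x + \<i> * of_real (y n) + of_real s)))"
  have "(\<lambda>n. \<integral>s. h n s \<partial>Q) \<longlonglongrightarrow> (\<integral>s. indicator {- x} s *\<^sub>R (of_real (1 - x) :: complex) \<partial>Q)"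
  proof (rule integral_dominated_convergence[where w = "\<lambda>_. 2 + \<bar>x\<bar>"])
    show "AE s in Q. (\<lambda>n. h n s) \<longlonglongrightarrow> indicator {- x} s *\<^sub>R (of_real (1 - x) :: complex)"
    proof (rule AE_I2)
      fix s
      show "(\<lambda>n. h n s) \<longlonglongrightarrow> indicator {- x} s *\<^sub>R (of_real (1 - x) :: complex)"
      proof (cases "s = - x")
        case True
        have "h n s = of_real (1 - x)" for n using y[of n] True by (simp add: h_def)
        then show ?thesis using True by simp
      next
        case False
        then have "complex_of_real (x + s) \<noteq> 0" by (simp only: of_real_eq_0_iff)
        then have nz: "complex_of_real x + \<i> * of_real 0 + of_real s \<noteq> 0" by simp
        have "(\<lambda>n. h n s) \<longlonglongrightarrow> \<i> * of_real 0 * ((1 + of_real s) / (of_real x + \<i> * of_real 0 + of_real s))"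
          unfolding h_def by (intro tendsto_intros ylim nz)
        then show ?thesis using False by simp
      qed
    qed
    show "AE s in Q. norm (h n s) \<le> 2 + \<bar>x\<bar>" for n
      using nonneg unfolding h_def by eventually_elim (rule kernel_height_bound[OF _ y])
  qed (auto simp: h_def)
  moreover have "(\<integral>s. indicator {- x} s *\<^sub>R (of_real (1 - x) :: complex) \<partial>Q) = of_real (weight x)"
    by (simp add: weight_def scaleR_conv_of_real mult.commute)
  moreover have "(\<integral>s. h n s \<partial>Q) = \<i> * of_real (y n) / f (of_real x + \<i> * of_real (y n))" for n
  proof -
    have z: "of_real x + \<i> * of_real (y n) \<in> slit" using y[of n] by (simp add: in_slit_iff)
    have "(\<integral>s. h n s \<partial>Q) = \<i> * of_real (y n) * G (of_real x + \<i> * of_real (y n))"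
      unfolding h_def G_def by (rule integral_mult_right_zero)
    then show ?thesis by (simp add: f_slit[OF z] f0_def)
  qed
  ultimately have 1: "(\<lambda>n. \<i> * of_real (y n) / f (of_real x + \<i> * of_real (y n))) \<longlonglongrightarrow> of_real (weight x)"
    by simp
  have fx: "f (of_real x) = 0" using assms(1) by (simp add: zero_at_def fr_zero_iff)
  have "filterlim (\<lambda>n. \<i> * complex_of_real (y n)) (at 0) sequentially"
    unfolding filterlim_at
  proof
    have "(\<lambda>n. \<i> * complex_of_real (y n)) \<longlonglongrightarrow> \<i> * of_real 0" by (intro tendsto_intros ylim)
    then show "(\<lambda>n. \<i> * complex_of_real (y n)) \<longlonglongrightarrow> 0" by simp
  qed (use y in \<open>auto intro!: always_eventually simp: less_imp_neq[symmetric]\<close>)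
  moreover have "(\<lambda>h. f (of_real x + h) / h) \<midarrow>0\<rightarrow> of_real d"
    using assms(2) fx by (simp add: DERIV_def)
  ultimately have "(\<lambda>n. f (of_real x + \<i> * of_real (y n)) / (\<i> * of_real (y n))) \<longlonglongrightarrow> of_real d"
    by (rule filterlim_compose[rotated])
  from tendsto_inverse[OF this]
  have "(\<lambda>n. \<i> * of_real (y n) / f (of_real x + \<i> * of_real (y n))) \<longlonglongrightarrow> inverse (of_real d)"
    using assms(3) by simp
  with 1 have "complex_of_real (weight x) = inverse (of_real d)" using LIMSEQ_unique by blast
  then show ?thesis by (metis inverse_eq_divide of_real_eq_iff of_real_inverse)
qed

lemma zero_at_deriv:
  assumes "zero_at x"
  shows "0 < weight x" "1 / deriv f (of_real x) = of_real (weight x)"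
proof -
  obtain d where d: "0 < d" "(f has_field_derivative of_real d) (at (of_real x))"
    using assms regular_iff[of x] by (auto simp: zero_at_def regular_at_def)
  have w: "weight x = 1 / d" using zero_weight[OF assms d(2)] d(1) by simp
  then show "0 < weight x" using d by simp
  show "1 / deriv f (of_real x) = of_real (weight x)"
    using DERIV_imp_deriv[OF d(2)] w by simp
qed

text \<open>Almost every s is 0 or the negative of a zero, and it belongs to at most one block, so
  the partial sums \<open>T n\<close> are dominated by the norm of h. Every series over the zeros in
  the theorem is an instance.\<close>

lemma integral_atoms:
  fixes h :: "real \<Rightarrow> 'b::{banach, second_countable_topology}"
  assumes "integrable Q h"
  shows "(\<lambda>p. \<Sum>x\<in>zeros (Suc p). prob {- x} *\<^sub>R h (- x)) sums ((\<integral>s. h s \<partial>Q) - prob {0} *\<^sub>R h 0)"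
proof -
  define T where "T = (\<lambda>n s. indicator {0} s *\<^sub>R h 0 + (\<Sum>p<n. \<Sum>x\<in>zeros (Suc p). indicator {- x} s *\<^sub>R h (- x)))"
  have ii: "integrable Q (\<lambda>s. indicator {a} s *\<^sub>R c)" for a and c :: 'b
    by (intro integrable_scaleR_left integrable_real_indicator) (auto simp: less_top[symmetric])
  have iv: "(\<integral>s. indicator {a} s *\<^sub>R c \<partial>Q) = prob {a} *\<^sub>R c" for a and c :: 'b
    by (subst integral_scaleR_left) (auto intro!: integrable_real_indicator simp: less_top[symmetric])
  have block: "(\<Sum>x\<in>zeros (Suc p). indicator {- x} s *\<^sub>R h (- x)) = (if - s \<in> zeros (Suc p) then h s else 0)" for p s
  proof -
    have "(\<Sum>x\<in>zeros (Suc p). indicator {- x} s *\<^sub>R h (- x)) = (\<Sum>x\<in>zeros (Suc p). if x = - s then h s else 0)"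
      by (intro sum.cong) (auto simp: indicator_def)
    then show ?thesis using zeros_finite by (simp add: sum.delta')
  qed
  have T0: "T n 0 = h 0" for n
    unfolding T_def block by (simp add: zeros_def)
  have Tp: "T n s = (if p < n then h s else 0)" if "- s \<in> zeros (Suc p)" for n s p
  proof -
    have "s \<noteq> 0" using that by (auto simp: zeros_def)
    have "- s \<in> zeros (Suc q) \<longleftrightarrow> q = p" for q using that zeros_index_unique by blast
    then have "T n s = (\<Sum>q<n. if q = p then h s else 0)" using \<open>s \<noteq> 0\<close> by (simp add: T_def block)
    then show ?thesis by simp
  qed
  have "(\<lambda>n. \<integral>s. T n s \<partial>Q) \<longlonglongrightarrow> (\<integral>s. h s \<partial>Q)"
  proof (rule integral_dominated_convergence[where w = "\<lambda>s. norm (h s)"])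
    show "AE s in Q. (\<lambda>n. T n s) \<longlonglongrightarrow> h s"
      using AE_zero_at
    proof eventually_elim
      case (elim s)
      then consider "s = 0" | p where "- s \<in> zeros (Suc p)" by (auto simp: zero_at_iff)
      then show ?case
      proof cases
        case 2
        have "eventually (\<lambda>n. T n s = h s) sequentially"
          using eventually_gt_at_top[of p] by eventually_elim (simp add: Tp[OF 2])
        then show ?thesis by (rule tendsto_eventually)
      qed (simp add: T0)
    qed
    show "AE s in Q. norm (T n s) \<le> norm (h s)" for n
      using AE_zero_at by eventually_elim (auto simp: zero_at_iff T0 Tp)
    show "T n \<in> borel_measurable Q" for n
      unfolding T_def
      by (intro borel_measurable_integrable Bochner_Integration.integrable_add Bochner_Integration.integrable_sum ii)
    show "integrable Q (\<lambda>s. norm (h s))" using assms by simp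
  qed (use assms in simp)
  moreover have "(\<integral>s. T n s \<partial>Q) = prob {0} *\<^sub>R h 0 + (\<Sum>p<n. \<Sum>x\<in>zeros (Suc p). prob {- x} *\<^sub>R h (- x))" for n
    unfolding T_def
    by (simp add: Bochner_Integration.integral_add Bochner_Integration.integral_sum Bochner_Integration.integrable_sum ii iv)
  ultimately have "(\<lambda>n. prob {0} *\<^sub>R h 0 + (\<Sum>p<n. \<Sum>x\<in>zeros (Suc p). prob {- x} *\<^sub>R h (- x)) - prob {0} *\<^sub>R h 0) \<longlonglongrightarrow> (\<integral>s. h s \<partial>Q) - prob {0} *\<^sub>R h 0"
    by (intro tendsto_diff tendsto_const) simp
  then show ?thesis by (simp add: sums_def)
qed

lemma AE_away:
  assumes "\<not> zero_at x"
  obtains \<delta> where "0 < \<delta>" "AE s in Q. \<delta> \<le> \<bar>x + s\<bar>"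
proof -
  obtain \<delta> where d: "0 < \<delta>" "prob {- x - \<delta><..<- x + \<delta>} = 0" using local_null[OF assms] by metis
  then have "{- x - \<delta><..<- x + \<delta>} \<in> null_sets Q" by (auto simp: emeasure_eq_measure intro: null_setsI)
  then have "AE s in Q. s \<notin> {- x - \<delta><..<- x + \<delta>}" by (rule AE_not_in)
  then have "AE s in Q. \<delta> \<le> \<bar>x + s\<bar>" by eventually_elim auto
  with d show ?thesis using that by blast
qed

text \<open>On the slit plane this is the definition of \<open>f0\<close>. A real point outside it
  is approached vertically: Q has no mass near -x, so the kernels stay bounded, and 1 / f is
  continuous there, even at a pole of f, where it is 0.\<close>

lemma inverse_f_rep:
  assumes "\<not> (f z = 0 \<and> f (z + 1) \<noteq> 0)"
  shows "integrable Q (\<lambda>s. (1 + of_real s) / (z + of_real s))"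
    and "1 / f z = (\<integral>s. (1 + of_real s) / (z + of_real s) \<partial>Q)"
proof -
  have "integrable Q (\<lambda>s. (1 + of_real s) / (z + of_real s)) \<and> 1 / f z = (\<integral>s. (1 + of_real s) / (z + of_real s) \<partial>Q)"
  proof (cases "z \<in> slit")
    case True
    then show ?thesis using kernel_integrable by (simp add: f_slit f0_def G_def)
  next
    case False
    then obtain x where z: "z = of_real x" using slit_or_real by blast
    have nz: "\<not> zero_at x"
      using assms fr_zero_iff[of x] fr_zero_iff[of "x + 1"] by (simp add: z zero_at_def)
    then obtain \<delta> where d: "0 < \<delta>" "AE s in Q. \<delta> \<le> \<bar>x + s\<bar>" using AE_away by blast
    define B where "B = (1 + \<bar>x\<bar>) / \<delta> + 1"
    have bound: "norm ((1 + of_real s) / (of_real x + \<i> * of_real y + of_real s)) \<le> B"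
      if "0 \<le> s" "\<delta> \<le> \<bar>x + s\<bar>" for s y
    proof -
      define n where "n = norm (of_real x + \<i> * of_real y + complex_of_real s)"
      have "\<bar>Re (of_real x + \<i> * of_real y + complex_of_real s)\<bar> \<le> n"
        unfolding n_def by (rule abs_Re_le_cmod)
      then have n: "\<bar>x + s\<bar> \<le> n" by simp
      then have n0: "0 < n" "\<delta> \<le> n" using d(1) that by linarith+
      have "1 + s \<le> (1 + \<bar>x\<bar>) + n" using n by linarith
      also have "1 + \<bar>x\<bar> \<le> (1 + \<bar>x\<bar>) / \<delta> * n"
        using mult_left_mono[OF n0(2), of "(1 + \<bar>x\<bar>) / \<delta>"] d(1) by simp
      finally have "1 + s \<le> B * n" by (simp add: B_def algebra_simps)
      moreover have "norm (1 + complex_of_real s) = 1 + s"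
        using that by (simp add: norm_one_add_of_real)
      ultimately show ?thesis using n0 by (simp add: norm_divide n_def[symmetric] divide_le_eq)
    qed
    have AEb: "AE s in Q. norm ((1 + of_real s) / (of_real x + \<i> * of_real y + of_real s)) \<le> B" for y
      using nonneg d(2) by eventually_elim (rule bound)
    have int: "integrable Q (\<lambda>s. (1 + of_real s) / (z + of_real s))"
      by (rule integrable_const_bound[where B = B]) (use AEb[of 0] in \<open>auto simp: z\<close>)
    define y where "y = (\<lambda>n. 1 / real (Suc n))"
    have y: "0 < y n" for n by (simp add: y_def)
    have ylim: "y \<longlonglongrightarrow> 0" unfolding y_def using LIMSEQ_Suc[OF lim_1_over_n] by simp
    have "(\<lambda>n. \<integral>s. (1 + of_real s) / (of_real x + \<i> * of_real (y n) + of_real s) \<partial>Q) \<longlonglongrightarrow> (\<integral>s. (1 + of_real s) / (z + of_real s) \<partial>Q)"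
    proof (rule integral_dominated_convergence[where w = "\<lambda>_. B"])
      show "AE s in Q. (\<lambda>n. (1 + of_real s) / (of_real x + \<i> * of_real (y n) + of_real s)) \<longlonglongrightarrow> (1 + of_real s) / (z + of_real s)"
        using d(2)
      proof eventually_elim
        case (elim s)
        then have "complex_of_real (x + s) \<noteq> 0" using d(1) by (simp only: of_real_eq_0_iff)
        then have nz: "complex_of_real x + \<i> * of_real 0 + of_real s \<noteq> 0" by simp
        have "(\<lambda>n. (1 + of_real s) / (of_real x + \<i> * of_real (y n) + of_real s)) \<longlonglongrightarrow> (1 + of_real s) / (of_real x + \<i> * of_real 0 + of_real s)"
          by (intro tendsto_intros ylim nz)
        then show ?case by (simp add: z)
      qed
    qed (use AEb in auto)
    moreover have "(\<integral>s. (1 + of_real s) / (of_real x + \<i> * of_real (y n) + of_real s) \<partial>Q) = 1 / f (of_real x + \<i> * of_real (y n))" for n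
    proof -
      have "of_real x + \<i> * of_real (y n) \<in> slit" using y[of n] by (simp add: in_slit_iff)
      then show ?thesis by (simp add: f_slit f0_def G_def)
    qed
    moreover have "(\<lambda>n. 1 / f (of_real x + \<i> * of_real (y n))) \<longlonglongrightarrow> 1 / f z"
    proof -
      have c: "isCont (\<lambda>w. 1 / f w) z"
        using analytic_at_imp_isCont[OF inverse_f_analytic[OF nz]] by (simp add: z)
      have "(\<lambda>n. of_real x + \<i> * of_real (y n)) \<longlonglongrightarrow> of_real x + \<i> * of_real 0"
        by (intro tendsto_intros ylim)
      then have "(\<lambda>n. of_real x + \<i> * of_real (y n)) \<longlonglongrightarrow> z" by (simp add: z)
      from isCont_tendsto_compose[OF c this] show ?thesis .
    qed
    ultimately have "1 / f z = (\<integral>s. (1 + of_real s) / (z + of_real s) \<partial>Q)"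
      using LIMSEQ_unique by (metis (no_types, lifting) ext)
    with int show ?thesis by blast
  qed
  then show "integrable Q (\<lambda>s. (1 + of_real s) / (z + of_real s))"
    "1 / f z = (\<integral>s. (1 + of_real s) / (z + of_real s) \<partial>Q)" by auto
qed

lemma weight_scaleR: "prob {- x} *\<^sub>R ((1 + of_real (- x)) * c) = of_real (weight x) * (c :: complex)"
  by (simp add: weight_def scaleR_conv_of_real)

lemma inverse_f_sums:
  assumes "\<not> (f z = 0 \<and> f (z + 1) \<noteq> 0)"
  shows "(\<lambda>p. \<Sum>x\<in>zeros (Suc p). of_real (weight x) / (z - of_real x)) sums (1 / f z - of_real (weight 0) / z)"
proof -
  have "prob {- x} *\<^sub>R ((1 + of_real (- x)) / (z + of_real (- x))) = of_real (weight x) / (z - of_real x)" for x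
    using weight_scaleR[of x "1 / (z - of_real x)"] by simp
  from this[of 0] this show ?thesis
    using integral_atoms[OF inverse_f_rep(1)[OF assms]] unfolding inverse_f_rep(2)[OF assms] by simp
qed

section \<open>The series of the meromorphic extension\<close>

lemma fr_nat: "fr (real n) = lam n"
proof (induction n)
  case (Suc n)
  have "psi (fr (real (Suc n))) = lam n" using fr_fun_eq[of "real n"] Suc by (simp add: add_ac)
  then show ?case
    using psi_inj_pos[of "fr (real (Suc n))" "lam (Suc n)"] fr_pos[of "real (Suc n)"] lam_Suc_pos[of n] psi_lam[of n]
    by simp
qed (simp add: fr_0)

lemma f_nat: "f (of_nat n) = of_real (lam n)"
  using f_of_real[of "real n"] by (simp add: fr_nat)

lemma f_zero_left: "f (z + of_nat n) = 0 \<Longrightarrow> f z = 0"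
proof (induction n)
  case (Suc n)
  have "f (z + of_nat n) = psi (f (z + of_nat (Suc n)))"
    using f_fun_eq[of "z + of_nat n"] by (simp add: add_ac)
  then show ?case using Suc by simp
qed simp

text \<open>The difference of the kernels at n and v = z + n is the kernel at n times z / (v + s), a
  factor of size at most 2 |z| / n. Hence f changes by a relative amount O(1 / n), and f n =
  \<open>lam n\<close> is only O(sqrt n).\<close>

lemma f_shift_tendsto: "(\<lambda>n. f (of_nat n) - f (z + of_nat n)) \<longlonglongrightarrow> 0"
proof (rule Lim_null_comparison)
  \<comment> \<open>One factor 2 comes from |v + s| being at least n / 2, the other from |G v| being
    at least g / 2; the condition n > C secures both.\<close>
  define C where "C = 4 * norm z"
  have "C \<ge> 0" by (simp add: C_def)
  show "\<forall>\<^sub>F n in sequentially. norm (f (of_nat n) - f (z + of_nat n)) \<le> C * (sqrt (2 * real n) / real n)"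
  proof (rule eventually_sequentiallyI)
    fix n :: nat assume "nat \<lceil>C\<rceil> + 1 \<le> n"
    then have n: "C < real n" by linarith
    then have n0: "0 < real n" using \<open>C \<ge> 0\<close> by linarith
    define w where "w = complex_of_nat n"
    define v where "v = z + of_nat n"
    have ws: "w \<in> slit" using n0 by (simp add: w_def in_slit_iff)
    have "- norm z \<le> Re z" using abs_Re_le_cmod[of z] by linarith
    then have vs: "v \<in> slit" using n \<open>C \<ge> 0\<close> by (simp add: v_def in_slit_iff C_def)
    define g where "g = (\<integral>s. (1 + s) / (real n + s) \<partial>Q)"
    have Gw: "G w = of_real g" using G_of_real[of "real n"] by (simp add: w_def g_def)
    have fw: "f w = of_real (lam n)" by (simp add: w_def f_nat)
    have lamg: "lam n = 1 / g"
    proof -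
      have "of_real (lam n) = (of_real (1 / g) :: complex)"
        using fw Gw f_slit[OF ws] by (simp add: f0_def)
      then show ?thesis by (simp only: of_real_eq_iff)
    qed
    have "0 < lam n" using fr_pos[OF n0] by (simp add: fr_nat)
    then have g: "0 < g" using lamg by simp
    have gint: "integrable Q (\<lambda>s. (1 + s) / (real n + s))"
      using \<open>0 < g\<close> not_integrable_integral_eq unfolding g_def by force
    have diff: "norm (G w - G v) \<le> 2 * norm z / real n * g"
    proof -
      have "norm (G w - G v) = norm (\<integral>s. (1 + of_real s) / (w + of_real s) - (1 + of_real s) / (v + of_real s) \<partial>Q)"
        unfolding G_def using kernel_integrable[OF ws] kernel_integrable[OF vs] by simp
      also have "\<dots> \<le> (\<integral>s. norm ((1 + of_real s) / (w + of_real s) - (1 + of_real s) / (v + of_real s)) \<partial>Q)"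
        by (rule integral_norm_bound)
      also have "\<dots> \<le> (\<integral>s. 2 * norm z / real n * ((1 + s) / (real n + s)) \<partial>Q)"
      proof (rule integral_mono_AE)
        show "AE s in Q. norm ((1 + of_real s) / (w + of_real s) - (1 + of_real s) / (v + of_real s)) \<le> 2 * norm z / real n * ((1 + s) / (real n + s))"
          using nonneg
        proof eventually_elim
          case (elim s)
          have ws: "w + of_real s = of_real (real n + s)" by (simp add: w_def)
          then have nw: "norm (w + of_real s) = real n + s" using elim n0 by (simp only: norm_of_real)
          have "v + of_real s = (w + of_real s) + z" by (simp add: v_def w_def)
          then have "norm (w + of_real s) - norm z \<le> norm (v + of_real s)"
            using norm_diff_ineq by metis
          then have nv: "real n / 2 \<le> norm (v + of_real s)" using nw n elim by (simp add: C_def)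
          have nz: "w + of_real s \<noteq> 0" "v + of_real s \<noteq> 0" using nw nv n0 elim by auto
          have n1: "norm (1 + complex_of_real s) = 1 + s"
            using elim by (rule norm_one_add_of_real)
          have "(1 + of_real s) / (w + of_real s) - (1 + of_real s) / (v + of_real s)
              = ((1 + of_real s) / (w + of_real s)) * (z / (v + of_real s))"
            using nz by (simp add: field_simps v_def w_def)
          then have "norm ((1 + of_real s) / (w + of_real s) - (1 + of_real s) / (v + of_real s))
              = ((1 + s) / (real n + s)) * (norm z / norm (v + of_real s))"
            by (simp only: norm_mult norm_divide nw n1)
          also have "\<dots> \<le> ((1 + s) / (real n + s)) * (norm z / (real n / 2))"
            using elim n0 nv by (intro mult_left_mono divide_left_mono mult_pos_pos) auto
          finally show ?case by (simp add: mult_ac)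
        qed
      qed (use kernel_integrable[OF ws] kernel_integrable[OF vs] gint in \<open>auto simp del: times_divide_eq_right times_divide_eq_left\<close>)
      also have "\<dots> = 2 * norm z / real n * g" unfolding g_def by (rule integral_mult_right_zero)
      finally show ?thesis .
    qed
    have "2 * norm z / real n \<le> 1 / 2" using n n0 by (simp add: C_def field_simps)
    then have "2 * norm z / real n * g \<le> g / 2" using g mult_right_mono[of _ "1 / 2" g] by fastforce
    then have Gv: "g / 2 \<le> norm (G v)"
      using diff norm_triangle_ineq2[of "G w" "G v"] g by (simp add: Gw)
    have "norm (f w - f v) = norm (G w - G v) / (g * norm (G v))"
    proof -
      have "f w - f v = - ((G w - G v) / (G w * G v))"
        using G_nonzero[OF ws] G_nonzero[OF vs] by (simp add: f_slit ws vs f0_def diff_divide_distrib)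
      then show ?thesis using g by (simp add: norm_divide norm_mult Gw)
    qed
    also have "\<dots> \<le> (2 * norm z / real n * g) / (g * (g / 2))"
      using diff Gv g by (intro frac_le mult_left_mono mult_pos_pos) auto
    also have "\<dots> = C * (lam n / real n)" using g by (simp add: lamg C_def)
    also have "\<dots> \<le> C * (sqrt (2 * real n) / real n)"
      using lam_le_sqrt[of n] \<open>C \<ge> 0\<close> by (intro mult_left_mono divide_right_mono) auto
    finally show "norm (f (of_nat n) - f (z + of_nat n)) \<le> C * (sqrt (2 * real n) / real n)"
      by (simp add: w_def v_def)
  qed
  have "(\<lambda>n. sqrt (2 * real n) / real n) \<longlonglongrightarrow> 0" by real_asymp
  then show "(\<lambda>n. C * (sqrt (2 * real n) / real n)) \<longlonglongrightarrow> 0" by (rule tendsto_mult_right_zero)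
qed

text \<open>The functional equation reads 1 / f (w + 1) = f (w + 1) - f w, so the sums along 0 and
  along z both telescope, and f 0 = 0.\<close>

lemma f_telescope: "(\<lambda>l. 1 / f (of_nat (Suc l)) - 1 / f (z + of_nat (Suc l))) sums f z"
proof -
  have inv: "1 / f (z + of_nat (Suc l)) = f (z + of_nat (Suc l)) - f (z + of_nat l)" for z l
    using f_fun_eq[of "z + of_nat l"] by (simp add: psi_def add_ac)
  have "(\<Sum>l<n. 1 / f (of_nat (Suc l)) - 1 / f (z + of_nat (Suc l))) = f z + (f (of_nat n) - f (z + of_nat n))" for n
  proof (induction n)
    case (Suc n)
    then show ?case using inv[of 0 n] inv[of z n] by simp
  qed (use f_nat[of 0] in simp)
  moreover have "(\<lambda>n. f z + (f (of_nat n) - f (z + of_nat n))) \<longlonglongrightarrow> f z + 0"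
    by (intro tendsto_add tendsto_const f_shift_tendsto)
  ultimately show ?thesis by (simp add: sums_def)
qed

text \<open>Each term of the telescoped series is the integral of (1 + s) (1 / (a + s) - 1 / (b +
  s)) with b - a = z. The factor z splits off, and summing over the atoms of Q gives the inner
  series; division by z gives the outer one when z is nonzero.\<close>

lemma f_series:
  assumes "\<not> is_pole f z"
  shows "\<exists>S T. (\<forall>l. (\<lambda>p. \<Sum>x\<in>zeros (Suc p). of_real (weight x) /
           ((of_nat (Suc l) - of_real x) * (z + of_nat (Suc l) - of_real x))) sums S l) \<and>
         (\<lambda>l. of_real (weight 0) / (of_nat (Suc l) * (z + of_nat (Suc l))) + S l) sums T \<and> f z = z * T"
proof -
  define h where "h = (\<lambda>u l s. (1 + complex_of_real s) / ((of_nat (Suc l) + of_real s) * (u + of_nat (Suc l) + of_real s)))"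
  have nz: "f (u + of_nat (Suc l)) \<noteq> 0" if "\<not> is_pole f u" for u l
    using f_zero_left[of "u + 1" l] that by (auto simp: f_pole_iff add_ac)
  have aux: "integrable Q (h u l)" "u * (\<integral>s. h u l s \<partial>Q) = 1 / f (of_nat (Suc l)) - 1 / f (u + of_nat (Suc l))"
    if u: "\<not> is_pole f u" for u l
  proof -
    define a where "a = complex_of_nat (Suc l)"
    define b where "b = u + complex_of_nat (Suc l)"
    have fa: "f a \<noteq> 0" using f_nat[of "Suc l"] lam_Suc_pos[of l] unfolding a_def by simp
    have fb: "f b \<noteq> 0" using nz[OF u] by (simp add: b_def)
    have na: "1 \<le> norm (a + of_real s)" "a + of_real s \<noteq> 0" if "0 \<le> s" for s
    proof -
      have "a + of_real s = of_real (real (Suc l) + s)" by (simp add: a_def)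
      then have "norm (a + of_real s) = real (Suc l) + s" using that by (simp only: norm_of_real)
      then show "1 \<le> norm (a + of_real s)" using that by simp
      then show "a + of_real s \<noteq> 0" by auto
    qed
    have nb: "AE s in Q. b + of_real s \<noteq> 0"
      using AE_zero_at
    proof eventually_elim
      case (elim s)
      show ?case
      proof
        assume "b + of_real s = 0"
        then have "b = of_real (- s)" by (simp add: add_eq_0_iff2)
        then have "f b = 0" using elim f_of_real[of "- s"] by (simp add: zero_at_def)
        then show False using fb by simp
      qed
    qed
    have ia: "integrable Q (\<lambda>s. (1 + of_real s) / (a + of_real s))" "1 / f a = (\<integral>s. (1 + of_real s) / (a + of_real s) \<partial>Q)"
      using inverse_f_rep[of a] fa by auto
    have ib: "integrable Q (\<lambda>s. (1 + of_real s) / (b + of_real s))" "1 / f b = (\<integral>s. (1 + of_real s) / (b + of_real s) \<partial>Q)"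
      using inverse_f_rep[of b] fb by auto
    have hm: "h u l \<in> borel_measurable Q" unfolding h_def by measurable
    show int: "integrable Q (h u l)"
    proof (rule Bochner_Integration.integrable_bound[OF ib(1) hm])
      show "AE s in Q. norm (h u l s) \<le> norm ((1 + of_real s) / (b + of_real s))"
        using nonneg
      proof eventually_elim
        case (elim s)
        have "norm (h u l s) = norm ((1 + of_real s) / (b + of_real s)) * (1 / norm (a + of_real s))"
          by (simp add: h_def a_def b_def norm_mult norm_divide)
        also have "\<dots> \<le> norm ((1 + of_real s) / (b + of_real s)) * 1"
          using na(1)[OF elim] by (intro mult_left_mono) (auto simp: divide_le_eq)
        finally show ?case by simp
      qed
    qed
    have "u * (\<integral>s. h u l s \<partial>Q) = (\<integral>s. u * h u l s \<partial>Q)" by simp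
    also have "\<dots> = (\<integral>s. (1 + of_real s) / (a + of_real s) - (1 + of_real s) / (b + of_real s) \<partial>Q)"
    proof (rule integral_cong_AE)
      show "AE s in Q. u * h u l s = (1 + of_real s) / (a + of_real s) - (1 + of_real s) / (b + of_real s)"
        using nonneg nb
      proof eventually_elim
        case (elim s)
        have "h u l s = (1 + of_real s) / ((a + of_real s) * (b + of_real s))" by (simp add: h_def a_def b_def)
        moreover have "u = (b + of_real s) - (a + of_real s)" by (simp add: a_def b_def)
        moreover have "(y - x) * (c / (x * y)) = c / x - c / y" if "x \<noteq> 0" "y \<noteq> 0" for x y c :: complex
          using that by (simp add: field_simps)
        ultimately show ?case using elim(2) na(2)[OF elim(1)] by metis
      qed
    qed (use hm in auto)
    also have "\<dots> = 1 / f a - 1 / f b" using ia ib by simp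
    finally show "u * (\<integral>s. h u l s \<partial>Q) = 1 / f (of_nat (Suc l)) - 1 / f (u + of_nat (Suc l))"
      by (simp add: a_def b_def)
  qed
  have blocks: "(\<lambda>p. \<Sum>x\<in>zeros (Suc p). of_real (weight x) / ((of_nat (Suc l) - of_real x) * (z + of_nat (Suc l) - of_real x)))
      sums ((\<integral>s. h z l s \<partial>Q) - of_real (weight 0) / (of_nat (Suc l) * (z + of_nat (Suc l))))" for l
  proof -
    have e: "prob {- x} *\<^sub>R h z l (- x) = of_real (weight x) / ((of_nat (Suc l) - of_real x) * (z + of_nat (Suc l) - of_real x))" for x
      using weight_scaleR[of x "1 / ((of_nat (Suc l) - of_real x) * (z + of_nat (Suc l) - of_real x))"] by (simp add: h_def)
    have e0: "prob {0} *\<^sub>R h z l 0 = of_real (weight 0) / (of_nat (Suc l) * (z + of_nat (Suc l)))"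
      using e[of 0] by simp
    show ?thesis
      using integral_atoms[OF aux(1)[OF assms, of l]] by (simp only: e e0)
  qed
  have "\<exists>T. (\<lambda>l. \<integral>s. h z l s \<partial>Q) sums T \<and> f z = z * T"
  proof (cases "z = 0")
    case False
    have "(\<lambda>l. z * (\<integral>s. h z l s \<partial>Q)) sums f z" unfolding aux(2)[OF assms] by (rule f_telescope)
    then have "(\<lambda>l. (z * (\<integral>s. h z l s \<partial>Q)) / z) sums (f z / z)" by (rule sums_divide)
    then show ?thesis using False by (intro exI[of _ "f z / z"]) simp
  next
    \<comment> \<open>At z = 0 the telescoped series vanishes identically and says nothing about its
      quotient by z. That quotient is compared, after an index shift by one, with the convergent
      series at u = 1.\<close>
    case True
    have p1: "\<not> is_pole f 1" using fr_nat[of 2] lam_Suc_pos[of 1] f_of_real[of 2] by (simp add: f_pole_iff numeral_2_eq_2)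
    have "summable (\<lambda>l. 1 * (\<integral>s. h 1 l s \<partial>Q))" unfolding aux(2)[OF p1] using f_telescope sums_summable by blast
    then have sm: "summable (\<lambda>l. Re (\<integral>s. h 1 l s \<partial>Q))" by (simp add: summable_Re)
    have "norm (\<integral>s. h z (Suc l) s \<partial>Q) \<le> Re (\<integral>s. h 1 l s \<partial>Q)" for l
    proof -
      have "norm (\<integral>s. h z (Suc l) s \<partial>Q) \<le> (\<integral>s. norm (h z (Suc l) s) \<partial>Q)" by (rule integral_norm_bound)
      also have "\<dots> \<le> (\<integral>s. Re (h 1 l s) \<partial>Q)"
      proof (rule integral_mono_AE)
        show "AE s in Q. norm (h z (Suc l) s) \<le> Re (h 1 l s)"
          using nonneg
        proof eventually_elim
          case (elim s)
          define c where "c = real (Suc l) + s"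
          have c: "0 < c" using elim by (simp add: c_def)
          have "h z (Suc l) s = of_real ((1 + s) / ((c + 1) * (c + 1)))" "h 1 l s = of_real ((1 + s) / (c * (c + 1)))"
            by (simp_all add: h_def True c_def add_ac)
          moreover have "(1 + s) / ((c + 1) * (c + 1)) \<le> (1 + s) / (c * (c + 1))"
            using c elim by (intro divide_left_mono mult_right_mono mult_pos_pos) auto
          ultimately show ?case using c elim by (simp only: norm_of_real Re_complex_of_real) simp
        qed
      qed (use aux(1)[OF assms] aux(1)[OF p1] in auto)
      also have "\<dots> = Re (\<integral>s. h 1 l s \<partial>Q)" using aux(1)[OF p1] by simp
      finally show ?thesis .
    qed
    then have "summable (\<lambda>l. \<integral>s. h z (Suc l) s \<partial>Q)" by (intro summable_comparison_test[OF _ sm]) auto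
    then have "summable (\<lambda>l. \<integral>s. h z l s \<partial>Q)" by (subst (asm) summable_Suc_iff)
    then show ?thesis using True f_nat[of 0] by (auto dest: summable_sums)
  qed
  then obtain T where T: "(\<lambda>l. \<integral>s. h z l s \<partial>Q) sums T" "f z = z * T" by blast
  show ?thesis
    by (intro exI[of _ "\<lambda>l. (\<integral>s. h z l s \<partial>Q) - of_real (weight 0) / (of_nat (Suc l) * (z + of_nat (Suc l)))"]
        exI[of _ T] conjI allI blocks T(2)) (use T(1) in simp)
qed

end

section \<open>The density\<close>

lemma complex_powr_measurable [measurable (raw)]:
  fixes g h :: "'a \<Rightarrow> complex"
  assumes [measurable]: "g \<in> borel_measurable M" "h \<in> borel_measurable M"
  shows "(\<lambda>x. g x powr h x) \<in> borel_measurable M"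
  unfolding powr_def by measurable

lemma norm_of_real_powr: "0 \<le> t \<Longrightarrow> norm (complex_of_real t powr w) = t powr Re w"
  by (simp add: norm_powr_real_powr)

lemma powr_le_one_of_nonneg: "0 \<le> t \<Longrightarrow> t \<le> 1 \<Longrightarrow> 0 \<le> a \<Longrightarrow> t powr a \<le> (1::real)"
  using powr_mono2[of a t 1] by simp

lemma of_real_powr_deriv:
  assumes "0 < x"
  shows "((\<lambda>x. complex_of_real x powr w) has_vector_derivative (w * of_real x powr (w - 1))) (at x within S)"
proof -
  have "((\<lambda>z. z powr w) has_field_derivative w * of_real x powr (w - 1)) (at (complex_of_real x))"
    using assms by (intro has_field_derivative_powr) (auto simp: complex_nonpos_Reals_iff)
  then show ?thesis by (rule has_vector_derivative_real_field)
qed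

text \<open>The primitive is differentiated only at t > 0, so the interval is cut off at
  \<open>e n\<close> and the cut is removed by dominated convergence.\<close>

lemma integral_powr_01:
  assumes "0 \<le> Re w"
  shows "integrable lborel (\<lambda>t. indicator {0<..<1} t *\<^sub>R (complex_of_real t powr w))"
    and "(\<integral>t. indicator {0<..<1} t *\<^sub>R (complex_of_real t powr w) \<partial>lborel) = 1 / (w + 1)"
proof -
  define e where "e = (\<lambda>n. 1 / real (Suc n))"
  have e: "0 < e n" "e n \<le> 1" for n by (simp_all add: e_def)
  have elim0: "e \<longlonglongrightarrow> 0" unfolding e_def using LIMSEQ_Suc[OF lim_1_over_n] by simp
  have w1: "w + 1 \<noteq> 0" using assms by (auto simp: complex_eq_iff)
  have bound: "norm (complex_of_real t powr w) \<le> 1" if "0 \<le> t" "t \<le> 1" for t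
    using that assms by (simp add: norm_of_real_powr powr_le_one_of_nonneg)
  have int1: "integrable lborel (indicator {0..1} :: real \<Rightarrow> real)"
    by (intro integrable_real_indicator) auto
  show "integrable lborel (\<lambda>t. indicator {0<..<1} t *\<^sub>R (complex_of_real t powr w))"
    by (rule Bochner_Integration.integrable_bound[OF int1]) (use bound in \<open>auto simp: indicator_def\<close>)
  have FTC: "(\<integral>t. indicator {e n..1} t *\<^sub>R (complex_of_real t powr w) \<partial>lborel)
      = (1 - of_real (e n) powr (w + 1)) / (w + 1)" for n
  proof -
    have "(\<integral>t. indicator {e n..1} t *\<^sub>R (complex_of_real t powr w) \<partial>lborel)
        = of_real 1 powr (w + 1) / (w + 1) - of_real (e n) powr (w + 1) / (w + 1)"
    proof (rule integral_FTC_Icc)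
      fix t assume "e n \<le> t" "t \<le> 1"
      then have t: "0 < t" using e(1)[of n] by linarith
      from has_vector_derivative_divide[OF of_real_powr_deriv[OF t, of "w + 1"], of "w + 1"]
      show "((\<lambda>t. complex_of_real t powr (w + 1) / (w + 1)) has_vector_derivative complex_of_real t powr w) (at t within {e n..1})"
        using w1 by simp
    next
      have "isCont (\<lambda>t. complex_of_real t powr w) t" if "t \<in> {e n..1}" for t
      proof -
        have "0 < t" using that e(1)[of n] by simp
        from of_real_powr_deriv[OF this] show ?thesis by (rule has_vector_derivative_continuous)
      qed
      then show "continuous_on {e n..1} (\<lambda>t. complex_of_real t powr w)"
        by (rule continuous_at_imp_continuous_on[rule_format])
    qed (use e in simp)
    then show ?thesis by (simp add: diff_divide_distrib)
  qed
  have "(\<lambda>n. \<integral>t. indicator {e n..1} t *\<^sub>R (complex_of_real t powr w) \<partial>lborel)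
      \<longlonglongrightarrow> (\<integral>t. indicator {0<..<1} t *\<^sub>R (complex_of_real t powr w) \<partial>lborel)"
  proof (rule integral_dominated_convergence[where w = "indicator {0..1}"])
    show "AE t in lborel. (\<lambda>n. indicator {e n..1} t *\<^sub>R (complex_of_real t powr w))
        \<longlonglongrightarrow> indicator {0<..<1} t *\<^sub>R (complex_of_real t powr w)"
      using AE_lborel_singleton[of 1]
    proof eventually_elim
      case (elim t)
      have "eventually (\<lambda>n. indicator {e n..1} t *\<^sub>R (complex_of_real t powr w) = indicator {0<..<1} t *\<^sub>R (complex_of_real t powr w)) sequentially"
      proof (cases "0 < t")
        case True
        have "eventually (\<lambda>n. e n < t) sequentially" using order_tendstoD(2)[OF elim0 True] .
        then show ?thesis by eventually_elim (use True elim in \<open>auto simp: indicator_def\<close>)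
      next
        case False
        then have "indicator {e n..1} t = (0::real)" for n using e(1)[of n] by (auto simp: indicator_def)
        then show ?thesis using False by (simp add: indicator_def)
      qed
      then show ?case by (rule tendsto_eventually)
    qed
    show "AE t in lborel. norm (indicator {e n..1} t *\<^sub>R (complex_of_real t powr w)) \<le> indicator {0..1} t" for n
    proof (rule AE_I2)
      fix t show "norm (indicator {e n..1} t *\<^sub>R (complex_of_real t powr w)) \<le> indicator {0..1} t"
        using bound[of t] e(1)[of n] by (auto simp: indicator_def)
    qed
  qed (use int1 in auto)
  moreover have "(\<lambda>n. (1 - complex_of_real (e n) powr (w + 1)) / (w + 1)) \<longlonglongrightarrow> (1 - 0) / (w + 1)"
  proof (intro tendsto_divide tendsto_diff tendsto_const w1)
    show "(\<lambda>n. complex_of_real (e n) powr (w + 1)) \<longlonglongrightarrow> 0"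
    proof (rule Lim_null_comparison[OF always_eventually elim0], rule allI)
      fix n
      have "norm (complex_of_real (e n) powr (w + 1)) = e n powr (Re w + 1)"
        using e(1)[of n] by (simp add: norm_of_real_powr)
      also have "\<dots> = e n powr Re w * e n" using e(1)[of n] by (simp add: powr_add)
      also have "\<dots> \<le> 1 * e n"
        using e[of n] assms by (intro mult_right_mono powr_le_one_of_nonneg) auto
      finally show "norm (complex_of_real (e n) powr (w + 1)) \<le> e n" by simp
    qed
  qed
  ultimately show "(\<integral>t. indicator {0<..<1} t *\<^sub>R (complex_of_real t powr w) \<partial>lborel) = 1 / (w + 1)"
    unfolding FTC using LIMSEQ_unique by fastforce
qed

text \<open>On [0, 1] the partial sums of the exponential series are dominated by
  \<open>exp \<bar>t\<bar>\<close>, so the moments determine the characteristic function.\<close>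

lemma moment_measure_unique:
  fixes M N :: "real measure"
  assumes "sets M = sets borel" "emeasure M UNIV = 1" "emeasure M {0..1} = 1"
    and "sets N = sets borel" "emeasure N UNIV = 1" "emeasure N {0..1} = 1"
    and eq: "\<And>n. (\<integral>t. t ^ n \<partial>M) = (\<integral>t. t ^ n \<partial>N)"
  shows "M = N"
proof -
  have rd: "real_distribution P" if "sets P = sets borel" "emeasure P UNIV = 1" for P :: "real measure"
  proof -
    have "space P = UNIV" using sets_eq_imp_space_eq[OF that(1)] by simp
    then interpret prob_space P by (intro prob_spaceI) (simp add: that)
    show ?thesis by unfold_locales (rule that(1))
  qed
  have ch: "(\<lambda>k. \<Sum>n<k. (\<i> * of_real t) ^ n / fact n * of_real (\<integral>x. x ^ n \<partial>P)) \<longlonglongrightarrow> char P t"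
    if P: "sets P = sets borel" "emeasure P UNIV = 1" "emeasure P {0..1} = 1" for P :: "real measure" and t
  proof -
    interpret P: real_distribution P by (rule rd[OF P(1,2)])
    have "P.prob {0..1} = 1" using P(3) by (simp add: P.emeasure_eq_measure)
    then have AE01: "AE x in P. x \<in> {0..1}" by (subst P.AE_in_set_eq_1) auto
    have int: "integrable P (\<lambda>x. x ^ n)" for n
    proof (rule P.integrable_const_bound[where B = 1])
      show "AE x in P. norm (x ^ n) \<le> 1" using AE01 by eventually_elim (auto simp: power_le_one)
    qed simp
    have "(\<lambda>k. \<integral>x. (\<Sum>n<k. (\<i> * of_real (t * x)) ^ n / fact n) \<partial>P) \<longlonglongrightarrow> (\<integral>x. exp (\<i> * of_real (t * x)) \<partial>P)"
    proof (rule integral_dominated_convergence[where w = "\<lambda>_. exp \<bar>t\<bar>"])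
      show "AE x in P. (\<lambda>k. \<Sum>n<k. (\<i> * of_real (t * x)) ^ n / fact n) \<longlonglongrightarrow> exp (\<i> * of_real (t * x))"
      proof (rule AE_I2)
        fix x
        have "(\<lambda>n. (\<i> * of_real (t * x)) ^ n /\<^sub>R fact n) sums exp (\<i> * of_real (t * x))" by (rule exp_converges)
        then show "(\<lambda>k. \<Sum>n<k. (\<i> * of_real (t * x)) ^ n / fact n) \<longlonglongrightarrow> exp (\<i> * of_real (t * x))"
          by (simp add: sums_def scaleR_conv_of_real divide_inverse mult.commute)
      qed
      show "AE x in P. norm (\<Sum>n<k. (\<i> * of_real (t * x)) ^ n / fact n) \<le> exp \<bar>t\<bar>" for k
        using AE01
      proof eventually_elim
        case (elim x)
        have "\<bar>t * x\<bar> \<le> \<bar>t\<bar>" using elim by (auto simp: abs_mult mult_left_le)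
        have "norm (\<Sum>n<k. (\<i> * of_real (t * x)) ^ n / fact n) \<le> (\<Sum>n<k. norm ((\<i> * complex_of_real (t * x)) ^ n / fact n))"
          by (rule norm_sum)
        also have "\<dots> = (\<Sum>n<k. \<bar>t * x\<bar> ^ n / fact n)"
          by (intro sum.cong) (simp_all add: norm_divide norm_power norm_mult abs_mult)
        also have "\<dots> \<le> (\<Sum>n<k. \<bar>t\<bar> ^ n / fact n)"
          using \<open>\<bar>t * x\<bar> \<le> \<bar>t\<bar>\<close> by (intro sum_mono divide_right_mono power_mono) auto
        also have "\<dots> \<le> (\<Sum>n. \<bar>t\<bar> ^ n / fact n)"
          using summable_exp[of "\<bar>t\<bar>"] by (intro sum_le_suminf) (auto simp: divide_inverse mult.commute)
        also have "\<dots> = exp \<bar>t\<bar>" by (simp add: exp_def scaleR_conv_of_real divide_inverse mult.commute)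
        finally show ?case .
      qed
    qed auto
    moreover have "(\<integral>x. (\<Sum>n<k. (\<i> * of_real (t * x)) ^ n / fact n) \<partial>P)
        = (\<Sum>n<k. (\<i> * of_real t) ^ n / fact n * of_real (\<integral>x. x ^ n \<partial>P))" for k
    proof -
      have "(\<integral>x. (\<Sum>n<k. (\<i> * of_real (t * x)) ^ n / fact n) \<partial>P)
          = (\<integral>x. (\<Sum>n<k. (\<i> * of_real t) ^ n / fact n * of_real (x ^ n)) \<partial>P)"
        by (simp add: power_mult_distrib mult_ac)
      also have "\<dots> = (\<Sum>n<k. \<integral>x. (\<i> * of_real t) ^ n / fact n * of_real (x ^ n) \<partial>P)"
        using int by (intro Bochner_Integration.integral_sum integrable_mult_right integrable_of_real) auto
      also have "\<dots> = (\<Sum>n<k. (\<i> * of_real t) ^ n / fact n * of_real (\<integral>x. x ^ n \<partial>P))"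
        by (intro sum.cong refl) (simp only: integral_mult_right_zero integral_complex_of_real)
      finally show ?thesis .
    qed
    ultimately show ?thesis by (simp add: char_def)
  qed
  have "char M = char N"
  proof
    fix t
    show "char M t = char N t"
      using ch[OF assms(1-3), of t] ch[OF assms(4-6), of t] unfolding eq by (rule LIMSEQ_unique)
  qed
  then show ?thesis using Levy_uniqueness rd assms by blast
qed

lemma integral_powr_01_real:
  fixes r :: real
  assumes "0 \<le> r"
  shows "integrable lborel (\<lambda>t. indicator {0<..<1} t * t powr r)"
    and "(\<integral>t. indicator {0<..<1} t * t powr r \<partial>lborel) = 1 / (r + 1)"
proof -
  have e: "Re (indicator {0<..<1} t *\<^sub>R (complex_of_real t powr of_real r)) = indicator {0<..<1} t * t powr r" for t
    by (auto simp: indicator_def powr_of_real)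
  note p = integral_powr_01[of "of_real r"]
  show "integrable lborel (\<lambda>t. indicator {0<..<1} t * t powr r)"
    using integrable_Re[OF p(1)] assms unfolding e by simp
  have "(\<integral>t. indicator {0<..<1} t * t powr r \<partial>lborel) = Re (1 / (of_real r + 1))"
    using integral_Re[OF p(1)] p(2) assms unfolding e by simp
  also have "\<dots> = Re (of_real (1 / (r + 1)))" by simp
  finally show "(\<integral>t. indicator {0<..<1} t * t powr r \<partial>lborel) = 1 / (r + 1)"
    by (simp only: Re_complex_of_real)
qed

text \<open>For t < 1 / 2 the quotient is at most 2 / (1 / 2) = 4. Otherwise the power is exp w with
  w = z ln t, where |ln t| is at most 2 (1 - t), which cancels the denominator, and at most 1, which
  bounds |Re w| by Re z.\<close>

lemma powr_difference_bound:
  assumes "0 \<le> Re z"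
  obtains C where "\<And>t. 0 < t \<Longrightarrow> t < 1 \<Longrightarrow> norm ((1 - complex_of_real t powr z) / (1 - of_real t)) \<le> C"
proof
  define C where "C = exp (Re z) * (2 * norm z)"
  fix t :: real assume t: "0 < t" "t < 1"
  have nt: "norm (1 - complex_of_real t) = 1 - t"
    using t by (metis abs_of_pos diff_gt_0_iff_gt norm_of_real of_real_1 of_real_diff)
  show "norm ((1 - complex_of_real t powr z) / (1 - of_real t)) \<le> max 4 C"
  proof (cases "t < 1 / 2")
    case True
    have "norm (1 - complex_of_real t powr z) \<le> 1 + norm (complex_of_real t powr z)"
      using norm_triangle_ineq4[of 1 "complex_of_real t powr z"] by simp
    also have "norm (complex_of_real t powr z) \<le> 1"
      using t assms by (simp add: norm_of_real_powr powr_le_one_of_nonneg)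
    finally have "norm (1 - complex_of_real t powr z) \<le> 4 * (1 - t)" using True by simp
    then have "norm ((1 - complex_of_real t powr z) / (1 - of_real t)) \<le> 4"
      using t by (simp add: norm_divide nt divide_le_eq)
    then show ?thesis by simp
  next
    case False
    define w where "w = z * of_real (ln t)"
    have ln: "- ln t \<le> 2 * (1 - t)" "- ln t \<le> 1" "ln t < 0"
    proof -
      have "ln (1 / t) \<le> 1 / t - 1" using t by (intro ln_le_minus_one) simp
      then have a: "- ln t \<le> (1 - t) / t" using t by (simp add: ln_div diff_divide_distrib)
      have "(1 - t) / t \<le> (1 - t) / (1 / 2)" using t False by (intro divide_left_mono) auto
      with a show "- ln t \<le> 2 * (1 - t)" by simp
      then show "- ln t \<le> 1" using False by simp
      show "ln t < 0" using t by simp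
    qed
    have "complex_of_real t powr z = exp w" using t by (simp add: powr_def w_def Ln_of_real)
    then have "norm (1 - complex_of_real t powr z) = norm (exp w - 1)" by (simp add: norm_minus_commute)
    also have "\<dots> \<le> exp \<bar>Re w\<bar> * norm w" using Taylor_exp[of w 0] by simp
    also have "\<dots> \<le> exp (Re z) * (norm z * (2 * (1 - t)))"
    proof (intro mult_mono)
      have "\<bar>Re w\<bar> = Re z * - ln t" using ln assms by (simp add: w_def abs_mult)
      also have "\<dots> \<le> Re z * 1" using ln assms by (intro mult_left_mono) auto
      finally show "exp \<bar>Re w\<bar> \<le> exp (Re z)" by simp
      show "norm w \<le> norm z * (2 * (1 - t))"
      proof -
        have "norm w = norm z * - ln t" using ln by (simp add: w_def norm_mult)
        also have "\<dots> \<le> norm z * (2 * (1 - t))" using ln by (intro mult_left_mono) auto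
        finally show ?thesis .
      qed
    qed auto
    finally have "norm (1 - complex_of_real t powr z) \<le> C * (1 - t)" by (simp only: C_def mult_ac)
    then have "norm ((1 - complex_of_real t powr z) / (1 - of_real t)) \<le> C"
      using t by (simp add: norm_divide nt divide_le_eq)
    then show ?thesis by simp
  qed
qed

context stieltjes_fixed_point
begin

section \<open>The density as a mixture of powers\<close>

definition dens :: "real \<Rightarrow> real" where
  "dens t = (\<integral>s. (1 + s) * t powr s \<partial>Q)"

lemma dens_integrable:
  assumes "0 < t" "t < 1"
  shows "integrable Q (\<lambda>s. (1 + s) * t powr s)"
proof (rule integrable_const_bound[where B = "1 + 1 / (- ln t)"])
  define c where "c = - ln t"
  have c: "0 < c" using assms by (simp add: c_def)
  show "AE s in Q. norm ((1 + s) * t powr s) \<le> 1 + 1 / (- ln t)"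
    using nonneg
  proof eventually_elim
    case (elim s)
    have "t powr s = exp (- (c * s))" using assms by (simp add: powr_def c_def mult.commute)
    moreover have "c * s \<le> exp (c * s)" using exp_ge_add_one_self[of "c * s"] by linarith
    then have "s * exp (- (c * s)) \<le> 1 / c" using c by (simp add: exp_minus field_simps)
    ultimately have "s * t powr s \<le> 1 / c" by simp
    moreover have "t powr s \<le> 1" using assms elim by (simp add: powr_le_one_of_nonneg)
    ultimately have "(1 + s) * t powr s \<le> 1 + 1 / c" by (simp add: distrib_right)
    then show ?case using elim by (simp add: c_def)
  qed
qed measurable

lemma dens_measurable [measurable]: "dens \<in> borel_measurable borel"
  unfolding dens_def[abs_def] by measurable

lemma dens_nonneg: "0 \<le> dens t"
  unfolding dens_def by (rule integral_nonneg_AE) (use nonneg in \<open>auto elim!: eventually_mono\<close>)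

lemma dens_sums:
  assumes "0 < t" "t < 1"
  shows "(\<lambda>p. \<Sum>x\<in>zeros (Suc p). weight x * t powr (- x)) sums (dens t - weight 0)"
proof -
  have e: "prob {- x} *\<^sub>R ((1 + - x) * t powr (- x)) = weight x * t powr (- x)" for x
    by (simp add: weight_def)
  have e0: "prob {0} *\<^sub>R ((1 + 0) * t powr 0) = weight 0" using assms by (simp add: weight_def)
  show ?thesis
    using integral_atoms[OF dens_integrable[OF assms]] unfolding e e0 dens_def .
qed

lemma dens_mono: "mono_on {0<..<1} dens"
proof (rule mono_onI)
  fix t u :: real assume tu: "t \<in> {0<..<1}" "u \<in> {0<..<1}" "t \<le> u"
  show "dens t \<le> dens u"
    unfolding dens_def
  proof (rule integral_mono_AE)
    show "AE s in Q. (1 + s) * t powr s \<le> (1 + s) * u powr s"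
      using nonneg by eventually_elim (use tu in \<open>auto intro!: mult_left_mono powr_mono2\<close>)
  qed (use tu in \<open>auto intro!: dens_integrable\<close>)
qed

text \<open>Powers with exponent in ]0, 1[ would be concave. As f has no zero in ]-1, 0[, almost
  every s is 0 or at least 1, and these powers are convex.\<close>

lemma dens_convex: "convex_on {0<..<1} dens"
proof (rule convex_onI)
  fix a t u :: real assume a: "0 < a" "a < 1" and tu: "t \<in> {0<..<1}" "u \<in> {0<..<1}"
  define v where "v = (1 - a) * t + a * u"
  have "v \<in> {0<..<1}"
    unfolding v_def using convexD[of "{0<..<1::real}" t u "1 - a" a] a tu by simp
  have "dens v \<le> (\<integral>s. (1 - a) * ((1 + s) * t powr s) + a * ((1 + s) * u powr s) \<partial>Q)"
    unfolding dens_def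
  proof (rule integral_mono_AE)
    show "AE s in Q. (1 + s) * v powr s \<le> (1 - a) * ((1 + s) * t powr s) + a * ((1 + s) * u powr s)"
      using nonneg AE_zero_at
    proof eventually_elim
      case (elim s)
      have "v powr s \<le> (1 - a) * t powr s + a * u powr s"
      proof (cases "s = 0")
        case False
        then have "1 \<le> s" using elim by (auto simp: zero_at_iff zeros_def)
        from convex_onD[OF powr_convex[OF this], of a t u] show ?thesis
          using a tu by (simp add: v_def)
      qed (use \<open>v \<in> {0<..<1}\<close> tu in simp)
      then have "(1 + s) * v powr s \<le> (1 + s) * ((1 - a) * t powr s + a * u powr s)"
        using elim by (intro mult_left_mono) auto
      then show ?case by (simp add: algebra_simps)
    qed
  qed (use \<open>v \<in> {0<..<1}\<close> tu in \<open>auto intro!: dens_integrable Bochner_Integration.integrable_add integrable_mult_right\<close>)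
  also have "\<dots> = (1 - a) * dens t + a * dens u"
    unfolding dens_def using tu dens_integrable by (simp add: dens_integrable)
  finally show "dens ((1 - a) *\<^sub>R t + a *\<^sub>R u) \<le> (1 - a) * dens t + a * dens u"
    by (simp add: v_def)
qed simp

text \<open>The integral of the power with exponent z + s is 1 / (z + s + 1), so exchanging the
  integrals produces \<open>G (z + 1)\<close>. The exchange is justified because the norms integrate
  over t to (1 + s) / (Re z + s + 1) \<le> 1.\<close>

lemma dens_transform:
  assumes z: "0 \<le> Re z"
  shows "integrable lborel (\<lambda>t. (indicator {0<..<1} t * dens t) *\<^sub>R (complex_of_real t powr z))"
    and "(\<integral>t. (indicator {0<..<1} t * dens t) *\<^sub>R (complex_of_real t powr z) \<partial>lborel) = 1 / f (z + 1)"
proof -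
  interpret P: pair_sigma_finite Q lborel
    by (intro pair_sigma_finite.intro sigma_finite_measure_axioms lborel.sigma_finite_measure_axioms)
  define k where "k = (\<lambda>s t. indicator {0<..<1} t *\<^sub>R ((1 + complex_of_real s) * complex_of_real t powr (z + of_real s)))"
  have k_alt: "k s t = (1 + of_real s) * (indicator {0<..<1} t *\<^sub>R (complex_of_real t powr (z + of_real s)))" for s t
    by (simp add: k_def)
  have k_norm: "norm (k s t) = (1 + s) * (indicator {0<..<1} t * t powr (Re z + s))" if "0 \<le> s" for s t
  proof -
    have "norm (1 + complex_of_real s) = 1 + s"
      using that by (rule norm_one_add_of_real)
    then show ?thesis by (auto simp: k_alt norm_mult norm_of_real_powr indicator_def)
  qed
  have int: "integrable (Q \<Otimes>\<^sub>M lborel) (case_prod k)"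
  proof (rule P.Fubini_integrable)
    show "case_prod k \<in> borel_measurable (Q \<Otimes>\<^sub>M lborel)"
      unfolding k_def by measurable
    then have m: "(\<lambda>s. \<integral>t. norm (k s t) \<partial>lborel) \<in> borel_measurable Q"
      by (intro lborel.borel_measurable_lebesgue_integral) (simp add: case_prod_beta' comp_def)
    show "integrable Q (\<lambda>s. \<integral>t. norm (case_prod k (s, t)) \<partial>lborel)"
    proof (rule integrable_const_bound[where B = 1])
      show "AE s in Q. norm (\<integral>t. norm (case_prod k (s, t)) \<partial>lborel) \<le> 1"
        using nonneg
      proof eventually_elim
        case (elim s)
        have "(\<integral>t. norm (k s t) \<partial>lborel) = (1 + s) * (1 / (Re z + s + 1))"
          unfolding k_norm[OF elim] using integral_powr_01_real(2)[of "Re z + s"] z elim by simp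
        also have "\<dots> \<le> 1" using z elim by simp
        finally show ?case by simp
      qed
    qed (use m in simp)
    show "AE s in Q. integrable lborel (\<lambda>t. case_prod k (s, t))"
      using nonneg
    proof eventually_elim
      case (elim s)
      have "integrable lborel (\<lambda>t. indicator {0<..<1} t *\<^sub>R (complex_of_real t powr (z + of_real s)))"
        by (rule integral_powr_01(1)) (use z elim in simp)
      then show ?case unfolding case_prod_conv k_alt by (rule integrable_mult_right)
    qed
  qed
  have snd: "(\<integral>s. k s t \<partial>Q) = (indicator {0<..<1} t * dens t) *\<^sub>R (complex_of_real t powr z)" for t
  proof (cases "t \<in> {0<..<1}")
    case True
    then have "k s t = complex_of_real ((1 + s) * t powr s) * complex_of_real t powr z" for s
      by (simp add: k_def powr_add powr_of_real mult_ac)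
    then have "(\<integral>s. k s t \<partial>Q) = of_real (dens t) * complex_of_real t powr z"
      unfolding dens_def by (simp only: integral_mult_left_zero integral_complex_of_real)
    then show ?thesis using True by (simp add: scaleR_conv_of_real)
  qed (simp add: k_def)
  from P.integrable_snd[OF int]
  show "integrable lborel (\<lambda>t. (indicator {0<..<1} t * dens t) *\<^sub>R (complex_of_real t powr z))"
    unfolding snd .
  have "(\<integral>t. (\<integral>s. k s t \<partial>Q) \<partial>lborel) = (\<integral>s. (\<integral>t. k s t \<partial>lborel) \<partial>Q)"
    by (rule P.Fubini_integral[OF int])
  also have "\<dots> = (\<integral>s. (1 + of_real s) / (z + 1 + of_real s) \<partial>Q)"
  proof (rule integral_cong_AE)
    show "AE s in Q. (\<integral>t. k s t \<partial>lborel) = (1 + of_real s) / (z + 1 + of_real s)"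
      using nonneg
    proof eventually_elim
      case (elim s)
      have "(\<integral>t. indicator {0<..<1} t *\<^sub>R (complex_of_real t powr (z + of_real s)) \<partial>lborel) = 1 / (z + of_real s + 1)"
        by (rule integral_powr_01(2)) (use z elim in simp)
      then have "(\<integral>t. k s t \<partial>lborel) = (1 + of_real s) * (1 / (z + of_real s + 1))"
        unfolding k_alt by (simp only: integral_mult_right_zero)
      then show ?case by (simp add: add_ac)
    qed
    show "(\<lambda>s. \<integral>t. k s t \<partial>lborel) \<in> borel_measurable Q"
      using P.integrable_fst[OF int] by auto
  qed simp
  also have "\<dots> = 1 / f (z + 1)"
    using z f_slit[of "z + 1"] by (simp add: f0_def G_def in_slit_iff)
  finally show "(\<integral>t. (indicator {0<..<1} t * dens t) *\<^sub>R (complex_of_real t powr z) \<partial>lborel) = 1 / f (z + 1)"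
    unfolding snd .
qed

definition dens_measure :: "real measure" where
  "dens_measure = density lborel (\<lambda>t. ennreal (indicator {0<..<1} t * dens t))"

lemma sets_dens_measure [measurable_cong, simp]: "sets dens_measure = sets borel"
  by (simp add: dens_measure_def)

lemma dens_measure_integral:
  fixes h :: "real \<Rightarrow> 'b::{banach, second_countable_topology}"
  assumes "h \<in> borel_measurable borel"
  shows "(\<integral>t. h t \<partial>dens_measure) = (\<integral>t. (indicator {0<..<1} t * dens t) *\<^sub>R h t \<partial>lborel)"
  unfolding dens_measure_def using assms dens_nonneg by (intro integral_density) auto

lemma dens_measure_powr: "0 \<le> Re z \<Longrightarrow> (\<integral>t. complex_of_real t powr z \<partial>dens_measure) = 1 / f (z + 1)"
  by (subst dens_measure_integral) (auto simp: dens_transform)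

lemma dens_measure_AE: "AE t in dens_measure. t \<in> {0<..<1}"
  unfolding dens_measure_def by (subst AE_density) (auto simp: indicator_def)

lemma dens_measure_moment: "(\<integral>t. t ^ n \<partial>dens_measure) = 1 / lam (Suc n)"
proof -
  have "complex_of_real (\<integral>t. t ^ n \<partial>dens_measure) = (\<integral>t. complex_of_real (t ^ n) \<partial>dens_measure)"
    by (simp only: integral_complex_of_real)
  also have "\<dots> = (\<integral>t. complex_of_real t powr of_nat n \<partial>dens_measure)"
  proof (rule integral_cong_AE)
    show "AE t in dens_measure. complex_of_real (t ^ n) = complex_of_real t powr of_nat n"
      using dens_measure_AE by eventually_elim (auto simp: powr_nat)
  qed auto
  also have "\<dots> = 1 / f (of_nat n + 1)" by (rule dens_measure_powr) simp
  also have "\<dots> = of_real (1 / lam (Suc n))" using f_nat[of "Suc n"] by (simp add: add_ac)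
  finally show ?thesis by (simp only: of_real_eq_iff)
qed

lemma dens_measure_prob: "emeasure dens_measure UNIV = 1" "emeasure dens_measure {0..1} = 1"
proof -
  have i: "integrable lborel (\<lambda>t. indicator {0<..<1} t * dens t)"
  proof -
    have "integrable lborel (\<lambda>t. Re ((indicator {0<..<1} t * dens t) *\<^sub>R (complex_of_real t powr 0)))"
      by (rule integrable_Re[OF dens_transform(1)]) simp
    moreover have "Re ((indicator {0<..<1} t * dens t) *\<^sub>R (complex_of_real t powr 0)) = indicator {0<..<1} t * dens t" for t
      by (auto simp: indicator_def)
    ultimately show ?thesis by (simp only:)
  qed
  have "(\<integral>t. indicator {0<..<1} t * dens t \<partial>lborel) = (\<integral>t. t ^ 0 \<partial>dens_measure)"
    by (subst dens_measure_integral) auto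
  also have "\<dots> = 1" unfolding dens_measure_moment by simp
  finally have I: "(\<integral>t. indicator {0<..<1} t * dens t \<partial>lborel) = 1" .
  have "emeasure dens_measure UNIV = (\<integral>\<^sup>+ t. ennreal (indicator {0<..<1} t * dens t) \<partial>lborel)"
    by (simp add: dens_measure_def emeasure_density)
  also have "\<dots> = ennreal 1"
    using nn_integral_eq_integral[OF i] dens_nonneg I by simp
  finally show 1: "emeasure dens_measure UNIV = 1" by simp
  have "emeasure dens_measure {0..1} = emeasure dens_measure UNIV"
  proof (rule emeasure_eq_AE)
    show "AE t in dens_measure. t \<in> {0..1} \<longleftrightarrow> t \<in> UNIV"
      using dens_measure_AE by eventually_elim auto
  qed auto
  with 1 show "emeasure dens_measure {0..1} = 1" by simp
qed

text \<open>Expanding 1 / (1 - t) geometrically produces the terms of \<open>f_telescope\<close>;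
  the partial sums are (1 - t^n) times the integrand and therefore share its bound.\<close>

lemma dens_measure_f:
  assumes z: "0 < Re z"
  shows "(\<integral>t. (if t = 1 then z else (1 - complex_of_real t powr z) / (1 - complex_of_real t)) \<partial>dens_measure) = f z"
proof -
  interpret M: finite_measure dens_measure
    by (rule finite_measureI) (use dens_measure_prob in \<open>simp add: dens_measure_def\<close>)
  obtain C where C: "\<And>t. 0 < t \<Longrightarrow> t < 1 \<Longrightarrow> norm ((1 - complex_of_real t powr z) / (1 - of_real t)) \<le> C"
    using powr_difference_bound[of z] z by auto
  define g where "g = (\<lambda>t. if t = 1 then z else (1 - complex_of_real t powr z) / (1 - complex_of_real t))"
  define S where "S = (\<lambda>n t. \<Sum>l<n. complex_of_real t powr of_nat l - complex_of_real t powr (z + of_nat l))"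
  have S: "S n t = (1 - of_real t ^ n) * g t" if "t \<in> {0<..<1}" for n t
  proof -
    have "S n t = (\<Sum>l<n. complex_of_real t ^ l * (1 - complex_of_real t powr z))"
      unfolding S_def using that by (intro sum.cong) (auto simp: powr_add powr_nat algebra_simps)
    also have "\<dots> = (\<Sum>l<n. complex_of_real t ^ l) * (1 - complex_of_real t powr z)" by (simp add: sum_distrib_right)
    also have "(\<Sum>l<n. complex_of_real t ^ l) = (1 - of_real t ^ n) / (1 - of_real t)"
      using that by (subst sum_gp_strict) auto
    finally show ?thesis using that by (simp add: g_def)
  qed
  have int: "integrable dens_measure (\<lambda>t. complex_of_real t powr w)" if "0 \<le> Re w" for w
  proof (rule M.integrable_const_bound[where B = 1])
    show "AE t in dens_measure. norm (complex_of_real t powr w) \<le> 1"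
      using dens_measure_AE by eventually_elim (use that in \<open>auto simp: norm_of_real_powr powr_le_one_of_nonneg\<close>)
  qed simp
  have "(\<lambda>n. \<integral>t. S n t \<partial>dens_measure) \<longlonglongrightarrow> (\<integral>t. g t \<partial>dens_measure)"
  proof (rule integral_dominated_convergence[where w = "\<lambda>_. C"])
    show "AE t in dens_measure. (\<lambda>n. S n t) \<longlonglongrightarrow> g t"
      using dens_measure_AE
    proof eventually_elim
      case (elim t)
      have "(\<lambda>n. (1 - complex_of_real t ^ n) * g t) \<longlonglongrightarrow> (1 - 0) * g t"
        using elim by (intro tendsto_intros LIMSEQ_power_zero) auto
      then show ?case by (simp add: S[OF elim])
    qed
    show "AE t in dens_measure. norm (S n t) \<le> C" for n
      using dens_measure_AE
    proof eventually_elim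
      case (elim t)
      have "norm (1 - complex_of_real t ^ n) = \<bar>1 - t ^ n\<bar>"
        by (metis norm_of_real of_real_1 of_real_diff of_real_power real_norm_def)
      also have "\<dots> \<le> 1" using elim by (auto simp: power_le_one abs_le_iff intro: order_trans[OF _ zero_le_power])
      finally have "norm (1 - complex_of_real t ^ n) * norm (g t) \<le> 1 * C"
        using C[of t] elim by (intro mult_mono) (auto simp: g_def)
      then show ?case by (simp add: S[OF elim] norm_mult)
    qed
  qed (auto simp: S_def g_def)
  moreover have "(\<integral>t. S n t \<partial>dens_measure) = (\<Sum>l<n. 1 / f (of_nat (Suc l)) - 1 / f (z + of_nat (Suc l)))" for n
  proof -
    have "(\<integral>t. S n t \<partial>dens_measure) = (\<Sum>l<n. \<integral>t. complex_of_real t powr of_nat l - complex_of_real t powr (z + of_nat l) \<partial>dens_measure)"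
      unfolding S_def using z by (intro Bochner_Integration.integral_sum Bochner_Integration.integrable_diff int) auto
    also have "\<dots> = (\<Sum>l<n. 1 / f (of_nat (Suc l)) - 1 / f (z + of_nat (Suc l)))"
    proof (rule sum.cong)
      fix l
      show "(\<integral>t. complex_of_real t powr of_nat l - complex_of_real t powr (z + of_nat l) \<partial>dens_measure)
          = 1 / f (of_nat (Suc l)) - 1 / f (z + of_nat (Suc l))"
        using z by (subst Bochner_Integration.integral_diff) (auto intro!: int simp: dens_measure_powr add_ac)
    qed simp
    finally show ?thesis .
  qed
  ultimately have "(\<lambda>l. 1 / f (of_nat (Suc l)) - 1 / f (z + of_nat (Suc l))) sums (\<integral>t. g t \<partial>dens_measure)"
    by (simp add: sums_def)
  then show ?thesis using f_telescope[of z] sums_unique2 unfolding g_def by blast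
qed

end

section \<open>Identification of the defining objects\<close>

lemma sum_inverse_lam: "1 + (\<Sum>i=1..n. 1 / lam (Suc i)) = lam (Suc n)"
proof (induction n)
  case (Suc n)
  then show ?case using inverse_lam_Suc[of "Suc n"] by simp
qed simp

text \<open>For uniqueness, the partial sum y up to \<open>Suc n\<close> is positive and satisfies y
  - 1 / y = \<open>lam (Suc n)\<close>, and \<open>psi\<close> is injective on the positive
  axis.\<close>

lemma mseq_eq: "mseq = (\<lambda>n. 1 / lam (Suc n))"
  unfolding mseq_def
proof (rule the_equality)
  show "1 / lam (Suc 0) = 1 \<and> (\<forall>n. 0 < 1 / lam (Suc n)) \<and>
      (\<forall>n\<ge>1. (1 + (\<Sum>i=1..n. 1 / lam (Suc i))) * (1 / lam (Suc n)) = 1)"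
  proof (intro conjI allI impI)
    fix n :: nat
    show "0 < 1 / lam (Suc n)" using lam_Suc_pos by simp
    show "(1 + (\<Sum>i=1..n. 1 / lam (Suc i))) * (1 / lam (Suc n)) = 1"
      unfolding sum_inverse_lam using lam_Suc_pos[of n] by simp
  qed simp
next
  fix m :: "nat \<Rightarrow> real"
  assume m: "m 0 = 1 \<and> (\<forall>n. 0 < m n) \<and> (\<forall>n\<ge>1. (1 + (\<Sum>i=1..n. m i)) * m n = 1)"
  have "m n = 1 / lam (Suc n) \<and> 1 + (\<Sum>i=1..n. m i) = lam (Suc n)" for n
  proof (induction n)
    case (Suc n)
    define y where "y = lam (Suc n) + m (Suc n)"
    have S: "1 + (\<Sum>i=1..Suc n. m i) = y" using Suc by (simp add: y_def)
    then have ym: "y * m (Suc n) = 1" using m by (metis One_nat_def Suc_le_mono zero_le)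
    have "0 < m (Suc n)" using m by blast
    then have y0: "0 < y" using lam_Suc_pos[of n] by (simp add: y_def)
    have mi: "m (Suc n) = 1 / y" using ym y0 by (simp add: field_simps)
    then have "psi y = lam (Suc n)" by (simp add: psi_def y_def)
    then have "y = lam (Suc (Suc n))"
      using psi_inj_pos[OF y0 lam_Suc_pos[of "Suc n"]] psi_lam[of "Suc n"] by simp
    then show ?case using S mi by simp
  qed (use m in simp)
  then show "m = (\<lambda>n. 1 / lam (Suc n))" by blast
qed

text \<open>The difference vanishes in a punctured neighbourhood of every point or is nonzero in one
  of every point; the half plane excludes the latter at 1. Values are then recovered as limits, or
  are 0 at a common pole.\<close>

lemma nicely_meromorphic_unique:
  assumes g: "g nicely_meromorphic_on UNIV" and h: "h nicely_meromorphic_on UNIV"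
    and eq: "\<And>z. 0 < Re z \<Longrightarrow> g z = h z"
  shows "g = h"
proof
  fix z
  have "(\<lambda>z. g z - h z) meromorphic_on UNIV"
    using g h by (intro meromorphic_intros) (auto simp: nicely_meromorphic_on_def)
  then consider "\<forall>z. eventually (\<lambda>w. g w - h w = 0) (at z)" | "\<forall>z. eventually (\<lambda>w. g w - h w \<noteq> 0) (at z)"
    using meromorphic_imp_constant_or_avoid[of "\<lambda>z. g z - h z" UNIV 0]
    by (auto simp: eventually_cosparse_open_eq)
  then show "g z = h z"
  proof cases
    case 1
    then have ev: "eventually (\<lambda>w. g w = h w) (at z)" by simp
    then have poles: "is_pole g z \<longleftrightarrow> is_pole h z" by (rule is_pole_cong) simp
    show ?thesis
    proof (cases "is_pole g z")
      case True
      have "g z = 0 \<and> h z = 0"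
        using g h True poles not_tendsto_and_filterlim_at_infinity[OF trivial_limit_at]
        unfolding nicely_meromorphic_on_def is_pole_def by blast
      then show ?thesis by simp
    next
      case False
      then have "g \<midarrow>z\<rightarrow> g z" "h \<midarrow>z\<rightarrow> h z"
        using g h poles unfolding nicely_meromorphic_on_def by blast+
      moreover have "h \<midarrow>z\<rightarrow> g z" using \<open>g \<midarrow>z\<rightarrow> g z\<close> by (rule Lim_transform_eventually) (rule ev)
      ultimately show ?thesis using LIM_unique by blast
    qed
  next
    case 2
    have "eventually (\<lambda>w::complex. w \<in> {w. 0 < Re w}) (at 1)"
      by (rule eventually_at_in_open') (auto intro: open_halfspace_Re_gt)
    moreover have "eventually (\<lambda>w. g w - h w \<noteq> 0) (at 1)" using 2 by blast
    ultimately have "eventually (\<lambda>w::complex. False) (at 1)" by eventually_elim (use eq in auto)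
    then show ?thesis by simp
  qed
qed

context stieltjes_fixed_point
begin

lemma mu_eq: "mu = dens_measure"
  unfolding mu_def
proof (rule the_equality)
  show "sets dens_measure = sets borel \<and> emeasure dens_measure UNIV = 1 \<and> emeasure dens_measure {0..1} = 1 \<and>
      (\<forall>n. (\<integral>t. t ^ n \<partial>dens_measure) = mseq n)"
    by (simp add: dens_measure_prob dens_measure_moment mseq_eq)
  fix M :: "real measure"
  assume M: "sets M = sets borel \<and> emeasure M UNIV = 1 \<and> emeasure M {0..1} = 1 \<and> (\<forall>n. (\<integral>t. t ^ n \<partial>M) = mseq n)"
  show "M = dens_measure"
    by (rule moment_measure_unique) (use M in \<open>simp_all add: dens_measure_prob dens_measure_moment mseq_eq\<close>)
qed

lemma f_mero_eq: "f_mero = f"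
  unfolding f_mero_def
proof (rule the_equality)
  have f_int: "f z = f_int z" if "0 < Re z" for z
    using dens_measure_f[OF that] by (simp add: f_int_def mu_eq)
  then show "f nicely_meromorphic_on UNIV \<and> (\<forall>z. 0 < Re z \<longrightarrow> f z = f_int z)"
    using nicely_meromorphic_f by blast
  fix g assume "g nicely_meromorphic_on UNIV \<and> (\<forall>z. 0 < Re z \<longrightarrow> g z = f_int z)"
  then show "g = f"
    using f_int nicely_meromorphic_f by (intro nicely_meromorphic_unique) auto
qed

lemma nicely_meromorphic_inverse_shift: "(\<lambda>z. 1 / f (z + 1)) nicely_meromorphic_on UNIV"
proof -
  define g where "g = (\<lambda>z. inverse (f z))"
  have g: "g nicely_meromorphic_on UNIV"
    unfolding g_def by (intro nicely_meromorphic_on_inverse nicely_meromorphic_f)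
  have "(\<lambda>z. g (z + 1)) nicely_meromorphic_on UNIV"
    unfolding nicely_meromorphic_on_def
  proof
    have "g meromorphic_on UNIV" using g by (simp add: nicely_meromorphic_on_def)
    then show "(\<lambda>z. g (z + 1)) meromorphic_on UNIV"
      by (rule meromorphic_on_compose) (auto intro!: analytic_intros)
    show "\<forall>z\<in>UNIV. is_pole (\<lambda>z. g (z + 1)) z \<and> g (z + 1) = 0 \<or> (\<lambda>z. g (z + 1)) \<midarrow>z\<rightarrow> g (z + 1)"
    proof
      fix z
      consider "is_pole g (z + 1)" "g (z + 1) = 0" | "g \<midarrow>z + 1\<rightarrow> g (z + 1)"
        using g unfolding nicely_meromorphic_on_def by blast
      then show "is_pole (\<lambda>z. g (z + 1)) z \<and> g (z + 1) = 0 \<or> (\<lambda>z. g (z + 1)) \<midarrow>z\<rightarrow> g (z + 1)"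
      proof cases
        case 1
        then show ?thesis using is_pole_shift_iff[of g 1 z] by (simp add: comp_def add.commute)
      next
        case 2
        from LIM_offset[OF this, of 1] show ?thesis by simp
      qed
    qed
  qed
  then show ?thesis by (simp add: g_def inverse_eq_divide)
qed

lemma F_mero_eq: "F_mero = (\<lambda>z. 1 / f (z + 1))"
  unfolding F_mero_def
proof (rule the_equality)
  have F_int: "1 / f (z + 1) = F_int z" if "0 < Re z" for z
    using dens_measure_powr[of z] that by (simp add: F_int_def mu_eq)
  then show "(\<lambda>z. 1 / f (z + 1)) nicely_meromorphic_on UNIV \<and> (\<forall>z. 0 < Re z \<longrightarrow> 1 / f (z + 1) = F_int z)"
    using nicely_meromorphic_inverse_shift by blast
  fix g assume "g nicely_meromorphic_on UNIV \<and> (\<forall>z. 0 < Re z \<longrightarrow> g z = F_int z)"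
  then show "g = (\<lambda>z. 1 / f (z + 1))"
    using F_int nicely_meromorphic_inverse_shift by (intro nicely_meromorphic_unique) auto
qed

text \<open>Genuine zeros of f at z + 1 are poles of the function in question, so the hypothesis
  excludes them; poles of f at z + 1 remain admissible and give the value 0.\<close>

lemma F_sums:
  assumes "\<not> is_pole (\<lambda>z. 1 / f (z + 1)) z"
  shows "(\<lambda>p. \<Sum>x\<in>zeros (Suc p). of_real (weight x) / (z + 1 - of_real x)) sums (1 / f (z + 1) - of_real (weight 0) / (z + 1))"
proof (rule inverse_f_sums)
  show "\<not> (f (z + 1) = 0 \<and> f (z + 1 + 1) \<noteq> 0)"
  proof
    assume z: "f (z + 1) = 0 \<and> f (z + 1 + 1) \<noteq> 0"
    then have np: "\<not> is_pole f (z + 1)" by (simp add: f_pole_iff)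
    obtain x d where d: "0 < d" "(f has_field_derivative of_real d) (at (z + 1))"
      using f_zero_deriv[OF np] z by metis
    have "f analytic_on {z + 1}" using z by (intro f_analytic) simp
    then have "isolated_zero f (z + 1)"
      using simple_zero(2)[of f "z + 1" "of_real d"] d z by simp
    then have "is_pole (\<lambda>z. inverse (f z)) (z + 1)" by (simp add: is_pole_inverse_iff)
    then have "is_pole (\<lambda>z. 1 / f (z + 1)) z"
      using is_pole_shift_iff[of "\<lambda>z. inverse (f z)" 1 z] by (simp add: comp_def add.commute inverse_eq_divide)
    with assms show False ..
  qed
qed

lemma zero_at_real_iff: "\<not> is_pole f (of_real x) \<and> f (of_real x) = 0 \<longleftrightarrow> zero_at x"
  using fr_zero_iff[of x] fr_zero_iff[of "x + 1"] by (auto simp: f_pole_iff zero_at_def)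

lemma zero_set: "{z. \<not> is_pole f z \<and> f z = 0} = insert 0 {of_real x | x p. x \<in> zeros (Suc p)}"
proof (intro equalityI subsetI)
  fix z assume z: "z \<in> {z. \<not> is_pole f z \<and> f z = 0}"
  then obtain x where x: "z = of_real x" using not_slit_real by blast
  then have "x = 0 \<or> (\<exists>p. x \<in> zeros (Suc p))" using z zero_at_real_iff zero_at_iff by blast
  then show "z \<in> insert 0 {of_real x | x p. x \<in> zeros (Suc p)}" using x by auto
next
  fix z assume "z \<in> insert 0 {complex_of_real x | x p. x \<in> zeros (Suc p)}"
  then obtain x where "z = of_real x" "zero_at x" unfolding zero_at_iff by fastforce
  then show "z \<in> {z. \<not> is_pole f z \<and> f z = 0}" using zero_at_real_iff by blast
qed

text \<open>Walking right from a pole ends at the last l with f (z + l) = 0, which exists because f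
  has no zeros in the slit plane; the point reached is a genuine zero.\<close>

lemma pole_set:
  "{z. is_pole f z} = {- of_nat l | l. l \<ge> 1} \<union> {of_real x - of_nat l | x p l. l \<ge> 1 \<and> x \<in> zeros (Suc p)}"
proof (intro equalityI subsetI)
  fix z assume "z \<in> {z. is_pole f z}"
  define P where "P = (\<lambda>l. f (z + of_nat l) = 0)"
  have P1: "P 1" using \<open>z \<in> {z. is_pole f z}\<close> by (simp add: P_def f_pole_iff)
  have bound: "l \<le> nat \<lceil>- Re z\<rceil>" if "P l" for l
  proof (rule ccontr)
    assume "\<not> l \<le> nat \<lceil>- Re z\<rceil>"
    then have "- Re z < real l" by linarith
    then have "z + of_nat l \<in> slit" by (simp add: in_slit_iff)
    then show False using f_slit_nonzero that by (simp add: P_def)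
  qed
  define l where "l = Greatest P"
  have "P l" unfolding l_def by (rule GreatestI_nat[of P, OF P1 bound])
  then have l: "f (z + of_nat l) = 0" by (simp add: P_def)
  have l1: "1 \<le> l" unfolding l_def by (rule Greatest_le_nat[of P, OF P1 bound])
  have "\<not> P (Suc l)"
  proof
    assume "P (Suc l)"
    from Greatest_le_nat[of P, OF this bound] show False by (simp add: l_def)
  qed
  then have "f (z + of_nat (Suc l)) \<noteq> 0" by (simp add: P_def)
  then have "\<not> is_pole f (z + of_nat l)" by (simp add: f_pole_iff add_ac)
  with l have "z + of_nat l \<in> insert 0 {of_real x | x p. x \<in> zeros (Suc p)}" using zero_set by blast
  then show "z \<in> {- of_nat l | l. l \<ge> 1} \<union> {of_real x - of_nat l | x p l. l \<ge> 1 \<and> x \<in> zeros (Suc p)}"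
  proof
    assume "z + of_nat l = 0"
    then have "z = - of_nat l" by (simp add: eq_neg_iff_add_eq_0)
    then show ?thesis using l1 by blast
  next
    assume "z + of_nat l \<in> {of_real x | x p. x \<in> zeros (Suc p)}"
    then obtain x p where "z + of_nat l = of_real x" "x \<in> zeros (Suc p)" by blast
    then have "z = of_real x - of_nat l" by (simp add: algebra_simps)
    then show ?thesis using l1 \<open>x \<in> zeros (Suc p)\<close> by blast
  qed
next
  fix z :: complex assume "z \<in> {- of_nat l | l. l \<ge> 1} \<union> {of_real x - of_nat l | x p l. l \<ge> 1 \<and> x \<in> zeros (Suc p)}"
  then obtain w l where w: "f w = 0" "z = w - of_nat l" "l \<ge> 1"
  proof
    assume "z \<in> {- of_nat l | l. l \<ge> 1}"
    then show ?thesis using that[of 0] f_nat[of 0] by auto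
  next
    assume "z \<in> {of_real x - of_nat l | x p l. l \<ge> 1 \<and> x \<in> zeros (Suc p)}"
    then obtain x p l where "z = of_real x - of_nat l" "l \<ge> 1" "x \<in> zeros (Suc p)" by blast
    moreover from this have "f (of_real x) = 0" by (simp add: zeros_def fr_zero_iff)
    ultimately show ?thesis using that by blast
  qed
  have "z + 1 + of_nat (l - 1) = w" using w by (simp add: of_nat_diff)
  then have "f (z + 1) = 0" using f_zero_left[of "z + 1" "l - 1"] w by simp
  then show "z \<in> {z. is_pole f z}" by (simp add: f_pole_iff)
qed

section \<open>Indexing the zeros in increasing order\<close>

definition xi :: "nat \<Rightarrow> nat \<Rightarrow> real" where
  "xi p k = sorted_list_of_set (zeros p) ! (k - 1)"

lemma xi_bij: "bij_betw (xi (Suc p)) {1..2 ^ p} (zeros (Suc p))"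
proof -
  have "bij_betw (\<lambda>k. k - 1) {1..2 ^ p} {..<2 ^ p :: nat}"
    by (rule bij_betw_byWitness[where f' = Suc]) auto
  moreover have "bij_betw ((!) (sorted_list_of_set (zeros (Suc p)))) {..<2 ^ p} (zeros (Suc p))"
    by (rule bij_betw_nth) (simp_all add: zeros_finite zeros_card)
  ultimately have "bij_betw ((!) (sorted_list_of_set (zeros (Suc p))) \<circ> (\<lambda>k. k - 1)) {1..2 ^ p} (zeros (Suc p))"
    by (rule bij_betw_trans)
  then show ?thesis by (simp add: comp_def xi_def[abs_def])
qed

lemma xi_sum: "(\<Sum>k=1..2 ^ p. h (xi (Suc p) k)) = (\<Sum>x\<in>zeros (Suc p). h x)"
  by (rule sum.reindex_bij_betw[OF xi_bij])

lemma xi_mem: "k \<in> {1..2 ^ p} \<Longrightarrow> xi (Suc p) k \<in> zeros (Suc p)"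
  using xi_bij bij_betwE by blast

lemma xi_less:
  assumes "k \<in> {1..<2 ^ p}"
  shows "xi (Suc p) k < xi (Suc p) (k + 1)"
proof -
  have "sorted_wrt (<) (sorted_list_of_set (zeros (Suc p)))" by simp
  then show ?thesis
    unfolding xi_def by (rule sorted_wrt_nth_less) (use assms in \<open>auto simp: zeros_card\<close>)
qed

text \<open>The parameters g and P let one statement cover both the zero set and its translates, the
  poles.\<close>

lemma xi_image: "{g x l | x p l. P l \<and> x \<in> zeros (Suc p)} = {g (xi p k) l | p k l. P l \<and> p \<ge> 1 \<and> k \<in> {1..2 ^ (p - 1)}}"
proof (intro equalityI subsetI)
  fix z assume "z \<in> {g x l | x p l. P l \<and> x \<in> zeros (Suc p)}"
  then obtain x p l where x: "z = g x l" "P l" "x \<in> zeros (Suc p)" by blast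
  then obtain k where "k \<in> {1..2 ^ p}" "x = xi (Suc p) k"
    using bij_betw_imp_surj_on[OF xi_bij] by (metis imageE)
  then have "z = g (xi (Suc p) k) l" "P l" "Suc p \<ge> 1" "k \<in> {1..2 ^ (Suc p - 1)}" using x by auto
  then show "z \<in> {g (xi p k) l | p k l. P l \<and> p \<ge> 1 \<and> k \<in> {1..2 ^ (p - 1)}}" by blast
next
  fix z assume "z \<in> {g (xi p k) l | p k l. P l \<and> p \<ge> 1 \<and> k \<in> {1..2 ^ (p - 1)}}"
  then obtain p k l where pk: "z = g (xi p k) l" "P l" "p \<ge> 1" "k \<in> {1..2 ^ (p - 1)}" by blast
  then obtain q where q: "p = Suc q" by (metis Suc_le_D One_nat_def)
  then have "xi (Suc q) k \<in> zeros (Suc q)" using pk xi_mem by simp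
  then show "z \<in> {g x l | x p l. P l \<and> x \<in> zeros (Suc p)}" using pk q by blast
qed

end

theorem theorem1p4:
  "\<exists>(\<xi> :: nat \<Rightarrow> nat \<Rightarrow> real) (\<rho>0 :: real) (\<rho> :: nat \<Rightarrow> nat \<Rightarrow> real).
     \<comment> \<open>location and ordering of the zeros xi_{p,k}\<close>
     (\<forall>p\<ge>1. \<forall>k\<in>{1..2^(p-1)}. - real p - 1 < \<xi> p k \<and> \<xi> p k < - real p) \<and>
     (\<forall>p\<ge>1. \<forall>k\<in>{1..<2^(p-1)}. \<xi> p k < \<xi> p (k + 1)) \<and>
     \<comment> \<open>zeros and poles lie in ]-infinity,0] and are simple\<close>
     (\<forall>z. (is_pole f_mero z \<or> f_mero z = 0) \<longrightarrow> z \<in> complex_of_real ` {..0}) \<and>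
     (\<forall>z. \<not> is_pole f_mero z \<and> f_mero z = 0 \<longrightarrow> zorder f_mero z = 1) \<and>
     (\<forall>z. is_pole f_mero z \<longrightarrow> zorder f_mero z = -1) \<and>
     \<comment> \<open>the zero set\<close>
     {z. \<not> is_pole f_mero z \<and> f_mero z = 0} =
        insert 0 {complex_of_real (\<xi> p k) | p k. p \<ge> 1 \<and> k \<in> {1..2^(p-1)}} \<and>
     \<comment> \<open>the pole set\<close>
     {z. is_pole f_mero z} =
        {- of_nat l | l. l \<ge> 1} \<union>
        {complex_of_real (\<xi> p k) - of_nat l | p k l. l \<ge> 1 \<and> p \<ge> 1 \<and> k \<in> {1..2^(p-1)}} \<and>
     \<comment> \<open>the residue-type coefficients\<close>
     0 < \<rho>0 \<and> 1 / deriv f_mero 0 = complex_of_real \<rho>0 \<and>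
     (\<forall>p\<ge>1. \<forall>k\<in>{1..2^(p-1)}. 0 < \<rho> p k \<and> 1 / deriv f_mero (complex_of_real (\<xi> p k)) = complex_of_real (\<rho> p k)) \<and>
     \<comment> \<open>partial fraction expansion of F\<close>
     (\<forall>z. \<not> is_pole F_mero z \<longrightarrow>
        (\<lambda>p. \<Sum>k=1..2^p. complex_of_real (\<rho> (Suc p) k) / (z + 1 - complex_of_real (\<xi> (Suc p) k)))
          sums (F_mero z - complex_of_real \<rho>0 / (z + 1))) \<and>
     \<comment> \<open>series expansion of f\<close>
     (\<forall>z. \<not> is_pole f_mero z \<longrightarrow>
        (\<exists>S T. (\<forall>l. (\<lambda>p. \<Sum>k=1..2^p. complex_of_real (\<rho> (Suc p) k) /
                  ((of_nat (Suc l) - complex_of_real (\<xi> (Suc p) k)) * (z + of_nat (Suc l) - complex_of_real (\<xi> (Suc p) k))))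
                  sums S l) \<and>
               (\<lambda>l. complex_of_real \<rho>0 / (of_nat (Suc l) * (z + of_nat (Suc l))) + S l) sums T \<and>
               f_mero z = z * T)) \<and>
     \<comment> \<open>absolute continuity of mu with an increasing convex density on ]0,1[\<close>
     (\<exists>D :: real \<Rightarrow> real.
        (\<forall>t\<in>{0<..<1}. (\<lambda>p. \<Sum>k=1..2^p. \<rho> (Suc p) k * t powr (- \<xi> (Suc p) k)) sums (D t - \<rho>0)) \<and>
        mu = density lborel (\<lambda>t. ennreal (indicator {0<..<1} t * D t)) \<and>
        mono_on {0<..<1} D \<and> convex_on {0<..<1} D)"
proof -
  obtain Q where "real_distribution Q" "AE s in Q. 0 \<le> s"
    "\<And>x. 0 < x \<Longrightarrow> 1 / (\<integral>s. (1 + s) / (x + s) \<partial>Q) = psi (1 / (\<integral>s. (1 + s) / (x + 1 + s) \<partial>Q))"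
    using fixed_point_measure_exists by blast
  then interpret stieltjes_fixed_point Q
    by (intro stieltjes_fixed_point.intro stieltjes_fixed_point_axioms.intro)
  have zero0: "zero_at 0" by (simp add: zero_at_iff)
  have mem: "xi p k \<in> zeros p \<and> zero_at (xi p k)" if pk: "1 \<le> p" "k \<in> {1..2 ^ (p - 1)}" for p k
  proof -
    obtain q where "p = Suc q" using pk(1) by (metis Suc_le_D One_nat_def)
    then show ?thesis using pk xi_mem[of k q] zero_at_iff by auto
  qed
  show ?thesis
    unfolding f_mero_eq F_mero_eq mu_eq
  proof (rule exI[of _ xi], rule exI[of _ "weight 0"], rule exI[of _ "\<lambda>p k. weight (xi p k)"], intro conjI)
    show "\<forall>p\<ge>1. \<forall>k\<in>{1..2 ^ (p - 1)}. - real p - 1 < xi p k \<and> xi p k < - real p"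
      using mem by (auto simp: zeros_def)
    show "\<forall>p\<ge>1. \<forall>k\<in>{1..<2 ^ (p - 1)}. xi p k < xi p (k + 1)"
    proof (intro allI impI ballI)
      fix p k :: nat assume pk: "1 \<le> p" "k \<in> {1..<2 ^ (p - 1)}"
      then obtain q where "p = Suc q" by (metis Suc_le_D One_nat_def)
      then show "xi p k < xi p (k + 1)" using pk xi_less[of k q] by simp
    qed
    show "\<forall>z. (is_pole f z \<or> f z = 0) \<longrightarrow> z \<in> complex_of_real ` {..0}"
      using f_pole_value not_slit_real by (metis atMost_iff image_eqI)
    show "\<forall>z. \<not> is_pole f z \<and> f z = 0 \<longrightarrow> zorder f z = 1"
      using f_zero_deriv by metis
    show "\<forall>z. is_pole f z \<longrightarrow> zorder f z = -1"
      using f_zorder_pole by blast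
    show "{z. \<not> is_pole f z \<and> f z = 0} =
        insert 0 {complex_of_real (xi p k) | p k. p \<ge> 1 \<and> k \<in> {1..2 ^ (p - 1)}}"
      using zero_set xi_image[of "\<lambda>x _. complex_of_real x" "\<lambda>_. True"] by simp
    show "{z. is_pole f z} = {- of_nat l | l. l \<ge> 1} \<union>
        {complex_of_real (xi p k) - of_nat l | p k l. l \<ge> 1 \<and> p \<ge> 1 \<and> k \<in> {1..2 ^ (p - 1)}}"
      unfolding pole_set xi_image[of "\<lambda>x l. complex_of_real x - of_nat l"] ..
    show "0 < weight 0" "1 / deriv f 0 = complex_of_real (weight 0)"
      using zero_at_deriv[OF zero0] by simp_all
    show "\<forall>p\<ge>1. \<forall>k\<in>{1..2 ^ (p - 1)}. 0 < weight (xi p k) \<and>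
        1 / deriv f (complex_of_real (xi p k)) = complex_of_real (weight (xi p k))"
      using mem zero_at_deriv by blast
    show "\<forall>z. \<not> is_pole (\<lambda>z. 1 / f (z + 1)) z \<longrightarrow>
        (\<lambda>p. \<Sum>k=1..2 ^ p. complex_of_real (weight (xi (Suc p) k)) / (z + 1 - complex_of_real (xi (Suc p) k)))
          sums (1 / f (z + 1) - complex_of_real (weight 0) / (z + 1))"
      unfolding xi_sum[of "\<lambda>x. complex_of_real (weight x) / (_ + 1 - complex_of_real x)"] using F_sums by blast
    show "\<forall>z. \<not> is_pole f z \<longrightarrow>
        (\<exists>S T. (\<forall>l. (\<lambda>p. \<Sum>k=1..2 ^ p. complex_of_real (weight (xi (Suc p) k)) /
                  ((of_nat (Suc l) - complex_of_real (xi (Suc p) k)) * (z + of_nat (Suc l) - complex_of_real (xi (Suc p) k))))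
                  sums S l) \<and>
               (\<lambda>l. complex_of_real (weight 0) / (of_nat (Suc l) * (z + of_nat (Suc l))) + S l) sums T \<and>
               f z = z * T)"
      unfolding xi_sum[of "\<lambda>x. complex_of_real (weight x) / ((of_nat (Suc _) - complex_of_real x) * (_ + of_nat (Suc _) - complex_of_real x))"]
      using f_series by blast
    show "\<exists>D :: real \<Rightarrow> real.
        (\<forall>t\<in>{0<..<1}. (\<lambda>p. \<Sum>k=1..2 ^ p. weight (xi (Suc p) k) * t powr (- xi (Suc p) k)) sums (D t - weight 0)) \<and>
        dens_measure = density lborel (\<lambda>t. ennreal (indicator {0<..<1} t * D t)) \<and>
        mono_on {0<..<1} D \<and> convex_on {0<..<1} D"
    proof (intro exI[of _ dens] conjI ballI)
      fix t :: real assume t: "t \<in> {0<..<1}"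
      show "(\<lambda>p. \<Sum>k=1..2 ^ p. weight (xi (Suc p) k) * t powr (- xi (Suc p) k)) sums (dens t - weight 0)"
        unfolding xi_sum[of "\<lambda>x. weight x * t powr (- x)"] using dens_sums t by simp
    qed (simp_all add: dens_measure_def dens_mono dens_convex)
  qed
qed

end
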